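(* Let $G$ be a finite simple planar graph that contains no $4$-cycle adjacent to a $3$-cycle (i.e. no $4$-cycle and $3$-cycle sharing at least one edge). Then $\chi_{DP}(G)\le 4$, i.e. $G$ is DP-$4$-colorable.
   Context: DP-coloring: let $L$ be a list assignment of $G$ (a set $L(u)$ of colors for each vertex $u$). For each edge $uv$ let $M_{L,uv}$ be an arbitrary matching (possibly empty) between $\{u\}\times L(u)$ and $\{v\}\times L(v)$, and let $\mathcal{M}_L=\{M_{L,uv}: uv\in E(G)\}$. The $\mathcal{M}_L$-cover of $G$ is the graph $H$ with vertex set $\{(u,c): u\in V(G), c\in L(u)\}$ in which each $\{u\}\times L(u)$ induces a clique and, for each edge $uv$ of $G$, the edges between $\{u\}\times L(u)$ and $\{v\}\times L(v)$ are exactly those of $M_{L,uv}$ (and there are no edges between $\{u\}\times L(u)$ and $\{v\}\times L(v)$ when $uv\notin E(G)$). An $\mathcal{M}_L$-coloring of $G$ is an independent set of $H$ of size $|V(G)|$. The DP-chromatic number $\chi_{DP}(G)$ is the least $k$ such that $G$ has an $\mathcal{M}_L$-coloring for every list assignment $L$ with $|L(v)|\ge k$ for all $v$ and every matching assignment $\mathcal{M}_L$ over $L$; $G$ is DP-$k$-colorable if $\chi_{DP}(G)\le k$. *)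

theory Defs
  imports "HOL-Analysis.Analysis" "Graph_Theory.Graph_Theory"
begin

text \<open>
  A finite simple graph is a \<^term>\<open>pair_graph\<close>: an undirected edge \<open>uv\<close> is the pair of
  opposite arcs \<open>(u, v)\<close> and \<open>(v, u)\<close>.
\<close>

definition uedges :: "('a \<times> 'a) set \<Rightarrow> 'a set set" where
  "uedges A = (\<lambda>(u, v). {u, v}) ` A"


subsection \<open>Planarity\<close>

text \<open>
  A drawing places the vertices at distinct points of the plane and draws each edge as a Jordan arc
  joining its ends; an arc passes through no other vertex, and two arcs meet only at common ends.
\<close>

definition plane_drawing ::
    "'a pair_pre_digraph \<Rightarrow> ('a \<Rightarrow> complex) \<Rightarrow> ('a set \<Rightarrow> real \<Rightarrow> complex) \<Rightarrow> bool" where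
  "plane_drawing G p \<gamma> \<longleftrightarrow>
     inj_on p (pverts G) \<and>
     (\<forall>e \<in> uedges (parcs G).
        Path_Connected.arc (\<gamma> e) \<and>
        {pathstart (\<gamma> e), pathfinish (\<gamma> e)} = p ` e \<and>
        path_image (\<gamma> e) \<inter> p ` pverts G = p ` e) \<and>
     (\<forall>e \<in> uedges (parcs G). \<forall>e' \<in> uedges (parcs G). e \<noteq> e' \<longrightarrow>
        path_image (\<gamma> e) \<inter> path_image (\<gamma> e') \<subseteq> p ` (e \<inter> e'))"

definition planar :: "'a pair_pre_digraph \<Rightarrow> bool" where
  "planar G \<longleftrightarrow> (\<exists>p \<gamma>. plane_drawing G p \<gamma>)"


subsection \<open>Cycles sharing an edge\<close>

text \<open>
  \<^term>\<open>pre_digraph.cycle\<close> also admits the closed walk that goes back and forth along a single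
  edge, so for undirected graphs a lower bound on the length is needed.
\<close>

definition k_cycle :: "'a pair_pre_digraph \<Rightarrow> nat \<Rightarrow> ('a \<times> 'a) list \<Rightarrow> bool" where
  "k_cycle G k c \<longleftrightarrow> k \<ge> 3 \<and> pre_digraph.cycle (with_proj G) c \<and> length c = k"

definition adjacent_cycles :: "('a \<times> 'a) list \<Rightarrow> ('a \<times> 'a) list \<Rightarrow> bool" where
  "adjacent_cycles c d \<longleftrightarrow> uedges (set c) \<inter> uedges (set d) \<noteq> {}"


subsection \<open>DP-coloring\<close>

text \<open>
  Lists are finite sets, and the names of the colors are immaterial, so colors are taken from
  \<^typ>\<open>nat\<close>.
\<close>

type_synonym 'a list_assignment = "'a \<Rightarrow> nat set"

definition matching_between :: "'b set \<Rightarrow> 'b set \<Rightarrow> 'b set set \<Rightarrow> bool" where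
  "matching_between A B M \<longleftrightarrow> M \<subseteq> {{a, b} | a b. a \<in> A \<and> b \<in> B} \<and> pairwise disjnt M"

text \<open>A matching assignment is indexed by the undirected edges \<open>{u, v}\<close>.\<close>

type_synonym 'a matching_assignment = "'a set \<Rightarrow> ('a \<times> nat) set set"

definition matching_assignment ::
    "'a pair_pre_digraph \<Rightarrow> 'a list_assignment \<Rightarrow> 'a matching_assignment \<Rightarrow> bool" where
  "matching_assignment G L M \<longleftrightarrow>
     (\<forall>(u, v) \<in> parcs G. matching_between ({u} \<times> L u) ({v} \<times> L v) (M {u, v}))"

definition cover_graph ::
    "'a pair_pre_digraph \<Rightarrow> 'a list_assignment \<Rightarrow> 'a matching_assignment
      \<Rightarrow> ('a \<times> nat) pair_pre_digraph" where
  "cover_graph G L M =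
     \<lparr> pverts = Sigma (pverts G) L,
       parcs = {(x, y) | x y. x \<in> Sigma (pverts G) L \<and> y \<in> Sigma (pverts G) L \<and>
         (fst x = fst y \<and> x \<noteq> y \<or>
          (fst x, fst y) \<in> parcs G \<and> {x, y} \<in> M {fst x, fst y})} \<rparr>"

definition independent_set :: "'b pair_pre_digraph \<Rightarrow> 'b set \<Rightarrow> bool" where
  "independent_set H I \<longleftrightarrow> I \<subseteq> pverts H \<and> (\<forall>x \<in> I. \<forall>y \<in> I. (x, y) \<notin> parcs H)"

definition dp_coloring ::
    "'a pair_pre_digraph \<Rightarrow> 'a list_assignment \<Rightarrow> 'a matching_assignment \<Rightarrow> ('a \<times> nat) set \<Rightarrow> bool"
  where
  "dp_coloring G L M I \<longleftrightarrow>
     independent_set (cover_graph G L M) I \<and> card I = card (pverts G)"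

definition always_dp_colorable :: "'a pair_pre_digraph \<Rightarrow> nat \<Rightarrow> bool" where
  "always_dp_colorable G k \<longleftrightarrow>
     (\<forall>L M. (\<forall>v \<in> pverts G. finite (L v) \<and> k \<le> card (L v)) \<and> matching_assignment G L M \<longrightarrow>
        (\<exists>I. dp_coloring G L M I))"

definition chi_DP :: "'a pair_pre_digraph \<Rightarrow> nat" where
  "chi_DP G = (LEAST k. always_dp_colorable G k)"

text \<open>For a finite simple graph the minimum is attained, by a greedy choice of colors.\<close>

lemma always_dp_colorable_card:
  assumes "pair_graph G"
  shows "always_dp_colorable G (card (pverts G))"
  unfolding always_dp_colorable_def
proof (intro allI impI, elim conjE)
  fix L :: "'a list_assignment" and M :: "'a matching_assignment"
  assume L: "\<forall>v \<in> pverts G. finite (L v) \<and> card (pverts G) \<le> card (L v)"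
    and M: "matching_assignment G L M"
  interpret pair_graph G by fact
  let ?H = "cover_graph G L M"
  have sym: "(v, u) \<in> parcs G" if "(u, v) \<in> parcs G" for u v
    using pair_sym_arcs that by (auto simp: symmetric_def sym_def)
  have greedy: "\<exists>c. (\<forall>v \<in> S. c v \<in> L v) \<and>
      (\<forall>u \<in> S. \<forall>v \<in> S. (u, v) \<in> parcs G \<longrightarrow> {(u, c u), (v, c v)} \<notin> M {u, v})"
    if "finite S" "S \<subseteq> pverts G" for S
    using that
  proof (induction S)
    case empty
    then show ?case by simp
  next
    case (insert w S)
    then obtain c where c: "\<forall>v \<in> S. c v \<in> L v"
      "\<forall>u \<in> S. \<forall>v \<in> S. (u, v) \<in> parcs G \<longrightarrow> {(u, c u), (v, c v)} \<notin> M {u, v}"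
      by auto
    define F where
      "F u = {d. (u, w) \<in> parcs G \<and> {(u, c u), (w, d)} \<in> M {u, w}}" for u
    have F_le: "finite (F u) \<and> card (F u) \<le> 1" if "u \<in> S" for u
    proof -
      have "d = d'" if "d \<in> F u" "d' \<in> F u" for d d'
      proof (rule ccontr)
        assume "d \<noteq> d'"
        from that have e: "(u, w) \<in> parcs G" and
          m: "{(u, c u), (w, d)} \<in> M {u, w}" "{(u, c u), (w, d')} \<in> M {u, w}"
          by (auto simp: F_def)
        have "pairwise disjnt (M {u, w})"
          using M e by (auto simp: matching_assignment_def matching_between_def)
        moreover have "{(u, c u), (w, d)} \<noteq> {(u, c u), (w, d')}"
          using \<open>d \<noteq> d'\<close> by (auto simp: doubleton_eq_iff)
        ultimately have "disjnt {(u, c u), (w, d)} {(u, c u), (w, d')}"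
          using m by (metis pairwiseD)
        then show False by (simp add: disjnt_def)
      qed
      then have "F u = {} \<or> (\<exists>d. F u = {d})" by blast
      then show ?thesis by auto
    qed
    have "card (\<Union>u \<in> S. F u) \<le> (\<Sum>u \<in> S. card (F u))"
      by (rule card_UN_le) fact
    also have "\<dots> \<le> card S"
      using sum_mono[of S "\<lambda>u. card (F u)" "\<lambda>_. 1"] F_le by simp
    also have "\<dots> < card (insert w S)" using insert.hyps by simp
    also have "\<dots> \<le> card (pverts G)"
      by (rule card_mono[OF pair_finite_verts]) (use insert.prems in auto)
    also have "\<dots> \<le> card (L w)" using L insert.prems by auto
    finally have "card (\<Union>u \<in> S. F u) < card (L w)" .
    then have "\<not> L w \<subseteq> (\<Union>u \<in> S. F u)"
      using card_mono[of "\<Union>u \<in> S. F u" "L w"] F_le insert.hyps(1) by auto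
    then obtain d where d: "d \<in> L w" "\<And>u. u \<in> S \<Longrightarrow> d \<notin> F u" by blast
    let ?c = "c(w := d)"
    have new: "{(u, ?c u), (w, d)} \<notin> M {u, w}" if "u \<in> S" "(u, w) \<in> parcs G" for u
      using d(2)[OF that(1)] that insert.hyps(2) by (auto simp: F_def)
    have new': "{(w, d), (u, ?c u)} \<notin> M {w, u}" if "u \<in> S" "(w, u) \<in> parcs G" for u
      using new[OF that(1) sym[OF that(2)]] by (simp add: insert_commute)
    have "(w, w) \<notin> parcs G" using pair_no_loops[of "(w, w)"] by auto
    then have "\<forall>u \<in> insert w S. \<forall>v \<in> insert w S. (u, v) \<in> parcs G \<longrightarrow>
        {(u, ?c u), (v, ?c v)} \<notin> M {u, v}"
      using c(2) new new' insert.hyps(2) by auto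
    moreover have "\<forall>v \<in> insert w S. ?c v \<in> L v" using c(1) d(1) by auto
    ultimately show ?case by blast
  qed
  obtain c where c: "\<forall>v \<in> pverts G. c v \<in> L v"
    "\<forall>u \<in> pverts G. \<forall>v \<in> pverts G. (u, v) \<in> parcs G \<longrightarrow> {(u, c u), (v, c v)} \<notin> M {u, v}"
    using greedy[OF pair_finite_verts order_refl] by blast
  let ?I = "(\<lambda>v. (v, c v)) ` pverts G"
  have "independent_set ?H ?I"
    using c by (fastforce simp: independent_set_def cover_graph_def)
  moreover have "card ?I = card (pverts G)"
    by (rule card_image) (simp add: inj_on_def)
  ultimately show "\<exists>I. dp_coloring G L M I"
    unfolding dp_coloring_def by blast
qed

lemma chi_DP_le_iff:
  assumes "pair_graph G"
  shows "chi_DP G \<le> k \<longleftrightarrow> always_dp_colorable G k"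
proof
  assume "always_dp_colorable G k"
  then show "chi_DP G \<le> k" unfolding chi_DP_def by (rule Least_le)
next
  assume "chi_DP G \<le> k"
  moreover have "always_dp_colorable G (chi_DP G)"
    unfolding chi_DP_def by (rule LeastI) (rule always_dp_colorable_card[OF assms])
  ultimately show "always_dp_colorable G k"
    unfolding always_dp_colorable_def by (meson order_trans)
qed

end

theory Submission
  imports Defs "HOL-Complex_Analysis.Winding_Numbers"
begin

text \<open>
  It is easier to prove more: the color of one vertex, the root, may be prescribed. Colorings can
  then be glued at cut vertices, so a minimal counterexample is 2-connected; moreover all its
  vertices except the root have degree at least 4, and it contains no house (a 5-cycle with a
  triangle on one of its edges) that avoids the root and has only vertices of degree 4.

  An ear decomposition of a 2-connected plane graph yields a family of facial cycles that covers
  each edge twice and satisfies Euler's formula, because an ear splits a face into two faces by the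
  theta curve theorem. Give each vertex \<open>v\<close> the charge \<open>deg v - 4\<close> and each face the charge
  \<open>length - 4\<close>; the total is \<open>-8\<close>. Each triangle takes \<open>1/3\<close> across each of its edges, where a face
  of length at least 5 must lie. Only 5-faces with at least four triangles around them (the bad
  ones) become negative. They are paid by the big vertices, namely the root and the vertices of
  degree at least 5. The total is then at least \<open>-4\<close>, the charge of the root being the only negative
  one: a contradiction.
\<close>

text \<open>The hypothesis acts locally: two triangular faces never share an edge and a 4-face
  borders no triangle. A face of length l >= 4 with t triangles around it is thus left with l - 4 -
  t/3, which is negative only for l = 5 and t = 4 or 5; then 1/3 or 2/3 is missing. A vertex of
  degree d lies on at most d/2 triangles, and a big vertex gives at most 2/3 per triangle, that is
  d/3. This is at most d - 4 once d >= 6, and at most d at the root, whose degree has no lower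
  bound; hence the loss of 4 there. Degree 5 needs a finer count. A bad face without big vertices
  has no vertex that could pay for it. Here the house comes in: each triangle around such a face
  forms a house with it, in which only the tip of the triangle can fail to have degree 4 or be the
  root. So the tip is big and pays from a distance. The plane is used only to produce the facial
  cycles; after that, only incidences count.\<close>

hide_const (open) Digraph_Component.connected

subsection \<open>Edges of paths and cycles\<close>

fun path_edges :: "'a list \<Rightarrow> 'a set set" where
  "path_edges (x # y # zs) = insert {x, y} (path_edges (y # zs))"
| "path_edges _ = {}"

text \<open>A list of two vertices yields a single edge, so lists that stand for cycles are required
  to have length at least 3.\<close>

definition cycle_edges :: "'a list \<Rightarrow> 'a set set" where
  "cycle_edges xs = path_edges (xs @ [hd xs])"

lemma path_edges_Cons: "xs \<noteq> [] \<Longrightarrow> path_edges (x # xs) = insert {x, hd xs} (path_edges xs)"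
  by (cases xs) auto

lemma path_edges_append:
  "path_edges (xs @ x # ys) = path_edges (xs @ [x]) \<union> path_edges (x # ys)"
proof (induction xs)
  case (Cons z zs)
  then show ?case by (cases zs) (simp_all add: path_edges_Cons)
qed simp

lemma path_edges_rev [simp]: "path_edges (rev xs) = path_edges xs"
proof (induction xs rule: path_edges.induct)
  case (1 x y zs)
  have "path_edges (rev (x # y # zs)) = path_edges (rev zs @ [y]) \<union> path_edges [y, x]"
    using path_edges_append[of "rev zs" y "[x]"] by simp
  also have "\<dots> = path_edges (x # y # zs)" using 1 insert_commute[of x y "{}"] by simp
  finally show ?case .
qed auto

lemma Union_path_edges_subset: "\<Union>(path_edges xs) \<subseteq> set xs"
  by (induction xs rule: path_edges.induct) auto

lemma Union_path_edges: "length xs \<ge> 2 \<Longrightarrow> \<Union>(path_edges xs) = set xs"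
proof (induction xs rule: path_edges.induct)
  case (1 x y zs)
  then show ?case by (cases zs) auto
qed auto

lemma finite_path_edges [simp]: "finite (path_edges xs)"
  by (induction xs rule: path_edges.induct) auto

lemma path_edges_notin: "x \<notin> set xs \<Longrightarrow> e \<in> path_edges xs \<Longrightarrow> x \<notin> e"
  using Union_path_edges_subset[of xs] by blast

lemma card_path_edges: "distinct xs \<Longrightarrow> card (path_edges xs) = length xs - 1"
proof (induction xs rule: path_edges.induct)
  case (1 x y zs)
  have "{x, y} \<notin> path_edges (y # zs)"
    using 1(2) path_edges_notin[of x "y # zs" "{x, y}"] by fastforce
  then show ?case using 1 by simp
qed auto

lemma card_path_edge: "distinct xs \<Longrightarrow> e \<in> path_edges xs \<Longrightarrow> card e = 2"
  by (induction xs rule: path_edges.induct) auto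

lemma cycle_edges_Cons: "cycle_edges (x # xs) = path_edges (x # xs @ [x])"
  by (simp add: cycle_edges_def)

lemma cycle_edges_split:
  "cycle_edges (x # as @ y # bs) = path_edges (x # as @ [y]) \<union> path_edges (y # bs @ [x])"
  using path_edges_append[of "x # as" y "bs @ [x]"] by (simp add: cycle_edges_Cons)

lemma cycle_edges_rotate: "cycle_edges (xs @ ys) = cycle_edges (ys @ xs)"
  by (cases xs; cases ys) (auto simp: cycle_edges_split)

lemma finite_cycle_edges [simp]: "finite (cycle_edges xs)"
  by (simp add: cycle_edges_def)

lemma Union_cycle_edges: "xs \<noteq> [] \<Longrightarrow> \<Union>(cycle_edges xs) = set xs"
  unfolding cycle_edges_def by (subst Union_path_edges) (auto simp: Suc_le_eq)

text \<open>Serves to place the ends of an ear on a facial cycle, which then falls into the two arcs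
  between \<open>x\<close> and \<open>y\<close>.\<close>

lemma cycle_edges_rotate_to:
  assumes "x \<in> set xs" "y \<in> set xs" "x \<noteq> y" "distinct xs"
  obtains as bs where "distinct (x # as @ y # bs)" "length (x # as @ y # bs) = length xs"
    "cycle_edges (x # as @ y # bs) = cycle_edges xs"
proof -
  obtain us vs where xs: "xs = us @ x # vs" using assms(1) by (auto simp: in_set_conv_decomp)
  let ?ys = "(x # vs) @ us"
  have y: "y \<in> set (vs @ us)" using assms(2,3) xs by auto
  then obtain as bs where ab: "vs @ us = as @ y # bs" by (meson in_set_conv_decomp)
  have "cycle_edges xs = cycle_edges ?ys" unfolding xs by (rule cycle_edges_rotate)
  moreover have eq: "?ys = x # as @ y # bs" using ab by simp
  moreover have "distinct ?ys" "length ?ys = length xs" using assms(4) xs by auto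
  ultimately show thesis using that[of as bs] by auto
qed

lemma card_cycle_edges:
  assumes "distinct xs" "length xs \<ge> 3"
  shows "card (cycle_edges xs) = length xs"
proof -
  obtain x y z zs where xs: "xs = x # y # z # zs"
    using assms(2) by (auto simp: Suc_le_length_iff eval_nat_numeral)
  have c: "cycle_edges xs = insert {x, y} (path_edges (y # z # zs @ [x]))"
    by (simp add: xs cycle_edges_Cons)
  have "{x, y} \<notin> path_edges (y # z # zs @ [x])"
    using path_edges_notin[of y "z # zs @ [x]" "{x,y}"] assms xs
    by (auto simp: doubleton_eq_iff)
  moreover have "card (path_edges (y # z # zs @ [x])) = length xs - 1"
    using card_path_edges[of "y # z # zs @ [x]"] assms(1)
    by (auto simp: xs simp del: path_edges.simps)
  ultimately show ?thesis using c by (simp add: xs)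
qed

lemma cycle_edges_at:
  assumes "distinct xs" "length xs \<ge> 3" "v \<in> set xs"
  obtains a b where "a \<noteq> b" "a \<in> set xs" "b \<in> set xs" "a \<noteq> v" "b \<noteq> v"
    "{e \<in> cycle_edges xs. v \<in> e} = {{v, a}, {v, b}}"
proof -
  obtain us vs where xs: "xs = us @ v # vs" using assms(3) by (auto simp: in_set_conv_decomp)
  let ?ys = "v # vs @ us"
  have c: "cycle_edges xs = cycle_edges ?ys"
    unfolding xs using cycle_edges_rotate[of us "v # vs"] by simp
  have d: "distinct ?ys" "length ?ys = length xs" "set ?ys = set xs" using assms(1) xs by auto
  obtain a zs where "vs @ us = a # zs" using assms(2) xs by (cases "vs @ us") auto
  moreover obtain ws b where "zs = ws @ [b]" using assms(2) d calculation
    by (cases zs rule: rev_cases) auto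
  ultimately have ys: "?ys = v # a # ws @ [b]" by simp
  have "cycle_edges ?ys = {{v, a}, {v, b}} \<union> path_edges (a # ws @ [b])"
    using path_edges_append[of "a # ws" b "[v]"] unfolding ys by (auto simp: cycle_edges_Cons)
  moreover have "v \<notin> set (a # ws @ [b])" using d(1) ys by auto
  ultimately have "{e \<in> cycle_edges xs. v \<in> e} = {{v, a}, {v, b}}"
    using c path_edges_notin[of v "a # ws @ [b]"] by auto
  moreover have "a \<noteq> b" "a \<in> set xs" "b \<in> set xs" "a \<noteq> v" "b \<noteq> v"
    using d(1) d(3)[symmetric] unfolding ys by auto
  ultimately show thesis by (intro that)
qed

subsection \<open>Theta curves\<close>

lemma Jordan_arcs:
  fixes c1 c2 :: "real \<Rightarrow> complex"
  assumes "arc c1" "arc c2" "pathstart c1 = a" "pathfinish c1 = b" "pathstart c2 = a"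
    "pathfinish c2 = b"
    "path_image c1 \<inter> path_image c2 = {a, b}"
  shows "simple_path (c1 +++ reversepath c2)"
    "pathfinish (c1 +++ reversepath c2) = pathstart (c1 +++ reversepath c2)"
    "path_image (c1 +++ reversepath c2) = path_image c1 \<union> path_image c2"
proof -
  show "simple_path (c1 +++ reversepath c2)"
    by (rule simple_path_join_loop) (use assms in \<open>auto simp: arc_reversepath\<close>)
  show "path_image (c1 +++ reversepath c2) = path_image c1 \<union> path_image c2"
    using assms by (subst path_image_join) auto
qed (use assms in auto)

text \<open>
  For a point inside one of the three closed curves but outside the other two, exactly one of the
  three winding numbers would be nonzero, whereas they add up to zero with suitable signs.
\<close>

lemma theta_nested:
  fixes c1 c2 c :: "real \<Rightarrow> complex"
  assumes arcs: "arc c1" "arc c2" "arc c"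
    and ends: "pathstart c1 = a" "pathfinish c1 = b" "pathstart c2 = a" "pathfinish c2 = b"
      "pathstart c = a" "pathfinish c = b"
    and int: "path_image c1 \<inter> path_image c2 = {a, b}"
      "path_image c1 \<inter> path_image c = {a, b}"
      "path_image c2 \<inter> path_image c = {a, b}"
  shows "path_image c \<inter> inside (path_image c1 \<union> path_image c2) \<noteq> {} \<or>
         path_image c1 \<inter> inside (path_image c2 \<union> path_image c) \<noteq> {} \<or>
         path_image c2 \<inter> inside (path_image c1 \<union> path_image c) \<noteq> {}"
proof (rule ccontr)
  assume "\<not> ?thesis"
  then have n: "path_image c \<inter> inside (path_image c1 \<union> path_image c2) = {}"
    "path_image c1 \<inter> inside (path_image c2 \<union> path_image c) = {}"
    "path_image c2 \<inter> inside (path_image c1 \<union> path_image c) = {}" by auto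
  note J12 = Jordan_arcs[OF arcs(1,2) ends(1-4) int(1)]
  note J1 = Jordan_arcs[OF arcs(1,3) ends(1,2,5,6) int(2)]
  note J2 = Jordan_arcs[OF arcs(2,3) ends(3-6) int(3)]
  note I12 = Jordan_inside_outside[OF J12(1,2), unfolded J12(3)]
  note I1 = Jordan_inside_outside[OF J1(1,2), unfolded J1(3)]
  note I2 = Jordan_inside_outside[OF J2(1,2), unfolded J2(3)]
  have co: "inside (path_image c1 \<union> path_image c2) \<in> components (- (path_image c1 \<union> path_image c2))"
    "inside (path_image c1 \<union> path_image c) \<in> components (- (path_image c1 \<union> path_image c))"
    "inside (path_image c2 \<union> path_image c) \<in> components (- (path_image c2 \<union> path_image c))"
    unfolding inside_in_components using I12 I1 I2 by simp_all
  \<comment> \<open>An inside that avoids the other curve is a connected subset of its complement,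
    hence lies in one component. So two insides that avoid each other's curves and meet are
    equal.\<close>
  have eqI: "inside S = inside T"
    if "inside S \<in> components (- S)" "inside T \<in> components (- T)"
     "connected (inside S)" "connected (inside T)"
     "inside S \<inter> T = {}" "inside T \<inter> S = {}"
     "inside S \<inter> inside T \<noteq> {}" for S T :: "complex set"
    using components_maximal[OF that(1) that(4)] components_maximal[OF that(2) that(3)] that
    inside_no_overlap[of S] inside_no_overlap[of T] by blast
  have "path_image c2 - {a, b} \<noteq> {}" "path_image c1 - {a, b} \<noteq> {}"
    using arcs nonempty_simple_path_endless arc_imp_simple_path ends by metis+
  then have "path_image c1 \<union> path_image c \<noteq> path_image c2 \<union> path_image c"
    "path_image c1 \<union> path_image c \<noteq> path_image c1 \<union> path_image c2"
    using int by blast+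
  \<comment> \<open>Each Jordan curve is the frontier of its inside, so different curves have
    different insides.\<close>
  then have "inside (path_image c1 \<union> path_image c) \<noteq> inside (path_image c2 \<union> path_image c)"
    "inside (path_image c1 \<union> path_image c) \<noteq> inside (path_image c1 \<union> path_image c2)"
    using I1 I2 I12 by metis+
  note neq = this
  have no: "inside (path_image c1 \<union> path_image c) \<inter> (path_image c1 \<union> path_image c) = {}"
    "inside (path_image c2 \<union> path_image c) \<inter> (path_image c2 \<union> path_image c) = {}"
    "inside (path_image c1 \<union> path_image c2) \<inter> (path_image c1 \<union> path_image c2) = {}"
    by (rule inside_no_overlap)+
  have d: "inside (path_image c1 \<union> path_image c) \<inter> (path_image c2 \<union> path_image c) = {}"
    "inside (path_image c2 \<union> path_image c) \<inter> (path_image c1 \<union> path_image c) = {}"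
    "inside (path_image c1 \<union> path_image c) \<inter> (path_image c1 \<union> path_image c2) = {}"
    "inside (path_image c1 \<union> path_image c2) \<inter> (path_image c1 \<union> path_image c) = {}"
    using no n by blast+
  have dis: "inside (path_image c1 \<union> path_image c) \<inter> inside (path_image c2 \<union> path_image c) = {}"
    "inside (path_image c1 \<union> path_image c) \<inter> inside (path_image c1 \<union> path_image c2) = {}"
    using eqI[OF co(2,3) _ _ d(1,2)] eqI[OF co(2,1) _ _ d(3,4)] I1 I2 I12 neq by metis+
  obtain z where z: "z \<in> inside (path_image c1 \<union> path_image c)" using I1 by auto
  have zn: "z \<notin> path_image c1" "z \<notin> path_image c" "z \<notin> path_image c2"
    using z no n by blast+
  have "z \<in> outside (path_image c2 \<union> path_image c)"
    "z \<in> outside (path_image c1 \<union> path_image c2)"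
    using z zn dis by (auto simp: inside_Int_outside outside_inside)
  then have w: "winding_number (c2 +++ reversepath c) z = 0"
    "winding_number (c1 +++ reversepath c2) z = 0"
    using winding_number_zero_in_outside[OF simple_path_imp_path[OF J2(1)] J2(2)]
      winding_number_zero_in_outside[OF simple_path_imp_path[OF J12(1)] J12(2)] J2(3) J12(3)
        by simp_all
  have w1: "winding_number (c1 +++ reversepath c) z \<noteq> 0"
    using simple_closed_path_winding_number_inside[OF J1(1)] z unfolding J1(3)
    by (metis zero_neq_one neg_0_equal_iff_equal)
  have [simp]: "path c1" "path c2" "path c" using arcs by (auto simp: arc_imp_path)
  show False using w w1 zn ends
    by (simp add: winding_number_join winding_number_reversepath)
qed

text \<open>The set algebra of the case where the arc \<open>C1\<close> runs inside the closed curve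
  \<open>C2 \<union> C\<close> and cuts its inside into \<open>I12\<close> and \<open>I1\<close>.
  With plain set variables the claim is propositional at each point.\<close>

lemma theta_outside_sets:
  assumes "C1 \<inter> C2 = E" "C1 \<inter> C = E" "C2 \<inter> C = E"
    and "I12 \<union> O12 = - (C1 \<union> C2)" "I12 \<inter> O12 = {}"
    and "I2 \<union> O2 = - (C2 \<union> C)" "I2 \<inter> O2 = {}"
    and "I1 \<inter> C = {}" "I1 \<inter> C1 = {}" "I12 \<inter> I1 = {}"
      "I12 \<union> I1 \<union> (C1 - E) = I2"
  shows "O12 - C = I1 \<union> O2"
proof (rule set_eqI)
  fix x
  have "x \<in> E \<longleftrightarrow> x \<in> C1 \<and> x \<in> C2"
    "x \<in> E \<longleftrightarrow> x \<in> C1 \<and> x \<in> C"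
    "x \<in> E \<longleftrightarrow> x \<in> C2 \<and> x \<in> C"
    "x \<in> I12 \<or> x \<in> O12 \<longleftrightarrow> x \<notin> C1 \<and> x \<notin> C2"
    "\<not> (x \<in> I12 \<and> x \<in> O12)"
    "x \<in> I2 \<or> x \<in> O2 \<longleftrightarrow> x \<notin> C2 \<and> x \<notin> C"
    "\<not> (x \<in> I2 \<and> x \<in> O2)"
    "\<not> (x \<in> I1 \<and> x \<in> C)" "\<not> (x \<in> I1 \<and> x \<in> C1)"
    "\<not> (x \<in> I12 \<and> x \<in> I1)"
    "x \<in> I2 \<longleftrightarrow> x \<in> I12 \<or> x \<in> I1 \<or> x \<in> C1 \<and> x \<notin> E"
    using assms by (simp_all add: set_eq_iff)
  then show "x \<in> O12 - C \<longleftrightarrow> x \<in> I1 \<union> O2"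
    unfolding Un_iff Diff_iff by argo
qed

text \<open>If \<open>R\<close> is the inside of the closed curve, this is the usual splitting of an
  inside by a cross arc. If \<open>R\<close> is the outside, some arc must still run inside the
  curve formed by the other two, and it is \<open>c1\<close> or \<open>c2\<close>; splitting that
  inside and taking complements gives the claim.\<close>

lemma theta_split:
  fixes c1 c2 c :: "real \<Rightarrow> complex"
  assumes arcs: "arc c1" "arc c2" "arc c"
    and ends: "pathstart c1 = a" "pathfinish c1 = b" "pathstart c2 = a" "pathfinish c2 = b"
      "pathstart c = a" "pathfinish c = b"
    and int: "path_image c1 \<inter> path_image c2 = {a, b}"
      "path_image c1 \<inter> path_image c = {a, b}"
      "path_image c2 \<inter> path_image c = {a, b}"
    and R: "R \<in> components (- (path_image c1 \<union> path_image c2))"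
      "path_image c - {a, b} \<subseteq> R"
  obtains R1 R2 where "R1 \<in> components (- (path_image c1 \<union> path_image c))"
    "R2 \<in> components (- (path_image c2 \<union> path_image c))"
    "R - path_image c = R1 \<union> R2" "R1 \<inter> R2 = {}"
proof -
  note J12 = Jordan_arcs[OF arcs(1,2) ends(1-4) int(1)]
  note J1 = Jordan_arcs[OF arcs(1,3) ends(1,2,5,6) int(2)]
  note J2 = Jordan_arcs[OF arcs(2,3) ends(3-6) int(3)]
  note I12 = Jordan_inside_outside[OF J12(1,2), unfolded J12(3)]
  note I1 = Jordan_inside_outside[OF J1(1,2), unfolded J1(3)]
  note I2 = Jordan_inside_outside[OF J2(1,2), unfolded J2(3)]
  have "a \<noteq> b" using arcs(1) ends arc_distinct_ends by blast
  have ne: "path_image c2 - {a, b} \<noteq> {}" "path_image c1 - {a, b} \<noteq> {}"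
    "path_image c - {a, b} \<noteq> {}"
    using arcs nonempty_simple_path_endless arc_imp_simple_path ends by metis+
  let ?I12 = "inside (path_image c1 \<union> path_image c2)" and ?O12 = "outside (path_image c1 \<union> path_image c2)"
  let ?I1 = "inside (path_image c1 \<union> path_image c)" and ?O1 = "outside (path_image c1 \<union> path_image c)"
  let ?I2 = "inside (path_image c2 \<union> path_image c)" and ?O2 = "outside (path_image c2 \<union> path_image c)"
  have comp: "?I12 \<in> components (- (path_image c1 \<union> path_image c2))"
     "?O12 \<in> components (- (path_image c1 \<union> path_image c2))"
     "?I1 \<in> components (- (path_image c1 \<union> path_image c))"
     "?O1 \<in> components (- (path_image c1 \<union> path_image c))"
     "?I2 \<in> components (- (path_image c2 \<union> path_image c))"
     "?O2 \<in> components (- (path_image c2 \<union> path_image c))"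
    unfolding inside_in_components outside_in_components using I12 I1 I2 by simp_all
  have U: "?I12 \<union> ?O12 = - (path_image c1 \<union> path_image c2)" "?I12 \<inter> ?O12 = {}"
     "?I1 \<union> ?O1 = - (path_image c1 \<union> path_image c)" "?I1 \<inter> ?O1 = {}"
     "?I2 \<union> ?O2 = - (path_image c2 \<union> path_image c)" "?I2 \<inter> ?O2 = {}"
    by (simp_all add: inside_Un_outside inside_Int_outside)
  have "R \<inter> (?I12 \<union> ?O12) \<noteq> {}"
    using R(1) U(1) in_components_nonempty in_components_subset by fastforce
  then consider "R = ?I12" | "R = ?O12" 
    using components_nonoverlap[OF R(1) comp(1)] components_nonoverlap[OF R(1) comp(2)] by blast
  then show thesis
  proof cases
    case 1
    then have "path_image c \<inter> ?I12 \<noteq> {}" using R(2) ne(3) by auto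
    from split_inside_simple_closed_curve[OF arc_imp_simple_path[OF arcs(1)] ends(1,2) arc_imp_simple_path[OF arcs(2)] ends(3,4)
       arc_imp_simple_path[OF arcs(3)] ends(5,6) \<open>a \<noteq> b\<close> int this]
    have sp: "?I1 \<inter> ?I2 = {} \<and> ?I1 \<union> ?I2 \<union> (path_image c - {a, b}) = ?I12"
      by blast
    moreover have "(?I1 \<union> ?I2) \<inter> path_image c = {}" using U by blast
    ultimately have "R - path_image c = ?I1 \<union> ?I2" using 1 by blast
    then show thesis by (rule that[OF comp(3,5)]) (use sp in blast)
  next
    case 2
    have "path_image c \<subseteq> ?O12 \<union> {a, b}" using R(2) 2 by auto
    moreover have "{a, b} \<inter> ?I12 = {}" using int(1) U(1) by blast
    ultimately have "path_image c \<inter> ?I12 = {}" using U(2) by blast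
    then consider "path_image c1 \<inter> ?I2 \<noteq> {}"
      | "path_image c2 \<inter> ?I1 \<noteq> {}"
      using theta_nested[OF arcs ends int] by blast
    then show thesis
    proof cases
      case i: 1
      have *: "path_image c2 \<inter> path_image c1 = {a, b}" "path_image c \<inter> path_image c1 = {a, b}"
        using int by auto
      from split_inside_simple_closed_curve[OF arc_imp_simple_path[OF arcs(2)] ends(3,4) arc_imp_simple_path[OF arcs(3)] ends(5,6)
       arc_imp_simple_path[OF arcs(1)] ends(1,2) \<open>a \<noteq> b\<close> int(3) * i]
      have "inside (path_image c2 \<union> path_image c1) \<inter> inside (path_image c \<union> path_image c1) = {} \<and>
        inside (path_image c2 \<union> path_image c1) \<union> inside (path_image c \<union> path_image c1) \<union>
        (path_image c1 - {a, b}) = ?I2" by blast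
      note e = this[unfolded Un_commute[of "path_image c2" "path_image c1"] Un_commute[of "path_image c" "path_image c1"],
        THEN conjunct1] this[unfolded Un_commute[of "path_image c2" "path_image c1"]
          Un_commute[of "path_image c" "path_image c1"],
        THEN conjunct2]
      have "?I1 \<inter> path_image c = {}" "?I1 \<inter> path_image c1 = {}" using U(3) by blast+
      then have "R - path_image c = ?I1 \<union> ?O2" unfolding 2
        by (rule theta_outside_sets[OF int U(1,2,5,6) _ _ e])
      then show thesis by (rule that[OF comp(3,6)]) (use e(2) U(6) in blast)
    next
      case i: 2
      have *: "path_image c \<inter> path_image c2 = {a, b}" using int by auto
      from split_inside_simple_closed_curve[OF arc_imp_simple_path[OF arcs(1)] ends(1,2) arc_imp_simple_path[OF arcs(3)] ends(5,6)
       arc_imp_simple_path[OF arcs(2)] ends(3,4) \<open>a \<noteq> b\<close> int(2,1) * i]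
      have "?I12 \<inter> inside (path_image c \<union> path_image c2) = {} \<and>
        ?I12 \<union> inside (path_image c \<union> path_image c2) \<union> (path_image c2 - {a, b}) = ?I1" by blast
      note e = this[unfolded Un_commute[of "path_image c" "path_image c2"], THEN conjunct1]
        this[unfolded Un_commute[of "path_image c" "path_image c2"], THEN conjunct2]
      have "?I2 \<inter> path_image c = {}" "?I2 \<inter> path_image c2 = {}" using U(5) by blast+
      moreover have "path_image c2 \<inter> path_image c1 = {a, b}"
        "?I12 \<union> ?O12 = - (path_image c2 \<union> path_image c1)"
        using int(1) U(1) by blast+
      ultimately have "R - path_image c = ?I2 \<union> ?O1" unfolding 2
        using theta_outside_sets[OF _ int(3,2) _ U(2,3,4) _ _ e] by blast
      then have "R - path_image c = ?O1 \<union> ?I2" by blast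
      then show thesis by (rule that[OF comp(4,5)]) (use e(2) U(4) in blast)
    qed
  qed
qed

subsection \<open>Facial cycles and ears\<close>

text \<open>
  The cycles \<open>D i\<close> with \<open>i < n\<close> play the role of the face boundaries. A graph that is a single
  cycle bounds both of its faces, which is why repetitions must be allowed for \<open>n = 2\<close>.
\<close>

definition cycle_cover :: "'a set set \<Rightarrow> nat \<Rightarrow> (nat \<Rightarrow> 'a list) \<Rightarrow> bool" where
  "cycle_cover F n D \<longleftrightarrow>
     finite F \<and>
     (\<forall>i<n. distinct (D i) \<and> length (D i) \<ge> 3 \<and> cycle_edges (D i) \<subseteq> F) \<and>
     (\<forall>e\<in>F. card {i. i < n \<and> e \<in> cycle_edges (D i)} = 2) \<and>
     card (\<Union>F) + n = card F + 2 \<and>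
     (n = 2 \<or> inj_on (\<lambda>i. cycle_edges (D i)) {..<n})"

lemma cycle_cover_single:
  assumes "distinct xs" "length xs \<ge> 3"
  shows "cycle_cover (cycle_edges xs) 2 (\<lambda>_. xs)"
proof -
  have "xs \<noteq> []" using assms by auto
  moreover have "{i. i < 2 \<and> e \<in> cycle_edges xs} = {0, 1 :: nat}"
    if "e \<in> cycle_edges xs" for e
    using that by auto
  ultimately show ?thesis
    using assms by (simp add: cycle_cover_def card_cycle_edges Union_cycle_edges distinct_card)
qed

text \<open>A common edge has both ends in \<open>{x, y}\<close>, so it is \<open>{x, y}\<close>.
  Then both halves consist of this edge alone and the cycle has only two vertices.\<close>

lemma cycle_halves_disjoint:
  assumes "distinct (x # as @ y # bs)" "length (x # as @ y # bs) \<ge> 3"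
  shows "path_edges (x # as @ [y]) \<inter> path_edges (y # bs @ [x]) = {}"
proof (rule ccontr)
  assume "\<not> ?thesis"
  then obtain e where e: "e \<in> path_edges (x # as @ [y])" "e \<in> path_edges (y # bs @ [x])"
    by auto
  then have "e \<subseteq> {x, y}"
    using Union_path_edges_subset[of "x # as @ [y]"] Union_path_edges_subset[of "y # bs @ [x]"] assms(1)
    by fastforce
  moreover have "card e = 2" using e(1) card_path_edge[of "x # as @ [y]"] assms(1) by auto
  ultimately have exy: "e = {x, y}" using assms(1)
    by (metis card_2_iff card_subset_eq finite.emptyI finite.insertI distinct.simps(2) in_set_conv_decomp)
  have "as = []"
  proof (cases as)
    case (Cons z zs)
    then show ?thesis using e(1) exy path_edges_notin[of x "z # zs @ [y]" e] assms(1)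
      by (auto simp: doubleton_eq_iff)
  qed simp
  moreover have "bs = []"
  proof (cases bs)
    case (Cons z zs)
    then show ?thesis using e(2) exy path_edges_notin[of y "z # zs @ [x]" e] assms(1)
      by (auto simp: doubleton_eq_iff)
  qed simp
  ultimately show False using assms(2) by simp
qed

text \<open>The ear \<open>P\<close> turns the cycle \<open>A \<union> B\<close> into
  \<open>A \<union> P\<close>, which keeps the index \<open>i\<close>, and
  \<open>P \<union> B\<close>, which gets the index \<open>n\<close>. Euler's formula persists:
  there is one new face, and the ear has one more new edge than new vertices.\<close>

lemma cycle_cover_ear:
  assumes cc: "cycle_cover F n D" and i: "i < n"
    and D: "distinct (x # as @ y # bs)" "cycle_edges (x # as @ y # bs) = cycle_edges (D i)"
    and ps: "distinct (x # ps @ [y])" "set ps \<inter> \<Union>F = {}"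
      "path_edges (x # ps @ [y]) \<inter> F = {}"
    and fin: "finite (\<Union>F)"
  shows "cycle_cover (F \<union> path_edges (x # ps @ [y])) (Suc n)
           (D(i := x # as @ y # rev ps, n := x # ps @ y # bs))" (is "cycle_cover _ _ ?D")
proof -
  define P where "P = path_edges (x # ps @ [y])"
  define A where "A = path_edges (x # as @ [y])"
  define B where "B = path_edges (y # bs @ [x])"
  have Di: "cycle_edges (D i) = A \<union> B"
    using D(2) cycle_edges_split[of x as y bs] by (simp add: A_def B_def)
  have sub: "A \<subseteq> F" "B \<subseteq> F" using cc i Di by (auto simp: cycle_cover_def)
  have "length (x # as @ y # bs) \<ge> 3"
  proof (rule ccontr)
    assume "\<not> ?thesis"
    then have "cycle_edges (D i) = {{x, y}}"
      using Di by (auto simp: A_def B_def not_le less_Suc_eq_le)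
    then show False using cc i card_cycle_edges[of "D i"] by (auto simp: cycle_cover_def)
  qed
  then have AB: "A \<inter> B = {}" unfolding A_def B_def by (rule cycle_halves_disjoint[OF D(1)])
  have PF: "P \<inter> F = {}" using ps(3) by (simp add: P_def)
  have finF: "finite F" using cc by (simp add: cycle_cover_def)
  have revP: "path_edges (y # rev ps @ [x]) = P"
    using path_edges_rev[of "x # ps @ [y]"] by (simp add: P_def)
  have new: "cycle_edges (x # as @ y # rev ps) = A \<union> P"
    "cycle_edges (x # ps @ y # bs) = P \<union> B"
    unfolding cycle_edges_split revP by (simp_all add: A_def B_def P_def)
  have Pne: "P \<noteq> {}" "A \<noteq> {}" "B \<noteq> {}"
    by (simp_all add: P_def A_def B_def path_edges_Cons)
  define D' where "D' = ?D"
  have D': "D' i = x # as @ y # rev ps" "D' n = x # ps @ y # bs"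
    "\<And>j. j \<noteq> i \<Longrightarrow> j \<noteq> n \<Longrightarrow> D' j = D j"
    using i by (auto simp: D'_def)
  let ?c = "\<lambda>j. cycle_edges (D' j)"
  have c: "?c i = A \<union> P" "?c n = P \<union> B"
    "\<And>j. j \<noteq> i \<Longrightarrow> j \<noteq> n \<Longrightarrow> ?c j = cycle_edges (D j)"
    using D' new by auto
  have cP: "cycle_edges (D j) \<inter> P = {}" if "j < n" for j
    using cc that PF by (auto simp: cycle_cover_def)
  have xyUF: "x \<in> \<Union>F" "y \<in> \<Union>F"
  proof -
    have "set (x # as @ y # bs) = \<Union>(cycle_edges (D i))"
      using Union_cycle_edges[of "x # as @ y # bs"] D(2) by simp
    also have "\<dots> \<subseteq> \<Union>F" using cc i by (auto simp: cycle_cover_def)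
    finally show "x \<in> \<Union>F" "y \<in> \<Union>F" by auto
  qed
  have "distinct (D' j) \<and> length (D' j) \<ge> 3 \<and> ?c j \<subseteq> F \<union> P"
    if "j < Suc n" for j
  proof -
    consider "j = i" | "j = n" | "j < n" "j \<noteq> i" using \<open>j < Suc n\<close> by linarith
    then show ?thesis
    proof cases
      case 1
      have "set as \<subseteq> \<Union>F"
        using Union_path_edges[of "x # as @ [y]"] sub(1) by (auto simp: A_def)
      then have "distinct (x # as @ y # rev ps)" using D(1) ps by auto
      moreover have "as \<noteq> [] \<or> ps \<noteq> []"
        using PF sub(1) by (auto simp: A_def P_def)
      then have "length (x # as @ y # rev ps) \<ge> 3" by (cases as; cases ps) auto
      ultimately show ?thesis using 1 D'(1) c(1) sub by auto
    next
      case 2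
      have "set bs \<subseteq> \<Union>F"
        using Union_path_edges[of "y # bs @ [x]"] sub(2) by (auto simp: B_def)
      then have "distinct (x # ps @ y # bs)" using D(1) ps by auto
      moreover have "bs \<noteq> [] \<or> ps \<noteq> []"
        using PF sub(2) by (auto simp: B_def P_def insert_commute)
      then have "length (x # ps @ y # bs) \<ge> 3" by (cases bs; cases ps) auto
      ultimately show ?thesis using 2 D'(2) c(2) sub by auto
    next
      case 3
      then show ?thesis using cc D'(3)[of j] by (auto simp: cycle_cover_def)
    qed
  qed
  moreover have "card {j. j < Suc n \<and> e \<in> ?c j} = 2" if e: "e \<in> F \<union> P" for e
  proof (cases "e \<in> P")
    case True
    have "j < Suc n \<and> e \<in> ?c j \<longleftrightarrow> j = i \<or> j = n" for j
      using True c cP[of j] i by (cases "j = i"; cases "j = n") auto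
    then have "{j. j < Suc n \<and> e \<in> ?c j} = {i, n}" by blast
    then show ?thesis using i by simp
  next
    case False
    let ?S = "{j. j < n \<and> e \<in> cycle_edges (D j)}"
    have S: "card ?S = 2" "finite ?S" using cc e False by (auto simp: cycle_cover_def)
    show ?thesis
    proof (cases "e \<in> B")
      \<comment> \<open>An edge of \<open>B\<close> leaves the cycle with index \<open>i\<close> for
        the one with index \<open>n\<close>, so its number of faces is unchanged.\<close>
      case True
      then have iS: "e \<notin> A" "i \<in> ?S" using AB Di i by auto
      have "j < Suc n \<and> e \<in> ?c j \<longleftrightarrow> j = n \<or> j < n \<and> e \<in> cycle_edges (D j) \<and> j \<noteq> i"
        for j
        using False True c(1) c(2) c(3)[of j] i iS(1) by (cases "j = i"; cases "j = n") auto
      then have "{j. j < Suc n \<and> e \<in> ?c j} = insert n (?S - {i})" by blast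
      moreover have "card (insert n (?S - {i})) = Suc (card (?S - {i}))"
        by (rule card_insert_disjoint) (use S in auto)
      moreover have "Suc (card (?S - {i})) = card ?S" by (rule card_Suc_Diff1[OF S(2) iS(2)])
      ultimately show ?thesis using S(1) by metis
    next
      case nB: False
      have "j < Suc n \<and> e \<in> ?c j \<longleftrightarrow> j < n \<and> e \<in> cycle_edges (D j)"
        for j
        using False nB c(1) c(2) c(3)[of j] i Di by (cases "j = i"; cases "j = n") auto
      then show ?thesis using S(1) by simp
    qed
  qed
  moreover have "card (\<Union>(F \<union> P)) + Suc n = card (F \<union> P) + 2"
  proof -
    have "\<Union>(F \<union> P) = \<Union>F \<union> set ps"
      using Union_path_edges[of "x # ps @ [y]"] xyUF by (auto simp: P_def)
    then have "card (\<Union>(F \<union> P)) = card (\<Union>F) + length ps"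
      using fin ps by (simp add: card_Un_disjoint Int_commute distinct_card)
    moreover have "card (F \<union> P) = card F + (length ps + 1)"
      using card_path_edges[OF ps(1)] finF PF by (subst card_Un_disjoint) (auto simp: P_def)
    moreover have "card (\<Union>F) + n = card F + 2" using cc by (simp add: cycle_cover_def)
    ultimately show ?thesis by linarith
  qed
  moreover have "inj_on ?c {..<Suc n}"
  proof -
    have AB': "A \<union> P \<noteq> P \<union> B" using AB Pne PF sub by blast
    have old: "cycle_edges (D j) \<noteq> cycle_edges (D k)"
      if "j < n" "k < n" "j \<noteq> k" "j \<noteq> i" "k \<noteq> i" for j k
    proof -
      \<comment> \<open>For \<open>n = 2\<close> both cycles may coincide, but only one of them
        survives the ear, so the first ear ends all repetitions.\<close>
      have "n \<noteq> 2" using that i by linarith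
      then show ?thesis using cc that by (auto simp: cycle_cover_def inj_on_def)
    qed
    have oldP: "cycle_edges (D j) \<noteq> A \<union> P" "cycle_edges (D j) \<noteq> P \<union> B"
      if "j < n" for j
      using cP[OF that] Pne by blast+
    show ?thesis
    proof (rule inj_onI, rule ccontr)
      fix j k assume jk: "j \<in> {..<Suc n}" "k \<in> {..<Suc n}" "?c j = ?c k" "j \<noteq> k"
      have cas: "j = i \<or> j = n \<or> j < n \<and> j \<noteq> i" "k = i \<or> k = n \<or> k < n \<and> k \<noteq> i"
        using jk by auto
      show False
        using cas jk(3,4) c(1) c(2) c(3)[of j] c(3)[of k] AB' old[of j k] oldP[of j] oldP[of k] i
        by (elim disjE) auto
    qed
  qed
  moreover have "finite (F \<union> P)" using finF by (simp add: P_def)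
  ultimately have "cycle_cover (F \<union> P) (Suc n) D'" unfolding cycle_cover_def by blast
  then show ?thesis by (simp only: P_def D'_def)
qed

text \<open>One drawing is fixed for the whole proof. Subgraphs are edge sets
  \<open>F \<subseteq> E\<close> within it, so they need no drawings of their own.\<close>

locale drawn_graph =
  fixes V :: "'a set" and E :: "'a set set" and p :: "'a \<Rightarrow> complex" and \<gamma> :: "'a set \<Rightarrow> real \<Rightarrow> complex"
  assumes finite_V: "finite V"
    and edge: "e \<in> E \<Longrightarrow> e \<subseteq> V \<and> card e = 2"
    and inj_p: "inj_on p V"
    and arc_edge: "e \<in> E \<Longrightarrow> arc (\<gamma> e)"
    and ends_edge: "e \<in> E \<Longrightarrow> {pathstart (\<gamma> e), pathfinish (\<gamma> e)} = p ` e"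
    and edge_vertices: "e \<in> E \<Longrightarrow> path_image (\<gamma> e) \<inter> p ` V = p ` e"
    and edges_cross: "e \<in> E \<Longrightarrow> e' \<in> E \<Longrightarrow> e \<noteq> e' \<Longrightarrow>
      path_image (\<gamma> e) \<inter> path_image (\<gamma> e') \<subseteq> p ` (e \<inter> e')"
begin

lemma finite_E: "finite E"
  using edge finite_V by (meson Pow_iff finite_Pow_iff finite_subset subsetI)

definition drawing :: "'a set set \<Rightarrow> complex set" where
  "drawing F = (\<Union>e\<in>F. path_image (\<gamma> e))"

lemma drawing_Un: "drawing (F \<union> F') = drawing F \<union> drawing F'"
  by (auto simp: drawing_def)

lemma drawing_mono: "F \<subseteq> F' \<Longrightarrow> drawing F \<subseteq> drawing F'"
  by (auto simp: drawing_def)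

lemma closed_drawing: "F \<subseteq> E \<Longrightarrow> closed (drawing F)"
  unfolding drawing_def
  by (intro closed_UN) (auto intro: finite_subset[OF _ finite_E] closed_path_image arc_imp_path arc_edge)

lemma vertex_in_drawing: "F \<subseteq> E \<Longrightarrow> x \<in> V \<Longrightarrow> p x \<in> drawing F \<longleftrightarrow> x \<in> \<Union>F"
proof
  assume F: "F \<subseteq> E" "x \<in> V" "p x \<in> drawing F"
  then obtain e where e: "e \<in> F" "p x \<in> path_image (\<gamma> e)" by (auto simp: drawing_def)
  then have "p x \<in> p ` e" using edge_vertices[of e] F by auto
  then have "x \<in> e" using inj_p edge[of e] F e by (auto dest: inj_onD)
  then show "x \<in> \<Union>F" using e by auto
next
  assume F: "F \<subseteq> E" "x \<in> V" "x \<in> \<Union>F"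
  then obtain e where e: "e \<in> F" "x \<in> e" by auto
  then have "p x \<in> path_image (\<gamma> e)" using edge_vertices[of e] F by auto
  then show "p x \<in> drawing F" using e by (auto simp: drawing_def)
qed

lemma drawing_Int:
  assumes "F \<subseteq> E" "F' \<subseteq> E" "F \<inter> F' = {}"
  shows "drawing F \<inter> drawing F' \<subseteq> p ` (\<Union>F \<inter> \<Union>F')"
proof
  fix z assume "z \<in> drawing F \<inter> drawing F'"
  then obtain e e'
    where e: "e \<in> F" "e' \<in> F'"
      "z \<in> path_image (\<gamma> e) \<inter> path_image (\<gamma> e')"
    by (auto simp: drawing_def)
  then have "z \<in> p ` (e \<inter> e')" using edges_cross[of e e'] assms by blast
  then show "z \<in> p ` (\<Union>F \<inter> \<Union>F')" using e by blast
qed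

lemma edge_arc:
  assumes "{x, y} \<in> E"
  obtains g
    where "arc g" "pathstart g = p x" "pathfinish g = p y"
      "path_image g = path_image (\<gamma> {x, y})"
proof -
  have "{pathstart (\<gamma> {x, y}), pathfinish (\<gamma> {x, y})} = {p x, p y}"
    using ends_edge[OF assms] by simp
  then consider "pathstart (\<gamma> {x, y}) = p x" "pathfinish (\<gamma> {x, y}) = p y"
    | "pathstart (\<gamma> {x, y}) = p y" "pathfinish (\<gamma> {x, y}) = p x"
    by (auto simp: doubleton_eq_iff)
  then show thesis
  proof cases
    case 1
    then show ?thesis using that[of "\<gamma> {x, y}"] arc_edge[OF assms] by auto
  next
    case 2
    then show ?thesis
      using that[of "reversepath (\<gamma> {x, y})"] arc_edge[OF assms]
      by (auto simp: arc_reversepath)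
  qed
qed

lemma path_arc:
  assumes "distinct xs" "length xs \<ge> 2" "path_edges xs \<subseteq> E"
  obtains g where "arc g" "pathstart g = p (hd xs)" "pathfinish g = p (last xs)"
    "path_image g = drawing (path_edges xs)"
proof -
  have "\<exists>g. arc g \<and> pathstart g = p (hd xs) \<and> pathfinish g = p (last xs) \<and>
    path_image g = drawing (path_edges xs)"
    using assms
  proof (induction xs rule: path_edges.induct)
    case (1 x y zs)
    obtain g
      where g: "arc g" "pathstart g = p x" "pathfinish g = p y"
        "path_image g = path_image (\<gamma> {x, y})"
      using edge_arc[of x y] 1 by auto
    show ?case
    proof (cases zs)
      case Nil
      then show ?thesis using g by (auto simp: drawing_def)
    next
      case (Cons z zs')
      then obtain h where h: "arc h" "pathstart h = p y" "pathfinish h = p (last (y # zs))"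
        "path_image h = drawing (path_edges (y # zs))" using 1 by auto
      have "{x, y} \<notin> path_edges (y # zs)"
        using path_edges_notin[of x "y # zs" "{x, y}"] 1(2) by auto
      then have "drawing {{x, y}} \<inter> drawing (path_edges (y # zs)) \<subseteq> p ` (\<Union>{{x, y}} \<inter> \<Union>(path_edges (y # zs)))"
        by (intro drawing_Int) (use 1 in auto)
      also have "\<dots> \<subseteq> {p y}" using Union_path_edges_subset[of "y # zs"] 1(2) by auto
      finally have "path_image g \<inter> path_image h \<subseteq> {pathstart h}"
        using g h by (simp add: drawing_def)
      then have "arc (g +++ h)" using g h by (intro arc_join) auto
      moreover have "path_image (g +++ h) = drawing (path_edges (x # y # zs))"
        using g h by (simp add: path_image_join drawing_def)
      ultimately show ?thesis using g h by (intro exI[of _ "g +++ h"]) auto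
    qed
  qed auto
  then show thesis using that by blast
qed

text \<open>Each region is described as a component of the complement of its own cycle, the form in
  which the splitting by a cross arc applies. As it also avoids the rest of the drawing, it is a
  face of \<open>F\<close> whenever its cycle belongs to \<open>F\<close>.\<close>

definition regions :: "'a set set \<Rightarrow> nat \<Rightarrow> (nat \<Rightarrow> 'a list) \<Rightarrow> (nat \<Rightarrow> complex set) \<Rightarrow> bool" where
  "regions F n D R \<longleftrightarrow>
     (\<forall>i<n. R i \<in> components (- drawing (cycle_edges (D i))) \<and> R i \<inter> drawing F = {}) \<and>
     (\<forall>i<n. \<forall>j<n. i \<noteq> j \<longrightarrow> R i \<inter> R j = {}) \<and>
     - drawing F \<subseteq> (\<Union>i<n. R i)"

lemma cycle_arcs:
  assumes "distinct (x # as @ y # bs)" "cycle_edges (x # as @ y # bs) \<subseteq> E"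
    "path_edges (x # as @ [y]) \<inter> path_edges (y # bs @ [x]) = {}"
  obtains c1 c2 where "arc c1" "pathstart c1 = p x" "pathfinish c1 = p y"
    "arc c2" "pathstart c2 = p x" "pathfinish c2 = p y"
    "path_image c1 = drawing (path_edges (x # as @ [y]))"
    "path_image c2 = drawing (path_edges (y # bs @ [x]))"
    "path_image c1 \<inter> path_image c2 = {p x, p y}"
proof -
  let ?A = "path_edges (x # as @ [y])" and ?B = "path_edges (y # bs @ [x])"
  have AB: "?A \<subseteq> E" "?B \<subseteq> E" using assms(2) by (auto simp: cycle_edges_split)
  obtain c1
    where c1: "arc c1" "pathstart c1 = p x" "pathfinish c1 = p y" "path_image c1 = drawing ?A"
    using path_arc[of "x # as @ [y]"] assms(1) AB by auto
  obtain c2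
    where c2: "arc c2" "pathstart c2 = p y" "pathfinish c2 = p x" "path_image c2 = drawing ?B"
    using path_arc[of "y # bs @ [x]"] assms(1) AB by auto
  have "drawing ?A \<inter> drawing ?B \<subseteq> p ` (\<Union>?A \<inter> \<Union>?B)"
    using assms(3) AB by (intro drawing_Int)
  also have "\<dots> \<subseteq> {p x, p y}"
    using Union_path_edges_subset[of "x # as @ [y]"] Union_path_edges_subset[of "y # bs @ [x]"] assms(1)
    by auto
  finally have "path_image c1 \<inter> path_image c2 = {p x, p y}"
    using c1 c2 pathstart_in_path_image[of c1] pathfinish_in_path_image[of c1]
      pathstart_in_path_image[of c2] pathfinish_in_path_image[of c2] by auto
  then show thesis using that[of c1 "reversepath c2"] c1 c2 by (auto simp: arc_reversepath)
qed

text \<open>Inside and outside of a Jordan curve have the same boundary, so the same cycle is listed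
  twice.\<close>

lemma regions_cycle:
  assumes "distinct xs" "length xs \<ge> 3" "cycle_edges xs \<subseteq> E"
  obtains R where "regions (cycle_edges xs) 2 (\<lambda>_. xs) R"
proof -
  obtain x y bs where xs: "xs = x # [] @ y # bs" "bs \<noteq> []"
    using assms(2) by (auto simp: Suc_le_length_iff eval_nat_numeral)
  have "{x, y} \<notin> path_edges (y # bs @ [x])"
    using path_edges_notin[of y "bs @ [x]" "{x, y}"] assms(1) xs
    by (cases bs) (auto simp: doubleton_eq_iff)
  then have "path_edges (x # [] @ [y]) \<inter> path_edges (y # bs @ [x]) = {}" by simp
  then obtain c1 c2 where c: "arc c1" "pathstart c1 = p x" "pathfinish c1 = p y"
    "arc c2" "pathstart c2 = p x" "pathfinish c2 = p y"
    "path_image c1 = drawing (path_edges (x # [] @ [y]))"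
    "path_image c2 = drawing (path_edges (y # bs @ [x]))"
    "path_image c1 \<inter> path_image c2 = {p x, p y}"
    using cycle_arcs[of x "[]" y bs] assms xs by metis
  note J = Jordan_arcs[OF c(1,4,2,3,5,6,9)]
  define S where "S = drawing (cycle_edges xs)"
  have S: "path_image c1 \<union> path_image c2 = S"
    unfolding S_def c(7,8) xs(1) cycle_edges_split drawing_Un by simp
  have J': "connected (inside S)" "inside S \<noteq> {}" "connected (outside S)"
    "outside S \<noteq> {}"
    using Jordan_inside_outside[OF J(1,2)] unfolding J(3) S by blast+
  define R where "R i = (if i = 0 then inside S else outside S)" for i :: nat
  have comp: "R i \<in> components (- S)" for i
    unfolding R_def using J' by (simp add: inside_in_components outside_in_components)
  have dis: "R i \<inter> S = {}" for i
    unfolding R_def using inside_no_overlap[of S] outside_no_overlap[of S] by simp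
  have disj: "R i \<inter> R j = {}" if "i < 2" "j < 2" "i \<noteq> j" for i j
    unfolding R_def using that inside_Int_outside[of S] by (auto simp del: inside_Int_outside)
  have cover: "- S \<subseteq> (\<Union>i<2. R i)"
  proof -
    have "{..<2} = {0, 1::nat}" by auto
    moreover have "- S \<subseteq> inside S \<union> outside S" by simp
    ultimately show ?thesis by (simp add: R_def Un_commute del: inside_Un_outside)
  qed
  have "regions (cycle_edges xs) 2 (\<lambda>_. xs) R"
    unfolding regions_def S_def[symmetric] using comp dis disj cover by blast
  then show thesis by (rule that)
qed

text \<open>The ear without its ends is connected and avoids the drawing of \<open>F\<close>, so it
  runs in a single region \<open>R i\<close>. Its ends are limits of points of \<open>R i\<close>
  without being interior, so they lie on the frontier, that is on the cycle \<open>D i\<close>. Now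
  the theta curve formed by this cycle and the ear splits \<open>R i\<close>.\<close>

lemma regions_ear:
  assumes cc: "cycle_cover F n D" and R: "regions F n D R" and F: "F \<subseteq> E"
    and ps: "distinct (x # ps @ [y])" "set ps \<inter> \<Union>F = {}"
      "path_edges (x # ps @ [y]) \<inter> F = {}"
      "path_edges (x # ps @ [y]) \<subseteq> E" and xy: "x \<in> \<Union>F" "y \<in> \<Union>F"
  obtains D' R' where "cycle_cover (F \<union> path_edges (x # ps @ [y])) (Suc n) D'"
    "regions (F \<union> path_edges (x # ps @ [y])) (Suc n) D' R'"
proof -
  let ?P = "path_edges (x # ps @ [y])"
  have UF: "\<Union>F \<subseteq> V" using F edge by auto
  have finUF: "finite (\<Union>F)" by (rule finite_subset[OF UF finite_V])
  have "p x \<noteq> p y"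
  proof
    assume "p x = p y"
    then have "x = y" using inj_onD[OF inj_p] xy UF by blast
    then show False using ps(1) by simp
  qed
  obtain g where g: "arc g" "pathstart g = p x" "pathfinish g = p y" "path_image g = drawing ?P"
    using path_arc[of "x # ps @ [y]"] ps by auto
  let ?I = "path_image g - {p x, p y}"
  have xyF: "p x \<in> drawing F" "p y \<in> drawing F"
    using vertex_in_drawing[OF F] xy UF by blast+
  have conn: "connected ?I" "?I \<noteq> {}"
    using connected_simple_path_endless[OF arc_imp_simple_path[OF g(1)]]
      nonempty_simple_path_endless[OF arc_imp_simple_path[OF g(1)]] g by auto
  have "drawing ?P \<inter> drawing F \<subseteq> p ` (\<Union>?P \<inter> \<Union>F)"
    by (intro drawing_Int ps F)
  also have "\<dots> \<subseteq> {p x, p y}"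
    using Union_path_edges_subset[of "x # ps @ [y]"] ps(2) by auto
  finally have gF: "path_image g \<inter> drawing F \<subseteq> {p x, p y}" using g by simp
  then have IF: "?I \<subseteq> - drawing F" by auto
  then obtain i where i: "i < n" "?I \<inter> R i \<noteq> {}"
    using conn R unfolding regions_def by blast
  let ?C = "cycle_edges (D i)"
  have CF: "?C \<subseteq> F" "distinct (D i)" "length (D i) \<ge> 3"
    using cc i by (auto simp: cycle_cover_def)
  have Ri: "R i \<in> components (- drawing ?C)" "R i \<inter> drawing F = {}"
    using R i by (auto simp: regions_def)
  have "?I \<subseteq> - drawing ?C" using IF drawing_mono[OF CF(1)] by auto
  then have IR: "?I \<subseteq> R i" using components_maximal[OF Ri(1) conn(1)] i by auto
  have fr: "frontier (R i) \<subseteq> drawing ?C"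
    by (rule frontier_of_components_closed_complement[OF _ Ri(1)]) (use closed_drawing CF F in blast)
  have on: "z \<in> set (D i)" if z: "z = x \<or> z = y" for z
  proof -
    have zV: "z \<in> V" "z \<in> \<Union>F" using z xy UF by auto
    have "p z \<in> path_image g"
      using z g pathstart_in_path_image pathfinish_in_path_image by metis
    moreover have "connected (path_image g)"
      using g(1) by (simp add: arc_imp_path connected_path_image)
    moreover have "path_image g \<noteq> {a}" for a
      using \<open>p x \<noteq> p y\<close> g pathstart_in_path_image[of g] pathfinish_in_path_image[of g]
      by auto
    \<comment> \<open>A connected set with more than one point has no isolated points, and removing
      the two ends does not affect limit points.\<close>
    ultimately have "p z islimpt path_image g" by (intro connected_imp_perfect) auto
    then have "p z islimpt ?I"
      using islimpt_Un[of "p z" ?I "{p x, p y}"] islimpt_finite[of "{p x, p y}"]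
        islimpt_subset[of "p z" "path_image g" "?I \<union> {p x, p y}"] by blast
    then have "p z islimpt R i" using IR by (rule islimpt_subset)
    then have "p z \<in> closure (R i)" by (simp add: closure_def)
    moreover have "p z \<in> drawing F" using vertex_in_drawing[OF F zV(1)] zV by simp
    then have "p z \<notin> interior (R i)" using Ri(2) interior_subset by blast
    ultimately have "p z \<in> drawing ?C" using fr by (auto simp: frontier_def)
    then have "z \<in> \<Union>?C" using vertex_in_drawing[of ?C z] CF F zV by auto
    moreover have "D i \<noteq> []" using CF(3) by auto
    ultimately show ?thesis using Union_cycle_edges[of "D i"] by blast
  qed
  have onxy: "x \<in> set (D i)" "y \<in> set (D i)" and "x \<noteq> y" using on ps(1) by simp_all
  obtain as bs where ab: "distinct (x # as @ y # bs)" "cycle_edges (x # as @ y # bs) = ?C"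
    "length (x # as @ y # bs) = length (D i)"
    by (rule cycle_edges_rotate_to[OF onxy \<open>x \<noteq> y\<close> CF(2)])
  let ?D = "D(i := x # as @ y # rev ps, n := x # ps @ y # bs)"
  have cc': "cycle_cover (F \<union> ?P) (Suc n) ?D"
    by (rule cycle_cover_ear[OF cc i(1) ab(1,2) ps(1-3) finUF])
  let ?A = "path_edges (x # as @ [y])" and ?B = "path_edges (y # bs @ [x])"
  have Csplit: "?C = ?A \<union> ?B" using ab(2) by (simp add: cycle_edges_split)
  have AB: "?A \<inter> ?B = {}"
  proof (rule cycle_halves_disjoint[OF ab(1)])
    show "length (x # as @ y # bs) \<ge> 3" using ab(3) CF(3) by simp
  qed
  obtain c1 c2 where c: "arc c1" "pathstart c1 = p x" "pathfinish c1 = p y"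
    "arc c2" "pathstart c2 = p x" "pathfinish c2 = p y"
    "path_image c1 = drawing ?A" "path_image c2 = drawing ?B"
    "path_image c1 \<inter> path_image c2 = {p x, p y}"
    by (rule cycle_arcs[OF ab(1) _ AB]) (use ab(2) CF(1) F in auto)
  have dC: "path_image c1 \<union> path_image c2 = drawing ?C" unfolding Csplit drawing_Un c(7,8) ..
  have sub: "path_image c1 \<subseteq> drawing F" "path_image c2 \<subseteq> drawing F"
    using dC drawing_mono[OF CF(1)] by auto
  have int: "path_image c1 \<inter> path_image g = {p x, p y}"
    "path_image c2 \<inter> path_image g = {p x, p y}"
    using gF sub c g pathstart_in_path_image[of c1] pathfinish_in_path_image[of c1]
      pathstart_in_path_image[of g] pathfinish_in_path_image[of g]
      pathstart_in_path_image[of c2] pathfinish_in_path_image[of c2] by auto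
  obtain R1 R2 where R12: "R1 \<in> components (- (path_image c1 \<union> path_image g))"
    "R2 \<in> components (- (path_image c2 \<union> path_image g))"
    "R i - path_image g = R1 \<union> R2" "R1 \<inter> R2 = {}"
    using theta_split[OF c(1,4) g(1) c(2,3,5,6) g(2,3) c(9) int Ri(1)[folded dC] IR] by blast
  have revP: "path_edges (y # rev ps @ [x]) = ?P"
    using path_edges_rev[of "x # ps @ [y]"] by simp
  let ?R = "R(i := R1, n := R2)"
  have "regions (F \<union> ?P) (Suc n) ?D ?R"
    unfolding regions_def
  proof (intro conjI allI impI)
    fix j assume "j < Suc n"
    then consider "j = i" | "j = n" | "j < n" "j \<noteq> i" by linarith
    then have "?R j \<in> components (- drawing (cycle_edges (?D j))) \<and> ?R j \<inter> drawing (F \<union> ?P) = {}"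
    proof cases
      case 1
      have "R1 \<inter> drawing (F \<union> ?P) = {}"
        using R12(3) Ri(2) g(4) unfolding drawing_Un by blast
      then show ?thesis
        using 1 i R12(1)
        unfolding cycle_edges_split revP by (simp add: cycle_edges_split revP drawing_Un c g)
    next
      case 2
      have "R2 \<inter> drawing (F \<union> ?P) = {}"
        using R12(3) Ri(2) g(4) unfolding drawing_Un by blast
      then show ?thesis using 2 i R12(2) by (simp add: cycle_edges_split drawing_Un c g Un_commute)
    next
      case 3
      then have "R j \<in> components (- drawing (cycle_edges (D j)))"
        "R j \<inter> drawing F = {}" "cycle_edges (D j) \<subseteq> F"
        using R cc by (auto simp: regions_def cycle_cover_def)
      moreover have "R j \<inter> R i = {}" using R 3 i(1) by (auto simp: regions_def)
      then have "R j \<inter> path_image g = {}"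
        using IR \<open>R j \<inter> drawing F = {}\<close> xyF by blast
      ultimately show ?thesis using 3 g(4) by (simp add: drawing_Un Int_Un_distrib)
    qed
    then show "?R j \<in> components (- drawing (cycle_edges (?D j)))" "?R j \<inter> drawing (F \<union> ?P) = {}"
      by auto
  next
    fix j k assume jk: "j < Suc n" "k < Suc n" "j \<noteq> k"
    have R12i: "R1 \<subseteq> R i" "R2 \<subseteq> R i" using R12(3) by auto
    have dis: "R l \<inter> R m = {}" if "l < n" "m < n" "l \<noteq> m" for l m
      using R that by (auto simp: regions_def)
    have "j = i \<or> j = n \<or> j < n \<and> j \<noteq> i" "k = i \<or> k = n \<or> k < n \<and> k \<noteq> i"
      using jk by auto
    then show "?R j \<inter> ?R k = {}"
      using jk(3) i(1) dis[of j i] dis[of k i] dis[of j k] R12i R12(4) by (elim disjE) auto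
  next
    have "- drawing (F \<union> ?P) \<subseteq> (\<Union>j<n. R j) - path_image g"
      using R g(4) by (auto simp: regions_def drawing_Un)
    also have "\<dots> \<subseteq> (\<Union>j<Suc n. ?R j)"
    proof
      fix z assume z: "z \<in> (\<Union>j<n. R j) - path_image g"
      then obtain j where j: "j < n" "z \<in> R j" "z \<notin> path_image g" by auto
      show "z \<in> (\<Union>j<Suc n. ?R j)"
      proof (cases "j = i")
        case True
        then have "z \<in> R1 \<or> z \<in> R2" using j R12(3) by auto
        then have "z \<in> ?R i \<or> z \<in> ?R n" using i(1) by auto
        then show ?thesis using i(1) by (metis UN_I lessThan_iff less_SucI lessI)
      next
        case False
        then have "z \<in> ?R j" using j by auto
        then show ?thesis using j(1) by (metis UN_I lessThan_iff less_SucI)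
      qed
    qed
    finally show "- drawing (F \<union> ?P) \<subseteq> (\<Union>j<Suc n. ?R j)" .
  qed
  then show thesis using that cc' by blast
qed

end

subsection \<open>Ear decompositions\<close>

definition induced_edges :: "'a set set \<Rightarrow> 'a set \<Rightarrow> 'a set set" where
  "induced_edges E W = {e \<in> E. e \<subseteq> W}"

text \<open>
  Connected and without cut vertex: the case of disjoint \<open>W1\<close> and \<open>W2\<close> is included.
\<close>

definition nonseparable :: "'a set set \<Rightarrow> 'a set \<Rightarrow> bool" where
  "nonseparable E W \<longleftrightarrow>
     (\<forall>W1 W2 x. W1 \<union> W2 = W \<and> W1 \<inter> W2 \<subseteq> {x} \<and> W1 \<noteq> W \<and> W2 \<noteq> W \<longrightarrow>
       (\<exists>e\<in>induced_edges E W. \<not> e \<subseteq> W1 \<and> \<not> e \<subseteq> W2))"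

lemma path_edge_interior:
  "ps \<noteq> [] \<Longrightarrow> e \<in> path_edges (x # ps @ [y]) \<Longrightarrow> e \<inter> set ps \<noteq> {}"
proof (induction ps arbitrary: x)
  case (Cons z zs)
  then show ?case by (cases zs) auto
qed simp

lemma rtrancl_path:
  assumes "(a, b) \<in> {(a, b). a \<in> X \<and> b \<in> X \<and> {a, b} \<in> E}\<^sup>*" "a \<in> X"
  obtains ps
    where "ps \<noteq> []" "hd ps = a" "last ps = b" "distinct ps" "set ps \<subseteq> X"
      "path_edges ps \<subseteq> E"
proof -
  have "\<exists>ps. ps \<noteq> [] \<and> hd ps = a \<and> last ps = b \<and> distinct ps \<and> set ps \<subseteq> X \<and> path_edges ps \<subseteq> E"
    using assms(1)
  proof (induction rule: rtrancl_induct)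
    case base
    then show ?case using assms(2) by (intro exI[of _ "[a]"]) auto
  next
    case (step b c)
    then obtain ps
      where ps: "ps \<noteq> []" "hd ps = a" "last ps = b" "distinct ps" "set ps \<subseteq> X"
        "path_edges ps \<subseteq> E"
      by auto
    show ?case
    proof (cases "c \<in> set ps")
      case True
      \<comment> \<open>A repeated vertex is handled by cutting the path back to its earlier
        visit.\<close>
      then obtain us vs where uv: "ps = us @ c # vs" by (auto simp: in_set_conv_decomp)
      have "path_edges (us @ [c]) \<subseteq> E"
        using ps(6) path_edges_append[of us c vs] unfolding uv by blast
      moreover have "hd (us @ [c]) = a" using ps(2) uv by (cases us) auto
      ultimately show ?thesis using ps uv by (intro exI[of _ "us @ [c]"]) auto
    next
      case False
      obtain qs where qs: "ps = qs @ [b]" using ps(1,3) by (metis append_butlast_last_id)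
      have "path_edges (ps @ [c]) = path_edges ps \<union> {{b, c}}"
        using path_edges_append[of qs b "[c]"] qs by simp
      then have "path_edges (ps @ [c]) \<subseteq> E" using ps(6) step(2) by auto
      then show ?thesis using ps False step(2) by (intro exI[of _ "ps @ [c]"]) auto
    qed
  qed
  then show thesis using that by blast
qed

text \<open>Let \<open>C\<close> be the part of \<open>W - S\<close> reachable from
  \<open>u0\<close> and \<open>N\<close> its neighbours in \<open>S\<close>. If \<open>N\<close> had
  at most one vertex, \<open>C \<union> N\<close> and \<open>W - C\<close> would be a separation of
  \<open>W\<close>. So two vertices of \<open>S\<close> attach to \<open>C\<close>, and a path
  outside \<open>S\<close> joins their neighbours in \<open>C\<close>.\<close>

lemma ear_exists:
  assumes card2: "\<And>e. e \<in> E \<Longrightarrow> card e = 2" and W: "nonseparable E W"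
    and S: "S \<subseteq> W" "S \<noteq> W" "card S \<ge> 2"
  obtains x y ps
    where "x \<in> S" "y \<in> S" "ps \<noteq> []" "distinct (x # ps @ [y])"
      "set ps \<subseteq> W - S"
    "path_edges (x # ps @ [y]) \<subseteq> E"
proof -
  define r where "r = {(a, b). a \<in> W - S \<and> b \<in> W - S \<and> {a, b} \<in> E}"
  obtain u0 where u0: "u0 \<in> W - S" using S by auto
  define C where "C = {v. (u0, v) \<in> r\<^sup>*}"
  define N where "N = {x \<in> S. \<exists>u\<in>C. {x, u} \<in> E}"
  have C: "C \<subseteq> W - S"
  proof
    fix v assume "v \<in> C"
    then have "(u0, v) \<in> r\<^sup>*" by (simp add: C_def)
    then show "v \<in> W - S"
      by (induction rule: rtrancl_induct) (use u0 in \<open>auto simp: r_def\<close>)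
  qed
  have "\<not> N \<subseteq> {x}" for x
  proof
    assume N: "N \<subseteq> {x}"
    have "C \<union> N \<noteq> W"
    proof
      assume "C \<union> N = W"
      then have "S \<subseteq> {x}" using S(1) C N by auto
      then have "card S \<le> card {x}" by (rule card_mono[rotated]) simp
      then show False using S(3) by simp
    qed
    moreover have "W - C \<noteq> W" using u0 by (auto simp: C_def)
    moreover have "(C \<union> N) \<union> (W - C) = W" using C S(1) by (auto simp: N_def)
    moreover have "(C \<union> N) \<inter> (W - C) \<subseteq> {x}" using N by auto
    ultimately obtain e
      where e: "e \<in> induced_edges E W" "\<not> e \<subseteq> C \<union> N"
        "\<not> e \<subseteq> W - C"
      using W unfolding nonseparable_def by blast
    then have eE: "e \<in> E" "e \<subseteq> W" by (auto simp: induced_edges_def)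
    obtain a b where ab: "a \<in> e" "a \<in> C" "b \<in> e" "b \<notin> C \<union> N"
      using e eE by auto
    then have "e = {a, b}" using card2[OF eE(1)] by (auto simp: card_2_iff)
    note ab = this ab(2,4) eE
    show False
    proof (cases "b \<in> S")
      case True
      then have "b \<in> N" using ab insert_commute[of a b "{}"] by (auto simp: N_def)
      then show False using ab by auto
    next
      case False
      then have "(a, b) \<in> r" using ab C by (auto simp: r_def)
      then have "b \<in> C" using ab(2) by (auto simp: C_def intro: rtrancl_into_rtrancl)
      then show False using ab by auto
    qed
  qed
  then obtain x y where xy: "x \<in> N" "y \<in> N" "x \<noteq> y" by (metis subsetI singletonI)
  then obtain u v where uv: "u \<in> C" "{x, u} \<in> E" "v \<in> C" "{y, v} \<in> E"
    by (auto simp: N_def)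
  have "sym r" by (auto simp: r_def sym_def insert_commute)
  then have "(u, u0) \<in> r\<^sup>*" using uv(1) by (simp add: C_def sym_rtrancl symD)
  then have "(u, v) \<in> r\<^sup>*" using uv(3) by (auto simp: C_def)
  then obtain ps
    where ps: "ps \<noteq> []" "hd ps = u" "last ps = v" "distinct ps" "set ps \<subseteq> W - S"
      "path_edges ps \<subseteq> E"
    unfolding r_def using rtrancl_path[of u v "W - S" E] uv C by blast
  obtain qs where qs: "ps = qs @ [v]" using ps(1,3) by (metis append_butlast_last_id)
  have "path_edges (ps @ [y]) \<subseteq> E"
    using path_edges_append[of qs v "[y]"] qs ps(6) uv(4) by (auto simp: insert_commute)
  then have "path_edges (x # ps @ [y]) \<subseteq> E"
    using path_edges_Cons[of "ps @ [y]" x] ps(1,2) uv(2) by auto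
  moreover have "x \<in> S" "y \<in> S" using xy by (auto simp: N_def)
  moreover have "distinct (x # ps @ [y])" using ps(4,5) xy(3) calculation by auto
  ultimately show thesis using that ps(1,5) by blast
qed

context drawn_graph
begin

text \<open>Induction on the number of missing edges. While a vertex is missing there is an ear
  through new vertices; afterwards every missing edge is itself an ear. The regions are carried
  along because they determine which face an ear splits.\<close>

lemma cycle_cover_grow:
  assumes W: "nonseparable E W" "W \<subseteq> V" and F: "F \<noteq> {}"
    "F \<subseteq> induced_edges E W"
    and c: "cycle_cover F n D" "regions F n D R"
  shows "\<exists>n D. cycle_cover (induced_edges E W) n D \<and> \<Union>(induced_edges E W) = W"
  using F c
proof (induction "card (induced_edges E W - F)" arbitrary: F n D R rule: less_induct)
  case less
  let ?EW = "induced_edges E W"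
  have EW: "?EW \<subseteq> E" "\<Union>?EW \<subseteq> W" by (auto simp: induced_edges_def)
  have finEW: "finite ?EW" using EW(1) finite_E finite_subset by blast
  have FE: "F \<subseteq> E" using less.prems EW by auto
  have UF: "\<Union>F \<subseteq> W" using less.prems EW by auto
  have step: ?case
    if st: "x \<in> \<Union>F" "y \<in> \<Union>F" "distinct (x # ps @ [y])"
      "set ps \<inter> \<Union>F = {}" "set ps \<subseteq> W"
    "path_edges (x # ps @ [y]) \<inter> F = {}" "path_edges (x # ps @ [y]) \<subseteq> E" for x y ps
  proof -
    let ?P = "path_edges (x # ps @ [y])"
    obtain D' R'
      where D': "cycle_cover (F \<union> ?P) (Suc n) D'" "regions (F \<union> ?P) (Suc n) D' R'"
      using regions_ear[OF less.prems(3,4) FE st(3,4,6,7,1,2)] by blast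
    have "set (x # ps @ [y]) \<subseteq> W" using st(1,2,5) UF by auto
    then have "\<Union>?P \<subseteq> W"
      using Union_path_edges_subset[of "x # ps @ [y]"] by (rule order_trans[rotated])
    then have P: "?P \<subseteq> ?EW" using st(7) by (auto simp: induced_edges_def)
    have "?P \<noteq> {}" by (simp add: path_edges_Cons)
    then have "?EW - (F \<union> ?P) \<subset> ?EW - F" using P st(6) by blast
    then have "card (?EW - (F \<union> ?P)) < card (?EW - F)"
      using finEW by (intro psubset_card_mono) auto
    moreover have "F \<union> ?P \<noteq> {}" "F \<union> ?P \<subseteq> ?EW"
      using less.prems(1,2) P by auto
    ultimately show ?thesis using less.hyps[OF _ _ _ D'] by blast
  qed
  show ?case
  proof (cases "\<Union>F = W")
    case True
    show ?thesis
    proof (cases "F = ?EW")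
      case True
      then show ?thesis using less.prems \<open>\<Union>F = W\<close> by blast
    next
      case False
      then obtain e where e: "e \<in> ?EW" "e \<notin> F" using less.prems(2) by blast
      then have "card e = 2" "e \<subseteq> W" using edge EW by (auto simp: induced_edges_def)
      then obtain x y where "e = {x, y}" "x \<noteq> y" by (auto simp: card_2_iff)
      then show ?thesis using step[of x y "[]"] e EW(1) True \<open>e \<subseteq> W\<close> by auto
    qed
  next
    case False
    obtain e where e: "e \<in> F" using less.prems(1) by auto
    have "card e = 2" using e FE edge by auto
    moreover have "finite (\<Union>F)" by (rule finite_subset[OF order_trans[OF UF W(2)] finite_V])
    then have "card e \<le> card (\<Union>F)" by (rule card_mono) (use e in auto)
    ultimately have "card (\<Union>F) \<ge> 2" by simp
    then obtain x y ps
      where ps: "x \<in> \<Union>F" "y \<in> \<Union>F" "ps \<noteq> []" "distinct (x # ps @ [y])"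
        "set ps \<subseteq> W - \<Union>F"
      "path_edges (x # ps @ [y]) \<subseteq> E"
      using ear_exists[OF _ W(1) UF False] edge by metis
    have "path_edges (x # ps @ [y]) \<inter> F = {}"
    proof (rule ccontr)
      assume "\<not> ?thesis"
      then obtain e where "e \<in> path_edges (x # ps @ [y])" "e \<in> F" by auto
      then show False using path_edge_interior[OF ps(3), of e x y] ps(5) by blast
    qed
    then show ?thesis using step[OF ps(1,2,4) _ _ _ ps(6)] ps(5) by blast
  qed
qed

text \<open>The initial cycle consists of some edge together with an ear attached to its two
  ends.\<close>

lemma nonseparable_cycle_cover:
  assumes W: "nonseparable E W" "W \<subseteq> V" "card W \<ge> 3"
  obtains n D where "cycle_cover (induced_edges E W) n D" "\<Union>(induced_edges E W) = W"
proof -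
  obtain w where w: "w \<in> W" using W(3) by fastforce
  have "{w} \<noteq> W" "W - {w} \<noteq> W" using W(3) w by auto
  moreover have "{w} \<union> (W - {w}) = W" "{w} \<inter> (W - {w}) \<subseteq> {w}"
    using w by auto
  ultimately obtain e where e: "e \<in> induced_edges E W"
    using W(1) unfolding nonseparable_def by blast
  then have e2: "card e = 2" "e \<subseteq> W" "e \<in> E"
    using edge by (auto simp: induced_edges_def)
  then have "e \<noteq> W" using W(3) by auto
  then obtain x y ps
    where ps: "x \<in> e" "y \<in> e" "ps \<noteq> []" "distinct (x # ps @ [y])"
      "set ps \<subseteq> W - e"
      "path_edges (x # ps @ [y]) \<subseteq> E"
    using ear_exists[OF _ W(1) e2(2) \<open>e \<noteq> W\<close>] edge e2 by (metis order_refl)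
  let ?xs = "x # ps @ [y]"
  have xy: "e = {x, y}"
    by (rule card_subset_eq[symmetric]) (use e2 ps card.infinite in \<open>fastforce+\<close>)
  have len: "length ?xs \<ge> 3" using ps(3) by (cases ps) auto
  have "cycle_edges ?xs = path_edges ?xs \<union> {{y, x}}"
    using path_edges_append[of "x # ps" y "[x]"] by (simp add: cycle_edges_Cons)
  then have cE: "cycle_edges ?xs \<subseteq> E" using ps(6) e2 xy by (auto simp: insert_commute)
  moreover have "\<Union>(cycle_edges ?xs) \<subseteq> W"
    using Union_cycle_edges[of ?xs] ps e2 by auto
  ultimately have sub: "cycle_edges ?xs \<subseteq> induced_edges E W"
    by (auto simp: induced_edges_def)
  obtain R where R: "regions (cycle_edges ?xs) 2 (\<lambda>_. ?xs) R"
    using regions_cycle[OF ps(4) len cE] .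
  have "cycle_edges ?xs \<noteq> {}"
    using \<open>cycle_edges ?xs = path_edges ?xs \<union> {{y, x}}\<close> by simp
  from cycle_cover_grow[OF W(1,2) this sub cycle_cover_single[OF ps(4) len] R] show thesis
    using that by blast
qed

end

subsection \<open>Discharging\<close>

lemma path_edges_decomp:
  "e \<in> path_edges ys \<Longrightarrow> \<exists>us a b vs. ys = us @ a # b # vs \<and> e = {a, b}"
proof (induction ys rule: path_edges.induct)
  case (1 x y zs)
  show ?case
  proof (cases "e = {x, y}")
    case True
    then show ?thesis by (intro exI[of _ "[]"]) auto
  next
    case False
    then obtain us a b vs where "y # zs = us @ a # b # vs" "e = {a, b}" using 1 by auto
    then show ?thesis by (intro exI[of _ "x # us"]) auto
  qed
qed auto

lemma cycle_edges_rotate_edge: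
  assumes "e \<in> cycle_edges xs" "distinct xs" "length xs \<ge> 2"
  obtains a b zs where "e = {a, b}" "distinct (a # b # zs)" "length (a # b # zs) = length xs"
    "set (a # b # zs) = set xs" "cycle_edges (a # b # zs) = cycle_edges xs"
proof -
  obtain us a b vs where d: "xs @ [hd xs] = us @ a # b # vs" "e = {a, b}"
    using path_edges_decomp assms(1) unfolding cycle_edges_def by blast
  show thesis
  proof (cases vs rule: rev_cases)
    \<comment> \<open>The edge is the one that closes the cycle.\<close>
    case Nil
    then have xs: "xs = us @ [a]" "hd xs = b" using d(1) by auto
    then obtain zs where us: "us = b # zs" using assms(3) by (cases us) auto
    have "cycle_edges (a # b # zs) = cycle_edges xs"
      using cycle_edges_rotate[of us "[a]"] xs us by simp
    then show thesis using that[of a b zs] xs us d(2) assms(2) by auto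
  next
    case (snoc ws w)
    then have xs: "xs = us @ a # b # ws" using d(1) by auto
    have "cycle_edges (a # b # ws @ us) = cycle_edges xs"
      using cycle_edges_rotate[of us "a # b # ws"] xs by simp
    then show thesis using that[of a b "ws @ us"] xs d(2) assms(2) by auto
  qed
qed

text \<open>What is known of a minimal counterexample with root \<open>w\<close> once the facial
  cycles are found; the aim is to derive \<open>False\<close>. In
  \<open>no_triangle_on_4_cycle\<close> the vertex \<open>x\<close> may be \<open>c\<close> or
  \<open>d\<close>, so a 4-cycle with a chord is excluded as well.\<close>

locale cycle_covered_graph =
  fixes W :: "'a set" and F :: "'a set set" and n :: nat and D :: "nat \<Rightarrow> 'a list" and w :: 'a
  assumes cover: "cycle_cover F n D"
    and finite_W: "finite W"
    and Union_F: "\<Union>F = W"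
    and card_edge: "e \<in> F \<Longrightarrow> card e = 2"
    and no_triangle_on_4_cycle: "distinct [a, b, c, d] \<Longrightarrow>
      {{a, b}, {b, c}, {c, d}, {d, a}, {a, x}, {b, x}} \<subseteq> F \<Longrightarrow> False"
    and w: "w \<in> W"
    and degree_ge_4: "v \<in> W \<Longrightarrow> v \<noteq> w \<Longrightarrow> card {e \<in> F. v \<in> e} \<ge> 4"
    and no_house: "distinct [a, b, c, d, f, x] \<Longrightarrow>
      {{a, b}, {b, c}, {c, d}, {d, f}, {f, a}, {a, x}, {b, x}} \<subseteq> F \<Longrightarrow>
      \<exists>v\<in>{a, b, c, d, f, x}. v = w \<or> card {e \<in> F. v \<in> e} \<noteq> 4"
begin

abbreviation inc :: "'a \<Rightarrow> 'a set set" where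
  "inc v \<equiv> {e \<in> F. v \<in> e}"

abbreviation deg :: "'a \<Rightarrow> nat" where
  "deg v \<equiv> card (inc v)"

abbreviation bd :: "nat \<Rightarrow> 'a set set" where
  "bd i \<equiv> cycle_edges (D i)"

text \<open>The root counts as big whatever its degree: its color is prescribed, so it cannot be
  erased with a house.\<close>

definition big :: "'a \<Rightarrow> bool" where
  "big v \<longleftrightarrow> v = w \<or> deg v \<ge> 5"

definition triangles :: "nat set" where
  "triangles = {i. i < n \<and> length (D i) = 3}"

definition tri :: "'a set \<Rightarrow> bool" where
  "tri e \<longleftrightarrow> (\<exists>j\<in>triangles. e \<in> bd j)"

definition ntri :: "nat \<Rightarrow> nat" where
  "ntri i = card {e \<in> bd i. tri e}"

definition bad :: "nat \<Rightarrow> bool" where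
  "bad i \<longleftrightarrow> i < n \<and> length (D i) = 5 \<and> ntri i \<ge> 4"

definition nbig :: "nat \<Rightarrow> nat" where
  "nbig i = card {v \<in> set (D i). big v}"

section \<open>Incidences of faces, edges and vertices\<close>

lemma finite_F: "finite F"
  using cover by (simp add: cycle_cover_def)

lemma face: "i < n \<Longrightarrow> distinct (D i) \<and> length (D i) \<ge> 3 \<and> bd i \<subseteq> F"
  using cover by (simp add: cycle_cover_def)

lemma card_bd: "i < n \<Longrightarrow> card (bd i) = length (D i)"
  using face card_cycle_edges by blast

lemma Union_bd: "i < n \<Longrightarrow> \<Union>(bd i) = set (D i)"
  by (rule Union_cycle_edges) (use face[of i] in fastforce)

lemma set_D_subset: "i < n \<Longrightarrow> set (D i) \<subseteq> W"
  using Union_bd face Union_F by blast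

lemma card_faces: "e \<in> F \<Longrightarrow> card {i. i < n \<and> e \<in> bd i} = 2"
  using cover by (simp add: cycle_cover_def)

lemma three_faces:
  assumes "e \<in> bd i" "e \<in> bd j" "e \<in> bd k" "i < n" "j < n" "k < n" "i \<noteq> j"
    "j \<noteq> k" "i \<noteq> k"
  shows False
proof -
  have "e \<in> F" using face assms by blast
  have "card {i, j, k} \<le> card {l. l < n \<and> e \<in> bd l}"
    by (rule card_mono) (use assms in auto)
  then show False using assms(7-9) card_faces[OF \<open>e \<in> F\<close>] by simp
qed

lemma other_face:
  assumes "e \<in> F"
  obtains j where "j < n" "e \<in> bd j" "j \<noteq> i"
proof -
  have "\<not> {l. l < n \<and> e \<in> bd l} \<subseteq> {i}"
  proof
    assume "{l. l < n \<and> e \<in> bd l} \<subseteq> {i}"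
    then have "card {l. l < n \<and> e \<in> bd l} \<le> card {i}" by (rule card_mono[rotated]) simp
    then show False using card_faces[OF assms] by simp
  qed
  then show thesis using that by blast
qed

lemma edges_at:
  assumes "i < n" "v \<in> set (D i)"
  obtains a b
    where "a \<noteq> b" "a \<noteq> v" "b \<noteq> v" "a \<in> set (D i)" "b \<in> set (D i)"
    "{e \<in> bd i. v \<in> e} = {{v, a}, {v, b}}"
  by (rule cycle_edges_at[of "D i" v]) (use face[OF assms(1)] assms(2) in auto)

lemma card_edges_at: "i < n \<Longrightarrow> v \<in> set (D i) \<Longrightarrow> card {e \<in> bd i. v \<in> e} = 2"
  by (rule edges_at[of i v]) (auto simp: doubleton_eq_iff)

lemma other_edge_at:
  assumes "i < n" "v \<in> e" "e \<in> bd i"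
  obtains e'
    where "e' \<in> bd i" "v \<in> e'" "e' \<noteq> e" "{f \<in> bd i. v \<in> f} = {e, e'}"
proof -
  have v: "v \<in> set (D i)" using Union_bd[OF assms(1)] assms(2,3) by blast
  obtain a b where ab: "a \<noteq> b" "a \<noteq> v" "{e \<in> bd i. v \<in> e} = {{v, a}, {v, b}}"
    by (rule edges_at[OF assms(1) v])
  have ne: "{v, a} \<noteq> {v, b}" using ab(1,2) by (auto simp: doubleton_eq_iff)
  have m: "{v, a} \<in> bd i" "{v, b} \<in> bd i" using ab(3) by blast+
  have "e \<in> {{v, a}, {v, b}}" using ab(3) assms(2,3) by blast
  then consider "e = {v, a}" | "e = {v, b}" by blast
  then show thesis
  proof cases
    case 1
    show thesis by (rule that[of "{v, b}"]) (use 1 ne m ab(3) in auto)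
  next
    case 2
    show thesis by (rule that[of "{v, a}"]) (use 2 ne m ab(3) in auto)
  qed
qed

section \<open>Double counting and the total charge\<close>

lemma sum_deg: "(\<Sum>v\<in>W. deg v) = 2 * card F"
proof -
  have "(\<Sum>v\<in>W. deg v) = (\<Sum>v\<in>W. \<Sum>e\<in>F. if v \<in> e then 1 else 0)"
    using finite_F by (intro sum.cong) (auto simp: sum.If_cases Int_def)
  also have "\<dots> = (\<Sum>e\<in>F. \<Sum>v\<in>W. if v \<in> e then 1 else 0)"
    by (rule sum.swap)
  also have "\<dots> = (\<Sum>e\<in>F. card e)"
  proof (rule sum.cong)
    fix e assume "e \<in> F"
    then have "W \<inter> {v. v \<in> e} = e" using Union_F by auto
    then show "(\<Sum>v\<in>W. if v \<in> e then 1 else 0) = card e"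
      using finite_W by (simp add: sum.If_cases)
  qed simp
  also have "\<dots> = 2 * card F" using card_edge by simp
  finally show ?thesis .
qed

lemma sum_length: "(\<Sum>i<n. length (D i)) = 2 * card F"
proof -
  have "(\<Sum>i<n. length (D i)) = (\<Sum>i<n. \<Sum>e\<in>F. if e \<in> bd i then 1 else 0)"
  proof (rule sum.cong)
    fix i assume "i \<in> {..<n}"
    then have "card (bd i) = length (D i)" "F \<inter> bd i = bd i" using face[of i] card_bd by auto
    then show "length (D i) = (\<Sum>e\<in>F. if e \<in> bd i then 1 else 0)"
      using finite_F by (simp add: sum.If_cases)
  qed simp
  also have "\<dots> = (\<Sum>e\<in>F. \<Sum>i<n. if e \<in> bd i then 1 else 0)" by (rule sum.swap)
  also have "\<dots> = (\<Sum>e\<in>F. card {i. i < n \<and> e \<in> bd i})"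
    by (intro sum.cong) (auto simp: sum.If_cases Int_def)
  also have "\<dots> = 2 * card F" using card_faces by simp
  finally show ?thesis .
qed

lemma Euler: "card W + n = card F + 2"
  using cover Union_F by (simp add: cycle_cover_def)

lemma total_charge: "(\<Sum>v\<in>W. real (deg v) - 4) + (\<Sum>i<n. real (length (D i)) - 4) = - 8"
proof -
  have "(\<Sum>v\<in>W. real (deg v) - 4) = 2 * real (card F) - 4 * real (card W)"
    using sum_deg by (simp add: sum_subtractf flip: of_nat_sum)
  moreover have "(\<Sum>i<n. real (length (D i)) - 4) = 2 * real (card F) - 4 * real n"
    using sum_length by (simp add: sum_subtractf flip: of_nat_sum)
  moreover have "real (card W) + real n = real (card F) + 2" using Euler by linarith
  ultimately show ?thesis by linarith
qed

lemma sum_deg_ge: "(\<Sum>v\<in>W. deg v) \<ge> 4 * (card W - 1)"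
proof -
  have "4 * (card W - 1) = (\<Sum>v\<in>W - {w}. 4)" using w finite_W by simp
  also have "\<dots> \<le> (\<Sum>v\<in>W - {w}. deg v)"
    by (rule sum_mono) (use degree_ge_4 in auto)
  also have "\<dots> \<le> (\<Sum>v\<in>W. deg v)" by (rule sum_mono2) (use finite_W in auto)
  finally show ?thesis .
qed

text \<open>
  If only two faces remained, there would be as many edges as vertices, too few for the degrees.
\<close>

lemma bd_inj: "i < n \<Longrightarrow> j < n \<Longrightarrow> bd i = bd j \<Longrightarrow> i = j"
proof -
  assume ij: "i < n" "j < n" "bd i = bd j"
  have "n \<noteq> 2"
  proof
    assume "n = 2"
    then have "card W = card F" using Euler by simp
    then have "4 * (card W - 1) \<le> 2 * card W" using sum_deg sum_deg_ge by simp
    moreover have "card (set (D i)) \<le> card W"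
      by (rule card_mono[OF finite_W set_D_subset[OF ij(1)]])
    then have "card W \<ge> 3" using face[OF ij(1)] by (simp add: distinct_card)
    ultimately show False by linarith
  qed
  then have "inj_on (\<lambda>i. cycle_edges (D i)) {..<n}"
    using cover by (simp add: cycle_cover_def)
  then show "i = j" using ij by (auto dest: inj_onD)
qed

section \<open>Triangular faces and their neighbours\<close>

lemma triangle_edge:
  assumes "j \<in> triangles" "e \<in> bd j"
  obtains a b c where "e = {a, b}" "distinct [a, b, c]" "bd j = {{a, b}, {b, c}, {c, a}}"
    "set (D j) = {a, b, c}"
proof -
  have j: "j < n" "length (D j) = 3" "distinct (D j)" using assms face by (auto simp: triangles_def)
  obtain a b zs where z: "e = {a, b}" "distinct (a # b # zs)" "length (a # b # zs) = length (D j)"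
    "set (a # b # zs) = set (D j)" "cycle_edges (a # b # zs) = bd j"
    by (rule cycle_edges_rotate_edge[OF assms(2)]) (use j in auto)
  then obtain c where "zs = [c]" using j by (cases zs) auto
  then show thesis using that[of a b c] z by (auto simp: cycle_edges_Cons)
qed

lemma triangle_at:
  assumes "j \<in> triangles" "e \<in> bd j" "e = {a, b}"
  obtains c where "distinct [a, b, c]" "bd j = {{a, b}, {b, c}, {c, a}}" "set (D j) = {a, b, c}"
proof -
  obtain a' b' c
    where t: "e = {a', b'}" "distinct [a', b', c]" "bd j = {{a', b'}, {b', c}, {c, a'}}"
    "set (D j) = {a', b', c}" by (rule triangle_edge[OF assms(1,2)])
  then consider "a = a'" "b = b'" | "a = b'" "b = a'"
    using assms(3) by (auto simp: doubleton_eq_iff)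
  then show thesis
  proof cases
    case 1
    then show thesis using that[of c] t by simp
  next
    case 2
    then show thesis using that[of c] t by (auto simp: insert_commute)
  qed
qed

text \<open>Triangles \<open>a b c\<close> and \<open>a b d\<close> with \<open>c \<noteq> d\<close>
  would form the 4-cycle \<open>a c b d\<close> with the chord \<open>{a, b}\<close>. If
  \<open>c = d\<close>, the boundaries coincide, hence the faces do.\<close>

lemma triangles_edge_disjoint:
  assumes "i \<in> triangles" "j \<in> triangles" "e \<in> bd i" "e \<in> bd j"
  shows "i = j"
proof -
  have ij: "i < n" "j < n" using assms by (auto simp: triangles_def)
  obtain a b c where i: "e = {a, b}" "distinct [a, b, c]" "bd i = {{a, b}, {b, c}, {c, a}}"
    by (rule triangle_edge[OF assms(1,3)])
  obtain d where d: "distinct [a, b, d]" "bd j = {{a, b}, {b, d}, {d, a}}"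
    by (rule triangle_at[OF assms(2,4) i(1)])
  have "c = d"
  proof (rule ccontr)
    assume "c \<noteq> d"
    have "{{a, c}, {c, b}, {b, d}, {d, a}, {a, b}, {c, b}} \<subseteq> F"
      using face[OF ij(1)] face[OF ij(2)] i(3) d(2) by (auto simp: insert_commute)
    then show False
      using no_triangle_on_4_cycle[of a c b d b] i(2) d(1) \<open>c \<noteq> d\<close> by auto
  qed
  then show ?thesis using bd_inj[OF ij] i d by simp
qed

lemma tri_in_F: "tri e \<Longrightarrow> e \<in> F"
  using face unfolding tri_def triangles_def by blast

lemma tri_faces:
  assumes "tri e"
  obtains j k
    where "j \<in> triangles" "k < n" "k \<notin> triangles"
      "{i. i < n \<and> e \<in> bd i} = {j, k}"
proof -
  obtain j where j: "j \<in> triangles" "e \<in> bd j" using assms by (auto simp: tri_def)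
  obtain k where k: "k < n" "e \<in> bd k" "k \<noteq> j"
    using other_face[OF tri_in_F[OF assms]] by metis
  have "k \<notin> triangles" using triangles_edge_disjoint j k by blast
  moreover have "{i. i < n \<and> e \<in> bd i} = {j, k}"
    using j k three_faces[OF j(2) k(2)] by (auto simp: triangles_def)
  ultimately show thesis using that j k by blast
qed

lemma no_tri_on_4_face:
  assumes "i < n" "length (D i) = 4" "e \<in> bd i"
  shows "\<not> tri e"
proof
  assume "tri e"
  then obtain j where j: "j \<in> triangles" "e \<in> bd j" by (auto simp: tri_def)
  obtain a b zs where z: "e = {a, b}" "distinct (a # b # zs)" "length (a # b # zs) = length (D i)"
    "cycle_edges (a # b # zs) = bd i"
    by (rule cycle_edges_rotate_edge[OF assms(3)]) (use face[OF assms(1)] in auto)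
  then obtain c d where zs: "zs = [c, d]"
    using assms(2) by (auto simp: length_Suc_conv eval_nat_numeral)
  obtain x where x: "distinct [a, b, x]" "bd j = {{a, b}, {b, x}, {x, a}}"
    by (rule triangle_at[OF j z(1)])
  have "{{a, b}, {b, c}, {c, d}, {d, a}} \<subseteq> F"
    using face[OF assms(1)] z(4) zs by (auto simp: cycle_edges_Cons)
  moreover have "{{a, x}, {b, x}} \<subseteq> F"
    using face[of j] j x by (auto simp: triangles_def insert_commute)
  ultimately show False using no_triangle_on_4_cycle[of a b c d x] z(2) zs by auto
qed

text \<open>If the tip of the triangle lay on the pentagon, a chord would cut the pentagon into a
  triangle and a 4-cycle with a common edge. So both together form a house. When the pentagon has no
  big vertex, only the tip can prevent the house from being reducible.\<close>

lemma pentagon_house: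
  assumes k: "k < n" "length (D k) = 5" and e: "e \<in> bd k"
    "e \<in> bd j" and j: "j \<in> triangles"
    and b: "b \<in> set (D j)" "b \<notin> e"
  shows "b \<notin> set (D k)" "nbig k = 0 \<Longrightarrow> big b"
proof -
  obtain a x zs where z: "e = {a, x}" "distinct (a # x # zs)" "length (a # x # zs) = length (D k)"
    "set (a # x # zs) = set (D k)" "cycle_edges (a # x # zs) = bd k"
    by (rule cycle_edges_rotate_edge[OF e(1)]) (use face[OF k(1)] in auto)
  then obtain c d f where zs: "zs = [c, d, f]"
    using k(2) by (auto simp: length_Suc_conv eval_nat_numeral)
  obtain b'
    where b': "distinct [a, x, b']" "bd j = {{a, x}, {x, b'}, {b', a}}" "set (D j) = {a, x, b'}"
    by (rule triangle_at[OF j e(2) z(1)])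
  have [simp]: "b' = b" using b b' z(1) by auto
  have kF: "{{a, x}, {x, c}, {c, d}, {d, f}, {f, a}} \<subseteq> F"
    using face[OF k(1)] z(5) zs by (auto simp: cycle_edges_Cons)
  have jF: "{{x, b}, {b, a}} \<subseteq> F" using face[of j] j b' by (auto simp: triangles_def)
  have [simp]: "{a, x} \<in> F" "{x, c} \<in> F" "{c, d} \<in> F" "{d, f} \<in> F"
    "{f, a} \<in> F" "{x, b} \<in> F" "{b, a} \<in> F"
    using kF jF by simp_all
  have [simp]: "{x, a} \<in> F" "{c, x} \<in> F" "{d, c} \<in> F" "{f, d} \<in> F"
    "{a, f} \<in> F" "{b, x} \<in> F" "{a, b} \<in> F"
    using kF jF by (simp_all add: insert_commute)
  have dist: "distinct [a, x, c, d, f]" using z zs by simp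
  have "b \<noteq> c"
  proof
    assume "b = c"
    then have "{a, c} \<in> F" "{c, a} \<in> F" using jF \<open>{a, b} \<in> F\<close> by simp_all
    then show False using no_triangle_on_4_cycle[of a c d f x] dist by auto
  qed
  moreover have "b \<noteq> f"
  proof
    assume "b = f"
    then have "{f, x} \<in> F" "{x, f} \<in> F" using jF \<open>{b, x} \<in> F\<close> by simp_all
    then show False using no_triangle_on_4_cycle[of f x c d a] dist by auto
  qed
  moreover have "b \<noteq> d"
  proof
    assume "b = d"
    then have "{d, a} \<in> F" "{a, d} \<in> F" using jF \<open>{a, b} \<in> F\<close> by simp_all
    then show False using no_triangle_on_4_cycle[of d a x c f] dist by auto
  qed
  ultimately show nb: "b \<notin> set (D k)" using b' z(4)[symmetric] zs by auto
  assume "nbig k = 0"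
  then have small: "\<not> big v" if "v \<in> set (D k)" for v using that by (auto simp: nbig_def)
  have "distinct [a, x, c, d, f, b]" using nb z zs by auto
  then obtain v where v: "v \<in> {a, x, c, d, f, b}" "v = w \<or> deg v \<noteq> 4"
    using no_house[of a x c d f b] by auto
  have Dk: "set (D k) = {a, x, c, d, f}" using z(4) zs by auto
  have "{a, x, c, d, f, b} \<subseteq> W"
    using set_D_subset[OF k(1)] set_D_subset[of j] j b(1) Dk by (auto simp: triangles_def)
  then have "v \<in> W" using v(1) by blast
  then have bv: "big v" using v(2) degree_ge_4[of v] by (cases "v = w") (auto simp: big_def)
  then have "v \<notin> set (D k)" using small by blast
  then show "big b" using v(1) bv Dk by simp
qed

text \<open>
  The face opposite to \<open>v\<close> across the triangle \<open>j\<close> is bad and has no big vertex. Such a face is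
  supported with \<open>2/15\<close> across each of its triangles, because the third vertex of the triangle is
  then big by the reducibility of the house.
\<close>

definition used :: "'a \<Rightarrow> nat \<Rightarrow> bool" where
  "used v j \<longleftrightarrow> (\<exists>k f. bad k \<and> nbig k = 0 \<and> f \<in> bd j \<and> f \<in> bd k \<and> v \<notin> f)"

definition triangle_value :: "'a \<Rightarrow> nat \<Rightarrow> real" where
  "triangle_value v j = (if used v j then 1/6 else 1/3)"

text \<open>
  A bad face charges a big vertex at most \<open>1/3\<close> for each of its edges there that lie on a triangle,
  and only \<open>1/6\<close> if that triangle has to support the face opposite to the vertex: then the bad
  face has a second big vertex. Since \<open>2 * 1/6 + 2/15 \<le> 2/3\<close>, every triangle costs at most \<open>2/3\<close>.
\<close>

definition edge_value :: "'a \<Rightarrow> 'a set \<Rightarrow> real" where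
  "edge_value v e = (if \<exists>j\<in>triangles. e \<in> bd j \<and> used v j then 1/6 else 1/3)"

text \<open>
  Without big vertices this is \<open>x / 0 = 0\<close>; it is only charged to big vertices of the face.
\<close>

definition share :: "nat \<Rightarrow> real" where
  "share i = (real (ntri i) - 3) / (3 * real (nbig i))"

definition bad_at :: "'a \<Rightarrow> nat set" where
  "bad_at v = {i. bad i \<and> v \<in> set (D i)}"

definition triangles_at :: "'a \<Rightarrow> nat set" where
  "triangles_at v = {j \<in> triangles. v \<in> set (D j)}"

definition tri_at :: "'a \<Rightarrow> 'a set set" where
  "tri_at v = {e \<in> F. v \<in> e \<and> tri e}"

definition used_at :: "'a \<Rightarrow> nat set" where
  "used_at v = {j \<in> triangles_at v. used v j}"

text \<open>Here \<open>2/15\<close> is the deficit \<open>2/3\<close> of a bad face with five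
  triangles, divided among them. With four triangles the deficit is \<open>1/3\<close> and
  \<open>1/12\<close> per triangle would do.\<close>

definition load :: "'a \<Rightarrow> real" where
  "load v = (\<Sum>i\<in>bad_at v. share i) + 2/15 * real (card (used_at v))"

section \<open>Bad faces and their charge to one big vertex\<close>

lemma badD: "bad i \<Longrightarrow> i < n \<and> length (D i) = 5 \<and> i \<notin> triangles"
  by (auto simp: bad_def triangles_def)

lemma trianglesD: "j \<in> triangles \<Longrightarrow> j < n \<and> length (D j) = 3"
  by (auto simp: triangles_def)

lemma not_big: "v \<in> W \<Longrightarrow> \<not> big v \<Longrightarrow> v \<noteq> w \<and> deg v = 4"
  using degree_ge_4[of v] by (fastforce simp: big_def)

lemma nbig_eq_0: "nbig i = 0 \<longleftrightarrow> (\<forall>v\<in>set (D i). \<not> big v)"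
  by (auto simp: nbig_def)

lemma finite_inc [simp]: "finite (inc v)"
  using finite_F by simp

lemma card_not_tri: "bad i \<Longrightarrow> card {e \<in> bd i. \<not> tri e} \<le> 1"
proof -
  assume i: "bad i"
  have "card (bd i) = card {e \<in> bd i. tri e} + card {e \<in> bd i. \<not> tri e}"
    by (subst card_Un_disjoint[symmetric]) (auto intro: arg_cong[where f = card])
  then show ?thesis using i card_bd[of i] by (auto simp: bad_def ntri_def)
qed

lemma bad_tri:
  assumes "bad i" "e \<in> bd i" "\<not> tri e" "e' \<in> bd i" "e' \<noteq> e"
  shows "tri e'"
proof (rule ccontr)
  assume "\<not> tri e'"
  then have "card {e, e'} \<le> card {e \<in> bd i. \<not> tri e}"
    by (intro card_mono) (use assms in auto)
  then show False using card_not_tri[OF assms(1)] assms(5) by simp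
qed

lemma ntri_le: "i < n \<Longrightarrow> ntri i \<le> length (D i)"
  using card_mono[of "bd i" "{e \<in> bd i. tri e}"] card_bd[of i] by (simp add: ntri_def)

lemma edge_other_end:
  assumes "e \<in> F" "a \<in> e"
  obtains b where "e = {a, b}" "b \<noteq> a"
proof -
  obtain x y where xy: "e = {x, y}" "x \<noteq> y"
    using card_edge[OF assms(1)] by (auto simp: card_2_iff)
  then consider "a = x" | "a = y" using assms(2) by auto
  then show thesis using that[of x] that[of y] xy by cases (auto simp: insert_commute)
qed

text \<open>The triangle \<open>j\<close> has vertices \<open>v\<close>, \<open>a\<close>,
  \<open>u1\<close>; beyond \<open>{a, u1}\<close> lies a bad face \<open>k\<close> without big
  vertices, so \<open>a\<close> has degree 4. Let \<open>e' = {a, b}\<close> and let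
  \<open>X\<close> be the triangle \<open>a b x\<close>. Then the edges at \<open>a\<close> go to
  \<open>v\<close>, \<open>u1\<close>, \<open>b\<close>, \<open>x\<close>. The second edge of
  \<open>k\<close> at \<open>a\<close> must be \<open>{a, x}\<close>, as \<open>{a, v}\<close> and
  \<open>{a, b}\<close> already have two other faces. So \<open>k\<close> and \<open>X\<close> form
  a house with tip \<open>b\<close>, and \<open>b\<close> is a big vertex of
  \<open>i\<close>.\<close>

lemma used_neighbour_big:
  assumes i: "bad i" "v \<in> set (D i)" "big v"
    and e: "{v, a} \<in> bd i" "a \<noteq> v" "j \<in> triangles" "{v, a} \<in> bd j" "used v j"
    and e': "e' \<in> bd i" "a \<in> e'" "v \<notin> e'" "tri e'"
  shows "\<exists>u\<in>set (D i). u \<noteq> v \<and> big u"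
proof -
  obtain u1
    where u1: "distinct [v, a, u1]" "bd j = {{v, a}, {a, u1}, {u1, v}}" "set (D j) = {v, a, u1}"
    by (rule triangle_at[OF e(3,4) refl])
  obtain k f where k: "bad k" "nbig k = 0" "f \<in> bd j" "f \<in> bd k" "v \<notin> f"
    using e(5) by (auto simp: used_def)
  have f: "f = {a, u1}" using k(3,5) u1(2) by auto
  have nat: "i < n" "j < n" "k < n" using badD i k trianglesD e(3) by auto
  have "i \<noteq> k" using i k(2) by (auto simp: nbig_eq_0)
  have jik: "j \<noteq> i" "j \<noteq> k" using badD i(1) k(1) e(3) by auto
  obtain X where X: "X \<in> triangles" "e' \<in> bd X" using e'(4) by (auto simp: tri_def)
  have Xn: "X < n" "X \<noteq> i" "X \<noteq> k" using X trianglesD badD i(1) k(1) by auto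
  have "e' \<in> F" using face[OF nat(1)] e' by auto
  then obtain b where b: "e' = {a, b}" "b \<noteq> a" using edge_other_end[OF _ e'(2)] by blast
  have "b \<noteq> v" using b e'(3) by auto
  have "b \<noteq> u1"
  proof
    assume "b = u1"
    then have "f \<in> bd i" using f b e'(1) by simp
    then show False using three_faces[of f i j k] k nat jik \<open>i \<noteq> k\<close> by auto
  qed
  have "X \<noteq> j"
  proof
    assume "X = j"
    then have "{a, b} \<in> {{v, a}, {a, u1}, {u1, v}}" using X(2) b(1) u1(2) by simp
    then show False
      using u1(1) \<open>b \<noteq> v\<close> \<open>b \<noteq> u1\<close> b(2)
      by (simp add: doubleton_eq_iff)
  qed
  obtain x where x: "distinct [a, b, x]" "bd X = {{a, b}, {b, x}, {x, a}}" "set (D X) = {a, b, x}"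
    by (rule triangle_at[OF X b(1)])
  have xv: "x \<noteq> v"
  proof
    assume "x = v"
    then have "{v, a} \<in> bd X" using x(2) by simp
    then show False
      using triangles_edge_disjoint[OF X(1) e(3) _ e(4)] \<open>X \<noteq> j\<close> by simp
  qed
  have xu: "x \<noteq> u1"
  proof
    assume "x = u1"
    then have "{u1, a} \<in> bd X" using x(2) by simp
    then have "{a, u1} \<in> bd X" by (simp add: insert_commute)
    moreover have "{a, u1} \<in> bd j" using u1(2) by simp
    ultimately show False
      using triangles_edge_disjoint[OF X(1) e(3)] \<open>X \<noteq> j\<close> by blast
  qed
  have "a \<in> f" using f by simp
  then have ak: "a \<in> set (D k)" using Union_bd[OF nat(3)] k(4) by blast
  then have "\<not> big a" using k(2) by (auto simp: nbig_eq_0)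
  moreover have "a \<in> W" using set_D_subset[OF nat(3)] ak by auto
  ultimately have da: "deg a = 4" using not_big by auto
  have sub: "{{a, v}, {a, u1}, {a, b}, {a, x}} \<subseteq> inc a"
    using face[OF nat(1)] face[OF nat(2)] face[OF Xn(1)] e(1) u1(2) x(2)
    by (auto simp: insert_commute)
  have "card {{a, v}, {a, u1}, {a, b}, {a, x}} = 4"
    using u1(1) x(1) xv xu \<open>b \<noteq> v\<close> \<open>b \<noteq> u1\<close>
    by (auto simp: doubleton_eq_iff card_insert_if)
  then have inca: "inc a = {{a, v}, {a, u1}, {a, b}, {a, x}}"
    using card_subset_eq[OF finite_inc sub] da by simp
  obtain f' where f': "f' \<in> bd k" "a \<in> f'" "f' \<noteq> f"
    by (rule other_edge_at[OF nat(3) \<open>a \<in> f\<close> k(4)])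
  have "f' \<in> inc a" using f' face[OF nat(3)] by auto
  then have f'4: "f' \<in> {{a, v}, {a, u1}, {a, b}, {a, x}}" by (simp only: inca)
  have f'1: "f' \<noteq> {a, v}"
  proof
    assume "f' = {a, v}"
    then have "f' = {v, a}" by auto
    then show False
      using three_faces[of f' i j k] f'(1) e nat jik \<open>i \<noteq> k\<close> by auto
  qed
  have f'2: "f' \<noteq> {a, b}"
    using three_faces[of e' i X k] f'(1) e'(1) X(2) nat Xn \<open>i \<noteq> k\<close> b(1) by auto
  have fx: "f' = {a, x}" using f'4 f'1 f'2 f'(3) f by simp
  then have "f' \<in> bd X" using x(2) by (auto simp: insert_commute)
  moreover have "length (D k) = 5" using badD k(1) by auto
  moreover have "b \<notin> f'" using fx x(1) by auto
  moreover have "b \<in> set (D X)" using x(3) by auto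
  ultimately have "big b" using pentagon_house(2)[OF nat(3) _ f'(1) _ X(1) _ _ k(2)] by blast
  moreover have "b \<in> set (D i)" using Union_bd[OF nat(1)] e'(1) b by auto
  ultimately show ?thesis using \<open>b \<noteq> v\<close> by auto
qed

lemma edge_value_bounds: "1/6 \<le> edge_value v e" "edge_value v e \<le> 1/3" "0 \<le> edge_value v e"
  by (auto simp: edge_value_def)

text \<open>Only three edges of the pentagon avoid \<open>v\<close>, so at least
  \<open>ntri i - 3\<close> triangle edges meet \<open>v\<close>. With two big vertices the value
  \<open>1/6\<close> per edge suffices. If \<open>v\<close> is the only one, \<open>1/3\<close> per
  edge suffices. If then some value is only \<open>1/6\<close>, the preceding lemma yields an edge
  on no triangle away from \<open>v\<close>: so \<open>ntri i = 4\<close>, both edges at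
  \<open>v\<close> count, and they cover the share \<open>1/3\<close>.\<close>

lemma share_le:
  assumes i: "bad i" "v \<in> set (D i)" "big v"
  shows "share i \<le> (\<Sum>e\<in>{e \<in> bd i. v \<in> e \<and> tri e}. edge_value v e)"
proof -
  let ?T = "{e \<in> bd i. v \<in> e \<and> tri e}"
  have iN: "i < n" "length (D i) = 5" using badD i(1) by auto
  have nt: "4 \<le> ntri i" "ntri i \<le> 5" using i ntri_le[OF iN(1)] iN by (auto simp: bad_def)
  have fin: "finite ?T" by simp
  have cT: "ntri i \<le> card ?T + 3"
  proof -
    have "card {e \<in> bd i. v \<notin> e} + card {e \<in> bd i. v \<in> e} = card (bd i)"
      by (subst card_Un_disjoint[symmetric]) (auto intro: arg_cong[where f = card])
    then have "card {e \<in> bd i. v \<notin> e} = 3"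
      using card_edges_at[OF iN(1) i(2)] card_bd iN by simp
    moreover have "{e \<in> bd i. tri e} \<subseteq> ?T \<union> {e \<in> bd i. v \<notin> e}"
      by auto
    then have "card {e \<in> bd i. tri e} \<le> card (?T \<union> {e \<in> bd i. v \<notin> e})"
      by (rule card_mono[rotated]) simp
    moreover have "card (?T \<union> {e \<in> bd i. v \<notin> e}) \<le> card ?T + card {e \<in> bd i. v \<notin> e}"
      by (rule card_Un_le)
    ultimately show ?thesis by (simp add: ntri_def)
  qed
  have ge: "real (card ?T) / 6 \<le> (\<Sum>e\<in>?T. edge_value v e)"
    using sum_bounded_below[of ?T "1/6" "edge_value v"] edge_value_bounds(1) by simp
  have vin: "v \<in> {v \<in> set (D i). big v}" using i by simp
  then have "nbig i > 0" by (auto simp: nbig_def card_gt_0_iff)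
  then consider "nbig i \<ge> 2" | "nbig i = 1" by linarith
  then show ?thesis
  proof cases
    case 1
    have "share i \<le> (real (ntri i) - 3) / 6"
      unfolding share_def by (rule divide_left_mono) (use 1 nt in auto)
    also have "\<dots> \<le> real (card ?T) / 6" using cT by simp
    finally show ?thesis using ge by simp
  next
    case 2
    then obtain z where "{v \<in> set (D i). big v} = {z}"
      unfolding nbig_def by (rule card_1_singletonE)
    then have only: "u = v" if "u \<in> set (D i)" "big u" for u using that vin by auto
    have sh: "share i = (real (ntri i) - 3) / 3" using 2 by (simp add: share_def)
    show ?thesis
    proof (cases "\<exists>e\<in>?T. edge_value v e \<noteq> 1/3")
      case False
      then have "(\<Sum>e\<in>?T. edge_value v e) = (\<Sum>e\<in>?T. 1/3)" by (intro sum.cong) auto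
      then have "(\<Sum>e\<in>?T. edge_value v e) = real (card ?T) / 3" by simp
      then show ?thesis using sh cT by simp
    next
      case True
      then obtain e j
        where e: "e \<in> bd i" "v \<in> e" "tri e" "j \<in> triangles" "e \<in> bd j" "used v j"
        by (auto simp: edge_value_def split: if_splits)
      have "e \<in> F" using face[OF iN(1)] e by auto
      then obtain a where a: "e = {v, a}" "a \<noteq> v" using edge_other_end[OF _ e(2)] by blast
      then have "a \<in> e" by simp
      obtain e' where e': "e' \<in> bd i" "a \<in> e'" "e' \<noteq> e"
        by (rule other_edge_at[OF iN(1) \<open>a \<in> e\<close> e(1)])
      have "card e' = 2" using card_edge face[OF iN(1)] e' by auto
      then have "v \<notin> e'" using e' a by (auto simp: card_2_iff doubleton_eq_iff)
      then have "\<not> tri e'" using used_neighbour_big[OF i, of a j e'] e e' a only by auto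
      note nt' = this
      have all: "tri e''" if "e'' \<in> bd i" "e'' \<noteq> e'" for e''
        using bad_tri[OF i(1) e'(1) nt'] that by auto
      have "{e \<in> bd i. tri e} \<subseteq> bd i - {e'}" using nt' by auto
      then have "card {e \<in> bd i. tri e} \<le> card (bd i - {e'})"
        by (rule card_mono[rotated]) simp
      then have n4': "ntri i = 4" using nt card_bd[OF iN(1)] iN e'(1) by (simp add: ntri_def)
      have "?T = {e \<in> bd i. v \<in> e}" using all \<open>v \<notin> e'\<close> by auto
      then have "card ?T = 2" using card_edges_at[OF iN(1) i(2)] by simp
      then show ?thesis using ge sh n4' by simp
    qed
  qed
qed

section \<open>Charges collected at one vertex\<close>

lemma tri_nontriangle_face_unique:
  assumes "tri e" "e \<in> bd i" "e \<in> bd k" "i < n" "k < n" "i \<notin> triangles"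
    "k \<notin> triangles"
  shows "i = k"
proof -
  obtain j where "j \<in> triangles" "e \<in> bd j" using assms(1) by (auto simp: tri_def)
  then show ?thesis using three_faces[of e i j k] assms trianglesD by blast
qed

lemma finite_bad [simp]: "finite {i. bad i}" "finite (bad_at v)"
  by (rule finite_subset[of _ "{..<n}"]; auto simp: bad_def bad_at_def)+

lemma finite_triangles [simp]: "finite triangles" "finite (triangles_at v)" "finite (used_at v)"
  by (rule finite_subset[of _ "{..<n}"]; auto simp: triangles_def triangles_at_def used_at_def)+

text \<open>Different bad faces charge different edges, since a triangle edge has only one face that
  is not a triangle.\<close>

lemma sum_share_le:
  assumes "big v" and I: "I \<subseteq> bad_at v"
  shows "(\<Sum>i\<in>I. share i) \<le> (\<Sum>e\<in>(\<Union>i\<in>I. {e \<in> bd i. v \<in> e \<and> tri e}). edge_value v e)"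
proof -
  have "(\<Sum>i\<in>I. share i) \<le> (\<Sum>i\<in>I. \<Sum>e\<in>{e \<in> bd i. v \<in> e \<and> tri e}. edge_value v e)"
    by (rule sum_mono, rule share_le) (use assms in \<open>auto simp: bad_at_def\<close>)
  also have "\<dots> = (\<Sum>e\<in>(\<Union>i\<in>I. {e \<in> bd i. v \<in> e \<and> tri e}). edge_value v e)"
  proof (rule sum.UNION_disjoint[symmetric])
    show "finite I" by (rule finite_subset[OF I finite_bad(2)])
    show "\<forall>i\<in>I. finite {e \<in> bd i. v \<in> e \<and> tri e}" by simp
    show "\<forall>i\<in>I. \<forall>j\<in>I. i \<noteq> j \<longrightarrow> {e \<in> bd i. v \<in> e \<and> tri e} \<inter> {e \<in> bd j. v \<in> e \<and> tri e} = {}"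
    proof (intro ballI impI, rule ccontr)
      fix i j assume ij: "i \<in> I" "j \<in> I" "i \<noteq> j"
        "{e \<in> bd i. v \<in> e \<and> tri e} \<inter> {e \<in> bd j. v \<in> e \<and> tri e} \<noteq> {}"
      then obtain e where e: "tri e" "e \<in> bd i" "e \<in> bd j" by auto
      have "bad i" "bad j" using ij I by (auto simp: bad_at_def)
      then show False using tri_nontriangle_face_unique[OF e] badD ij(3) by blast
    qed
  qed
  finally show ?thesis .
qed

lemma tri_at_UN: "tri_at v = (\<Union>j\<in>triangles_at v. {e \<in> bd j. v \<in> e})"
proof
  show "tri_at v \<subseteq> (\<Union>j\<in>triangles_at v. {e \<in> bd j. v \<in> e})"
  proof
    fix e assume e: "e \<in> tri_at v"
    then obtain j where j: "j \<in> triangles" "e \<in> bd j" by (auto simp: tri_at_def tri_def)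
    then have "v \<in> set (D j)" using Union_bd[of j] trianglesD[of j] e by (auto simp: tri_at_def)
    then show "e \<in> (\<Union>j\<in>triangles_at v. {e \<in> bd j. v \<in> e})"
      using j e by (auto simp: triangles_at_def tri_at_def)
  qed
  show "(\<Union>j\<in>triangles_at v. {e \<in> bd j. v \<in> e}) \<subseteq> tri_at v"
  proof
    fix e assume "e \<in> (\<Union>j\<in>triangles_at v. {e \<in> bd j. v \<in> e})"
    then have "v \<in> e" "tri e" by (auto simp: triangles_at_def tri_def)
    then show "e \<in> tri_at v" using tri_in_F by (auto simp: tri_at_def)
  qed
qed

lemma edge_value_triangle: "j \<in> triangles \<Longrightarrow> e \<in> bd j \<Longrightarrow> edge_value v e = triangle_value v j"
proof -
  assume j: "j \<in> triangles" "e \<in> bd j"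
  have "k = j" if "k \<in> triangles" "e \<in> bd k" for k
    using triangles_edge_disjoint[OF that(1) j(1) that(2) j(2)] .
  then have "(\<exists>k\<in>triangles. e \<in> bd k \<and> used v k) \<longleftrightarrow> used v j"
    using j by blast
  then show ?thesis by (simp add: edge_value_def triangle_value_def)
qed

text \<open>Converts sums over edges into sums over triangles, which is how the budget of a vertex
  is measured. No edge is counted twice because triangles are edge-disjoint.\<close>

lemma sum_tri_at: "(\<Sum>e\<in>tri_at v. g e) = (\<Sum>j\<in>triangles_at v. \<Sum>e\<in>{e \<in> bd j. v \<in> e}. g e)"
  unfolding tri_at_UN
proof (rule sum.UNION_disjoint)
  show "\<forall>i\<in>triangles_at v. \<forall>j\<in>triangles_at v. i \<noteq> j \<longrightarrow> {e \<in> bd i. v \<in> e} \<inter> {e \<in> bd j. v \<in> e} = {}"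
    using triangles_edge_disjoint unfolding triangles_at_def by blast
qed simp_all

lemma sum_edge_value: "(\<Sum>e\<in>tri_at v. edge_value v e) = (\<Sum>j\<in>triangles_at v. 2 * triangle_value v j)"
  unfolding sum_tri_at
proof (rule sum.cong)
  fix j assume j: "j \<in> triangles_at v"
  then have "card {e \<in> bd j. v \<in> e} = 2"
    using card_edges_at trianglesD by (auto simp: triangles_at_def)
  moreover have "(\<Sum>e\<in>{e \<in> bd j. v \<in> e}. edge_value v e) = (\<Sum>e\<in>{e \<in> bd j. v \<in> e}. triangle_value v j)"
    by (rule sum.cong) (use j edge_value_triangle in \<open>auto simp: triangles_at_def\<close>)
  ultimately show "(\<Sum>e\<in>{e \<in> bd j. v \<in> e}. edge_value v e) = 2 * triangle_value v j"
    by simp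
qed simp

lemma card_tri_at: "card (tri_at v) = 2 * card (triangles_at v)"
proof -
  have "card (tri_at v) = (\<Sum>e\<in>tri_at v. 1)" by simp
  also have "\<dots> = (\<Sum>j\<in>triangles_at v. card {e \<in> bd j. v \<in> e})"
    unfolding sum_tri_at by simp
  also have "\<dots> = (\<Sum>j\<in>triangles_at v. 2)"
    by (rule sum.cong) (use card_edges_at trianglesD in \<open>auto simp: triangles_at_def\<close>)
  finally show ?thesis by simp
qed

lemma tri_at_subset: "tri_at v \<subseteq> inc v"
  by (auto simp: tri_at_def)

lemma finite_tri_at [simp]: "finite (tri_at v)"
  by (rule finite_subset[OF tri_at_subset finite_inc])

lemma card_triangles_at: "2 * card (triangles_at v) \<le> deg v"
  using card_mono[OF finite_inc tri_at_subset, of v] card_tri_at[of v] by simp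

definition across :: "'a \<Rightarrow> nat \<Rightarrow> real" where
  "across v j = (if used v j then 2/15 else 0)"

lemma load_eq: "load v = (\<Sum>i\<in>bad_at v. share i) + (\<Sum>j\<in>triangles_at v. across v j)"
proof -
  have "(\<Sum>j\<in>triangles_at v. across v j) = 2/15 * real (card (used_at v))"
    unfolding across_def used_at_def by (simp add: sum.If_cases Int_def)
  then show ?thesis by (simp add: load_def)
qed

text \<open>The sum is \<open>1/3 + 0\<close> or \<open>1/6 + 2/15 = 3/10\<close>. Keeping this sum
  apart from a second \<open>triangle_value\<close> allows one of the latter to be saved at degree
  5.\<close>

lemma triangle_value_across: "triangle_value v j + across v j \<le> 1/3" "triangle_value v j \<le> 1/3" "0 \<le> triangle_value v j"
  by (auto simp: triangle_value_def across_def)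

lemma bad_edges_subset: "I \<subseteq> bad_at v \<Longrightarrow> (\<Union>i\<in>I. {e \<in> bd i. v \<in> e \<and> tri e}) \<subseteq> tri_at v"
  using tri_in_F by (auto simp: tri_at_def)

lemma load_le: "big v \<Longrightarrow> load v \<le> 2/3 * real (card (triangles_at v))"
proof -
  assume "big v"
  then have "(\<Sum>i\<in>bad_at v. share i) \<le> (\<Sum>e\<in>(\<Union>i\<in>bad_at v. {e \<in> bd i. v \<in> e \<and> tri e}). edge_value v e)"
    by (rule sum_share_le) simp
  also have "\<dots> \<le> (\<Sum>e\<in>tri_at v. edge_value v e)"
    by (rule sum_mono2) (use bad_edges_subset[OF order_refl] edge_value_bounds(3) in auto)
  finally have "load v \<le> (\<Sum>j\<in>triangles_at v. 2 * triangle_value v j) + (\<Sum>j\<in>triangles_at v. across v j)"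
    unfolding load_eq sum_edge_value by simp
  also have "\<dots> = (\<Sum>j\<in>triangles_at v. 2 * triangle_value v j + across v j)"
    by (simp add: sum.distrib)
  also have "\<dots> \<le> (\<Sum>j\<in>triangles_at v. 2/3)"
  proof (rule sum_mono)
    fix j show "2 * triangle_value v j + across v j \<le> 2/3"
      using triangle_value_across[of v j] by linarith
  qed
  finally show ?thesis by simp
qed

text \<open>Suppose \<open>u\<close> has degree 4. The other edges \<open>r\<close> and
  \<open>r'\<close> of \<open>g\<close> and \<open>h\<close> at \<open>u\<close> lie on triangles,
  as each bad face has at most one edge on no triangle. Different triangles would give five edges at
  \<open>u\<close>; so one triangle \<open>T\<close> contains both. Then \<open>g\<close>,
  \<open>T\<close>, \<open>h\<close> close up around \<open>u\<close>, and a face at the fourth edge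
  \<open>s\<close> would need one of \<open>e\<close>, \<open>r\<close>, \<open>r'\<close> as a
  third face.\<close>

lemma bad_faces_on_nontri_edge:
  assumes e: "e \<in> bd g" "e \<in> bd h" "\<not> tri e" "u \<in> e" and gh: "g \<noteq> h"
    "bad g" "bad h"
  shows "big u"
proof (rule ccontr)
  assume nb: "\<not> big u"
  have nat: "g < n" "h < n" using badD gh by auto
  have "u \<in> W" using Union_bd[OF nat(1)] set_D_subset[OF nat(1)] e by blast
  then have du: "deg u = 4" using not_big nb by auto
  obtain r where r: "r \<in> bd g" "u \<in> r" "r \<noteq> e" "{f \<in> bd g. u \<in> f} = {e, r}"
    by (rule other_edge_at[OF nat(1) e(4,1)])
  obtain r'
    where r': "r' \<in> bd h" "u \<in> r'" "r' \<noteq> e" "{f \<in> bd h. u \<in> f} = {e, r'}"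
    by (rule other_edge_at[OF nat(2) e(4,2)])
  have tr: "tri r" "tri r'" using bad_tri[OF gh(2) e(1,3)] bad_tri[OF gh(3) e(2,3)] r r' by auto
  have rr': "r \<noteq> r'"
    using tri_nontriangle_face_unique[OF tr(1) r(1) _ nat] r' badD gh by blast
  obtain T where T: "T \<in> triangles" "r \<in> bd T" using tr by (auto simp: tri_def)
  obtain T' where T': "T' \<in> triangles" "r' \<in> bd T'" using tr by (auto simp: tri_def)
  have TN: "T < n" "T' < n" "T \<noteq> g" "T \<noteq> h" "T' \<noteq> h" "T' \<noteq> g"
    using trianglesD T T' badD gh by auto
  obtain q where q: "q \<in> bd T" "u \<in> q" "q \<noteq> r" "{f \<in> bd T. u \<in> f} = {r, q}"
    by (rule other_edge_at[OF TN(1) r(2) T(2)])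
  obtain q' where q': "q' \<in> bd T'" "u \<in> q'" "q' \<noteq> r'"
    by (rule other_edge_at[OF TN(2) r'(2) T'(2)])
  have tq: "tri q" "tri q'" using q q' T T' by (auto simp: tri_def)
  have F: "e \<in> F" "r \<in> F" "r' \<in> F" "q \<in> F" "q' \<in> F"
    using face[OF nat(1)] e r tr tq tri_in_F by auto
  have "T = T'"
  proof (rule ccontr)
    assume "T \<noteq> T'"
    then have "bd T \<inter> bd T' = {}" using triangles_edge_disjoint T(1) T'(1) by blast
    then have "distinct [e, r, q, r', q']" using q q' r r' tq tr e(3) T T' by auto
    then have "card {e, r, q, r', q'} = 5" by (simp add: card_insert_if)
    moreover have "card {e, r, q, r', q'} \<le> card (inc u)"
      by (rule card_mono) (use F e r r' q q' in auto)
    ultimately show False using du by simp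
  qed
  then have "q = r'" using q(4) T' r' rr' by blast
  have Tu: "{f \<in> bd T. u \<in> f} = {r, r'}" using q(4) \<open>q = r'\<close> by simp
  have c3: "card {e, r, r'} = 3" using r r' rr' by (auto simp: card_insert_if)
  have "{e, r, r'} \<subseteq> inc u" using F e r r' by auto
  then have "card (inc u - {e, r, r'}) = 1" using c3 du by (subst card_Diff_subset) auto
  then obtain s where s: "inc u - {e, r, r'} = {s}" by (rule card_1_singletonE)
  have sF: "s \<in> F" "u \<in> s" "s \<noteq> e" "s \<noteq> r" "s \<noteq> r'" using s by auto
  obtain k where k: "k < n" "s \<in> bd k" using other_face[OF sF(1)] by metis
  obtain y where y: "y \<in> bd k" "u \<in> y" "y \<noteq> s"
    by (rule other_edge_at[OF k(1) sF(2) k(2)])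
  have kn: "k \<noteq> g" "k \<noteq> h" "k \<noteq> T" using r(4) r'(4) Tu k(2) sF by blast+
  have "y \<in> inc u" using y face[OF k(1)] by auto
  then have "y \<in> {e, r, r'}" using s y(3) by blast
  then show False
    using three_faces[of e g h k] three_faces[of r g T k] three_faces[of r' h T k]
      e r r' T T' \<open>T = T'\<close> y(1) k(1) nat TN kn gh(1) by blast
qed

lemma share_le_sixth:
  assumes "bad i" "v \<in> set (D i)" "big v" "u \<in> set (D i)" "big u" "u \<noteq> v"
    "e \<in> bd i" "\<not> tri e"
  shows "share i \<le> 1/6"
proof -
  have i: "i < n" "length (D i) = 5" using badD assms by auto
  have "{e \<in> bd i. tri e} \<subseteq> bd i - {e}" using assms by auto
  then have "card {e \<in> bd i. tri e} \<le> card (bd i - {e})" by (rule card_mono[rotated]) simp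
  then have "ntri i \<le> 4" using card_bd[OF i(1)] i assms(7) by (simp add: ntri_def)
  then have nt: "ntri i = 4" using assms(1) by (simp add: bad_def)
  have "card {u, v} \<le> card {v \<in> set (D i). big v}" by (rule card_mono) (use assms in auto)
  then have "real (nbig i) \<ge> 2" using assms(6) by (simp add: nbig_def)
  then show ?thesis unfolding share_def nt by (simp add: field_simps)
qed

text \<open>
  Only two triangles at a vertex of degree 5 are critical, as \<open>4/3 > 1\<close>. Then one edge \<open>vu\<close> lies on no
  triangle. If one of the two faces at \<open>vu\<close> is not bad, it charges nothing; otherwise \<open>u\<close> is big and
  both faces charge at most \<open>1/6\<close>.
\<close>

lemma load_le_1:
  assumes v: "v \<in> W" "v \<noteq> w" "deg v = 5"
  shows "load v \<le> 1"
proof (cases "card (triangles_at v) \<le> 1")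
  case True
  have "load v \<le> 2/3 * real (card (triangles_at v))"
    by (rule load_le) (use v in \<open>simp add: big_def\<close>)
  then show ?thesis using True by simp
next
  case False
  have big: "big v" using v by (simp add: big_def)
  have c2: "card (triangles_at v) = 2" using False card_triangles_at[of v] v by simp
  have c4: "card (tri_at v) = 4" using c2 card_tri_at by simp
  have "card (inc v - tri_at v) = 1" using c4 v tri_at_subset by (subst card_Diff_subset) auto
  then obtain e where e: "inc v - tri_at v = {e}" by (rule card_1_singletonE)
  have eF: "e \<in> F" "v \<in> e" "\<not> tri e" using e by (auto simp: tri_at_def)
  have tri: "tri f" if "f \<in> F" "v \<in> f" "f \<noteq> e" for f
    using e that by (auto simp: tri_at_def)
  have sum2: "(\<Sum>j\<in>triangles_at v. triangle_value v j + across v j) \<le> 2/3"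
  proof -
    have "(\<Sum>j\<in>triangles_at v. triangle_value v j + across v j) \<le> (\<Sum>j\<in>triangles_at v. 1/3)"
      by (rule sum_mono) (rule triangle_value_across)
    then show ?thesis using c2 by simp
  qed
  \<comment> \<open>The triangle edge of \<open>g\<close> at \<open>v\<close> is charged by no bad
    face. This saves one of the four edge values and leaves at most
    \<open>2/3 + 1/3\<close>.\<close>
  have not_bad: "load v \<le> 1" if g: "g < n" "e \<in> bd g" "\<not> bad g" for g
  proof -
    obtain e' where e': "e' \<in> bd g" "v \<in> e'" "e' \<noteq> e"
      by (rule other_edge_at[OF g(1) eF(2) g(2)])
    have e'F: "e' \<in> F" using face[OF g(1)] e' by auto
    have te': "tri e'" using tri e' e'F by auto
    have gT: "g \<notin> triangles" using eF(3) g(2) by (auto simp: tri_def)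
    have sub: "(\<Union>i\<in>bad_at v. {e \<in> bd i. v \<in> e \<and> tri e}) \<subseteq> tri_at v - {e'}"
    proof
      fix f assume f: "f \<in> (\<Union>i\<in>bad_at v. {e \<in> bd i. v \<in> e \<and> tri e})"
      then obtain i where i: "bad i" "f \<in> bd i" by (auto simp: bad_at_def)
      have "f \<noteq> e'"
        using tri_nontriangle_face_unique[OF te' _ e'(1) _ g(1) _ gT, of i] i badD[OF i(1)] g(3)
        by blast
      then show "f \<in> tri_at v - {e'}" using f bad_edges_subset[of "bad_at v" v] by auto
    qed
    have e't: "e' \<in> tri_at v" using te' e'F e' by (auto simp: tri_at_def)
    then obtain j where j: "j \<in> triangles_at v" "e' \<in> bd j" unfolding tri_at_UN by auto
    have "(\<Sum>i\<in>bad_at v. share i) \<le> (\<Sum>f\<in>tri_at v - {e'}. edge_value v f)"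
      using sum_share_le[OF big order_refl] sum_mono2[OF _ sub, of "edge_value v"] edge_value_bounds(3)
      by fastforce
    also have "\<dots> = (\<Sum>f\<in>tri_at v. edge_value v f) - edge_value v e'"
      using e't by (simp add: sum_diff1)
    also have "edge_value v e' = triangle_value v j"
      using edge_value_triangle j by (auto simp: triangles_at_def)
    finally have "load v \<le> (\<Sum>j\<in>triangles_at v. 2 * triangle_value v j + across v j) - triangle_value v j"
      unfolding load_eq sum_edge_value by (simp add: sum.distrib)
    also have "(\<Sum>j\<in>triangles_at v. 2 * triangle_value v j + across v j) =
      (\<Sum>j\<in>triangles_at v. triangle_value v j + across v j) + (\<Sum>j\<in>triangles_at v. triangle_value v j)"
      by (simp add: sum.distrib sum_distrib_left[symmetric])
    also have "(\<Sum>j\<in>triangles_at v. triangle_value v j) =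
      triangle_value v j + (\<Sum>j\<in>triangles_at v - {j}. triangle_value v j)"
      using j by (simp add: sum.remove)
    also have "(\<Sum>j\<in>triangles_at v - {j}. triangle_value v j) \<le> (\<Sum>j\<in>triangles_at v - {j}. 1/3)"
      by (rule sum_mono) (rule triangle_value_across)
    also have "\<dots> = 1/3" using j c2 by simp
    finally show ?thesis using sum2 by simp
  qed
  \<comment> \<open>The index \<open>n\<close> belongs to no face, so \<open>g\<close> is just some
    face at \<open>e\<close>.\<close>
  obtain g where g: "g < n" "e \<in> bd g" "g \<noteq> n" by (rule other_face[OF eF(1)])
  obtain h where h: "h < n" "e \<in> bd h" "h \<noteq> g" by (rule other_face[OF eF(1)])
  show ?thesis
  proof (cases "bad g \<and> bad h")
    case False
    then show ?thesis using not_bad g h by auto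
  next
    case True
    obtain u where u: "e = {v, u}" "u \<noteq> v" by (rule edge_other_end[OF eF(1,2)])
    have ub: "big u" using bad_faces_on_nontri_edge[OF g(2) h(2) eF(3), of u] u h(3) True by auto
    have gh: "v \<in> set (D g)" "u \<in> set (D g)" "v \<in> set (D h)" "u \<in> set (D h)"
      using Union_bd[OF g(1)] Union_bd[OF h(1)] g(2) h(2) u(1) by auto
    have sg: "share g \<le> 1/6"
      using share_le_sixth[of g v u e] True gh big ub u(2) g(2) eF(3) by auto
    have sh: "share h \<le> 1/6"
      using share_le_sixth[of h v u e] True gh big ub u(2) h(2) eF(3) by auto
    obtain eg where eg: "eg \<in> bd g" "v \<in> eg" "eg \<noteq> e"
      by (rule other_edge_at[OF g(1) eF(2) g(2)])
    obtain eh where eh: "eh \<in> bd h" "v \<in> eh" "eh \<noteq> e"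
      by (rule other_edge_at[OF h(1) eF(2) h(2)])
    have egT: "eg \<in> tri_at v" "eh \<in> tri_at v" using tri eg eh face[OF g(1)] face[OF h(1)]
      by (auto simp: tri_at_def)
    then have tg: "tri eg" "tri eh" by (auto simp: tri_at_def)
    have gh_at: "g \<in> bad_at v" "h \<in> bad_at v" using True gh by (auto simp: bad_at_def)
    let ?R = "bad_at v - {g, h}"
    \<comment> \<open>A further bad face at \<open>v\<close> avoids \<open>e\<close>, which has the
      faces \<open>g\<close> and \<open>h\<close>, and also \<open>eg\<close> and \<open>eh\<close>,
      whose non-triangular faces are \<open>g\<close> and \<open>h\<close>. It must use the two
      remaining edges at \<open>v\<close>, so there is at most one such face.\<close>
    have R: "k < n" "bad k" "k \<notin> triangles" "v \<in> set (D k)"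
      "card {f \<in> bd k. v \<in> f} = 2"
      "{f \<in> bd k. v \<in> f} \<subseteq> tri_at v - {eg, eh}"
      if "k \<in> ?R" for k
    proof -
      show k: "k < n" "bad k" "k \<notin> triangles" "v \<in> set (D k)"
        using that badD by (auto simp: bad_at_def)
      then show "card {f \<in> bd k. v \<in> f} = 2" using card_edges_at by blast
      show "{f \<in> bd k. v \<in> f} \<subseteq> tri_at v - {eg, eh}"
      proof
        fix f assume f: "f \<in> {f \<in> bd k. v \<in> f}"
        have "f \<noteq> e" using three_faces[of e g h k] g h k f that by auto
        then have tf: "tri f" "f \<in> F" using tri f face[OF k(1)] by auto
        moreover have "f \<noteq> eg"
          using tri_nontriangle_face_unique[of f k g] tf f eg k g badD True that by auto
        moreover have "f \<noteq> eh"
          using tri_nontriangle_face_unique[of f k h] tf f eh k h badD True that by auto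
        ultimately show "f \<in> tri_at v - {eg, eh}" using f by (auto simp: tri_at_def)
      qed
    qed
    have "eg \<noteq> eh"
      using tri_nontriangle_face_unique[of eg g h] tg eg eh g h badD True by auto
    then have c2': "card (tri_at v - {eg, eh}) = 2" using c4 egT by (simp add: card_Diff_subset)
    have Req: "{f \<in> bd k. v \<in> f} = tri_at v - {eg, eh}" if "k \<in> ?R" for k
      by (rule card_subset_eq) (use R[OF that] c2' in auto)
    have R1: "k = l" if kl: "k \<in> ?R" "l \<in> ?R" for k l
    proof -
      obtain f where f: "f \<in> tri_at v - {eg, eh}"
        using c2' by (metis card.empty ex_in_conv zero_neq_numeral)
      then have "f \<in> bd k" "f \<in> bd l" "tri f"
        using Req[OF kl(1), symmetric] Req[OF kl(2), symmetric]
        by (blast, blast, auto simp: tri_at_def)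
      then show ?thesis using tri_nontriangle_face_unique[of f k l] R[OF kl(1)] R[OF kl(2)] by auto
    qed
    have rest: "(\<Sum>k\<in>?R. share k) \<le> (\<Sum>j\<in>triangles_at v. triangle_value v j)"
    proof (cases "?R = {}")
      case True
      have "0 \<le> (\<Sum>j\<in>triangles_at v. triangle_value v j)"
        by (rule sum_nonneg) (rule triangle_value_across)
      then show ?thesis unfolding True by simp
    next
      case False
      then obtain k where k: "k \<in> ?R" by blast
      have Rk: "?R = {k}" using R1 k by blast
      obtain a b
        where ab: "a \<noteq> b" "a \<noteq> v" "b \<noteq> v" "a \<in> set (D k)"
          "b \<in> set (D k)"
        "{f \<in> bd k. v \<in> f} = {{v, a}, {v, b}}" by (rule edges_at[OF R(1,4)[OF k]])
      have abT: "{v, a} \<in> tri_at v" "{v, b} \<in> tri_at v" "{v, a} \<in> bd k"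
        using R(6)[OF k] ab(6) by blast+
      obtain ja where ja: "ja \<in> triangles_at v" "{v, a} \<in> bd ja"
        using abT(1) unfolding tri_at_UN by auto
      obtain jb where jb: "jb \<in> triangles_at v" "{v, b} \<in> bd jb"
        using abT(2) unfolding tri_at_UN by auto
      have jT: "ja \<in> triangles" "jb \<in> triangles"
        using ja jb by (auto simp: triangles_at_def)
      \<comment> \<open>A common triangle would have its tip on the pentagon
        \<open>k\<close>.\<close>
      have "ja \<noteq> jb"
      proof
        assume "ja = jb"
        then have "b \<in> set (D ja)" using Union_bd[of jb] jb(2) trianglesD jT by blast
        moreover have "length (D k) = 5" using R(2)[OF k] badD by auto
        ultimately have "b \<notin> set (D k)"
          using pentagon_house(1)[OF R(1)[OF k] _ abT(3) ja(2) jT(1)] ab by auto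
        then show False using ab by simp
      qed
      then have tv: "{ja, jb} = triangles_at v"
        by (intro card_subset_eq) (use ja jb c2 in auto)
      have ne: "{v, a} \<noteq> {v, b}" using ab by (auto simp: doubleton_eq_iff)
      have "(\<Sum>k\<in>?R. share k) = share k" unfolding Rk by simp
      also have "\<dots> \<le> (\<Sum>f\<in>{f \<in> bd k. v \<in> f \<and> tri f}. edge_value v f)"
        by (rule share_le[OF R(2,4)[OF k] big])
      also have "{f \<in> bd k. v \<in> f \<and> tri f} = {{v, a}, {v, b}}"
        using ab(6) abT by (auto simp: tri_at_def)
      also have "(\<Sum>f\<in>\<dots>. edge_value v f) = triangle_value v ja + triangle_value v jb"
        using ne edge_value_triangle[OF jT(1) ja(2)] edge_value_triangle[OF jT(2) jb(2)] by simp
      also have "\<dots> = (\<Sum>j\<in>triangles_at v. triangle_value v j)"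
        using \<open>ja \<noteq> jb\<close> by (simp flip: tv)
      finally show ?thesis .
    qed
    have "(\<Sum>i\<in>bad_at v. share i) = share g + share h + (\<Sum>k\<in>?R. share k)"
    proof -
      have "bad_at v = {g, h} \<union> ?R" using gh_at by auto
      then have "(\<Sum>i\<in>bad_at v. share i) = (\<Sum>i\<in>{g, h}. share i) + (\<Sum>k\<in>?R. share k)"
        by (subst sum.union_disjoint[symmetric]) auto
      then show ?thesis using h(3) by simp
    qed
    also have "\<dots> \<le> 1/3 + (\<Sum>j\<in>triangles_at v. triangle_value v j)"
      using sg sh rest by simp
    finally have "load v \<le> 1/3 + (\<Sum>j\<in>triangles_at v. triangle_value v j + across v j)"
      unfolding load_eq by (simp add: sum.distrib)
    then show ?thesis using sum2 by simp
  qed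
qed

section \<open>Balance between bad faces and big vertices\<close>

lemma load_le_excess:
  assumes "v \<in> W" "big v" "v \<noteq> w"
  shows "load v \<le> real (deg v) - 4"
proof (cases "deg v = 5")
  case True
  then show ?thesis using load_le_1[OF assms(1,3)] by simp
next
  case False
  then have d: "deg v \<ge> 6" using assms by (auto simp: big_def)
  have "load v \<le> 2/3 * real (card (triangles_at v))" by (rule load_le[OF assms(2)])
  moreover have "2 * real (card (triangles_at v)) \<le> real (deg v)"
    using card_triangles_at[of v] by linarith
  ultimately show ?thesis using d by linarith
qed

text \<open>The shares of a bad face with big vertices add up to its deficit. For a bad face
  \<open>i\<close> without them, each triangle edge \<open>e\<close> of \<open>i\<close> is sent to
  the tip \<open>c\<close> of its triangle \<open>j\<close>. The pair \<open>(c, j)\<close>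
  determines \<open>e\<close> as the edge of \<open>j\<close> opposite to \<open>c\<close>, and
  \<open>i\<close> as the other face at \<open>e\<close>, so no support is counted twice.\<close>

lemma bad_deficit:
  "(\<Sum>i\<in>{i. bad i}. (real (ntri i) - 3) / 3) \<le> (\<Sum>v\<in>{v \<in> W. big v}. load v)"
proof -
  let ?B = "{i. bad i}" and ?Z = "{i. bad i \<and> nbig i = 0}" and ?G = "{v \<in> W. big v}"
  have finG: "finite ?G" using finite_W by simp
  have bn: "i < n" "length (D i) = 5" "i \<notin> triangles" "ntri i \<ge> 4" "ntri i \<le> 5"
    if "bad i" for i
    using that badD[OF that] ntri_le[of i] by (auto simp: bad_def)
  have "(\<Sum>v\<in>?G. \<Sum>i\<in>bad_at v. share i) = (\<Sum>v\<in>?G. \<Sum>i\<in>?B. if v \<in> set (D i) then share i else 0)"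
  proof (rule sum.cong)
    fix v
    have "bad_at v = ?B \<inter> {i. v \<in> set (D i)}" by (auto simp: bad_at_def)
    then show "(\<Sum>i\<in>bad_at v. share i) = (\<Sum>i\<in>?B. if v \<in> set (D i) then share i else 0)"
      by (simp add: sum.If_cases)
  qed simp
  also have "\<dots> = (\<Sum>i\<in>?B. \<Sum>v\<in>?G. if v \<in> set (D i) then share i else 0)"
    by (rule sum.swap)
  also have "\<dots> = (\<Sum>i\<in>?B. real (nbig i) * share i)"
  proof (rule sum.cong)
    fix i assume "i \<in> ?B"
    then have "?G \<inter> {v. v \<in> set (D i)} = {v \<in> set (D i). big v}"
      using set_D_subset bn by auto
    then show "(\<Sum>v\<in>?G. if v \<in> set (D i) then share i else 0) = real (nbig i) * share i"
      using finG by (simp add: sum.If_cases nbig_def)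
  qed simp
  also have "\<dots> = (\<Sum>i\<in>?B. if nbig i = 0 then 0 else (real (ntri i) - 3) / 3)"
    by (rule sum.cong) (auto simp: share_def)
  finally have shares: "(\<Sum>v\<in>?G. \<Sum>i\<in>bad_at v. share i) =
    (\<Sum>i\<in>?B. if nbig i = 0 then 0 else (real (ntri i) - 3) / 3)" .
  let ?X = "SIGMA i:?Z. {e \<in> bd i. tri e}" and ?Y = "SIGMA v:?G. used_at v"
  have fin0: "finite ?Z" by (rule finite_subset[OF _ finite_bad(1)]) auto
  have "card ?X \<le> card ?Y"
  proof (rule card_le_if_inj_on_rel[where r = "\<lambda>x y. snd x \<in> bd (snd y) \<and> fst y \<notin> snd x"])
    show "finite ?Y" using finG by auto
    fix x assume x: "x \<in> ?X"
    then obtain i e where ie: "x = (i, e)" "bad i" "nbig i = 0" "e \<in> bd i" "tri e" by auto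
    obtain j where j: "j \<in> triangles" "e \<in> bd j" using ie(5) by (auto simp: tri_def)
    obtain a b c where t: "e = {a, b}" "distinct [a, b, c]" "set (D j) = {a, b, c}"
      by (rule triangle_edge[OF j])
    have c: "c \<in> set (D j)" "c \<notin> e" using t by auto
    then have "big c" using pentagon_house(2)[OF _ _ ie(4) j(2,1)] bn[OF ie(2)] ie(3) by blast
    moreover have "c \<in> W" using set_D_subset c(1) trianglesD[OF j(1)] by auto
    moreover have "j \<in> used_at c"
      using ie j c by (auto simp: used_at_def triangles_at_def used_def)
    ultimately have "(c, j) \<in> ?Y" by auto
    then show "\<exists>y. y \<in> ?Y \<and> snd x \<in> bd (snd y) \<and> fst y \<notin> snd x"
      using ie j c by (intro exI[of _ "(c, j)"]) auto
  next
    fix x1 x2 y assume x: "x1 \<in> ?X" "x2 \<in> ?X" "y \<in> ?Y"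
      and r: "snd x1 \<in> bd (snd y) \<and> fst y \<notin> snd x1"
        "snd x2 \<in> bd (snd y) \<and> fst y \<notin> snd x2"
    obtain i1 e1 where ie1: "x1 = (i1, e1)" "bad i1" "e1 \<in> bd i1" "tri e1" using x by auto
    obtain i2 e2 where ie2: "x2 = (i2, e2)" "bad i2" "e2 \<in> bd i2" "tri e2" using x by auto
    obtain v j where y: "y = (v, j)" "j \<in> triangles" "v \<in> set (D j)"
      using x by (auto simp: used_at_def triangles_at_def)
    have j: "j < n" "length (D j) = 3" using trianglesD y by auto
    have "card (bd j - {f \<in> bd j. v \<in> f}) = 1"
      using card_edges_at[OF j(1) y(3)] card_bd[OF j(1)] j(2) by (subst card_Diff_subset) auto
    then obtain f where f: "bd j - {f \<in> bd j. v \<in> f} = {f}" by (rule card_1_singletonE)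
    have "e1 \<in> bd j - {f \<in> bd j. v \<in> f}" "e2 \<in> bd j - {f \<in> bd j. v \<in> f}"
      using r ie1(1) ie2(1) y(1) by simp_all
    then have "e1 = e2" unfolding f by simp
    moreover have "i1 = i2"
      using tri_nontriangle_face_unique[OF ie1(4,3), of i2]
        ie2(3) \<open>e1 = e2\<close> bn(1,3)[OF ie1(2)] bn(1,3)[OF ie2(2)]
      by simp
    ultimately show "x1 = x2" using ie1(1) ie2(1) by simp
  qed
  moreover have "card ?X = (\<Sum>i\<in>?Z. ntri i)" using fin0 by (simp add: card_SigmaI ntri_def)
  moreover have "card ?Y = (\<Sum>v\<in>?G. card (used_at v))" using finG by (simp add: card_SigmaI)
  ultimately have "(\<Sum>i\<in>?Z. ntri i) \<le> (\<Sum>v\<in>?G. card (used_at v))" by simp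
  then have XY: "(\<Sum>i\<in>?Z. real (ntri i)) \<le> (\<Sum>v\<in>?G. real (card (used_at v)))"
    unfolding of_nat_sum[symmetric] by (simp only: of_nat_le_iff)
  have "(\<Sum>i\<in>?B. if nbig i = 0 then (real (ntri i) - 3) / 3 else 0) = (\<Sum>i\<in>?Z. (real (ntri i) - 3) / 3)"
    by (simp add: sum.If_cases Int_def)
  also have "\<dots> \<le> (\<Sum>i\<in>?Z. 2/15 * real (ntri i))"
  proof (rule sum_mono)
    fix i assume "i \<in> ?Z"
    then have "ntri i = 4 \<or> ntri i = 5" using bn(4,5)[of i] by auto
    then show "(real (ntri i) - 3) / 3 \<le> 2/15 * real (ntri i)" by auto
  qed
  also have "\<dots> \<le> 2/15 * (\<Sum>v\<in>?G. real (card (used_at v)))" 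
    unfolding sum_distrib_left[symmetric] using XY by simp
  finally have zero: "(\<Sum>i\<in>?B. if nbig i = 0 then (real (ntri i) - 3) / 3 else 0) \<le>
    2/15 * (\<Sum>v\<in>?G. real (card (used_at v)))" .
  have "(\<Sum>i\<in>?B. (real (ntri i) - 3) / 3) =
    (\<Sum>i\<in>?B. if nbig i = 0 then 0 else (real (ntri i) - 3) / 3) +
    (\<Sum>i\<in>?B. if nbig i = 0 then (real (ntri i) - 3) / 3 else 0)"
    unfolding sum.distrib[symmetric] by (rule sum.cong) auto
  also have "\<dots> \<le> (\<Sum>v\<in>?G. \<Sum>i\<in>bad_at v. share i) + 2/15 * (\<Sum>v\<in>?G. real (card (used_at v)))"
    using zero shares by simp
  also have "\<dots> = (\<Sum>v\<in>?G. load v)"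
    unfolding load_def by (simp add: sum.distrib sum_distrib_left)
  finally show ?thesis .
qed

text \<open>A triangle lacks 1, and exactly one non-triangular face lies across each of its three
  edges and gives \<open>1/3\<close>. It remains to bound
  \<open>length (D i) - 4 - ntri i / 3\<close> for the other faces.\<close>

lemma face_charge:
  "(\<Sum>i<n. real (length (D i)) - 4) \<ge> - (\<Sum>i\<in>{i. bad i}. (real (ntri i) - 3) / 3)"
proof -
  let ?N = "{..<n} - triangles" and ?T = "{e \<in> F. tri e}"
  have TN: "triangles \<subseteq> {..<n}" by (auto simp: triangles_def)
  have one: "card {i \<in> triangles. e \<in> bd i} = 1" "card {i \<in> ?N. e \<in> bd i} = 1"
    if te: "tri e" for e
  proof -
    obtain j k
      where jk: "j \<in> triangles" "k < n" "k \<notin> triangles"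
        "{i. i < n \<and> e \<in> bd i} = {j, k}"
      by (rule tri_faces[OF te])
    have mem: "i < n \<and> e \<in> bd i \<longleftrightarrow> i = j \<or> i = k" for i
      using jk(4) by (simp add: set_eq_iff)
    have "i \<in> triangles \<and> e \<in> bd i \<longleftrightarrow> i = j" for i
      using mem[of i] jk(1,3) TN by blast
    then have "{i \<in> triangles. e \<in> bd i} = {j}" by simp
    moreover have "i \<in> ?N \<and> e \<in> bd i \<longleftrightarrow> i = k" for i
      using mem[of i] jk(1-3) by blast
    then have "{i \<in> ?N. e \<in> bd i} = {k}" by simp
    ultimately show "card {i \<in> triangles. e \<in> bd i} = 1" "card {i \<in> ?N. e \<in> bd i} = 1"
      by simp_all
  qed
  have count: "(\<Sum>i\<in>I. card {e \<in> bd i. tri e}) = card ?T"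
    if I: "finite I" "I \<subseteq> {..<n}" "\<And>e. tri e \<Longrightarrow> card {i \<in> I. e \<in> bd i} = 1"
      for I
  proof -
    have "(\<Sum>i\<in>I. card {e \<in> bd i. tri e}) = (\<Sum>i\<in>I. \<Sum>e\<in>?T. if e \<in> bd i then 1 else 0)"
    proof (rule sum.cong)
      fix i assume "i \<in> I"
      then have "?T \<inter> {e. e \<in> bd i} = {e \<in> bd i. tri e}" using face[of i] I by auto
      then show "card {e \<in> bd i. tri e} = (\<Sum>e\<in>?T. if e \<in> bd i then 1 else 0)"
        using finite_F by (simp add: sum.If_cases)
    qed simp
    also have "\<dots> = (\<Sum>e\<in>?T. \<Sum>i\<in>I. if e \<in> bd i then 1 else 0)"
      by (rule sum.swap)
    also have "\<dots> = (\<Sum>e\<in>?T. card {i \<in> I. e \<in> bd i})"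
      using I(1) by (intro sum.cong) (auto simp: sum.If_cases Int_def)
    also have "\<dots> = card ?T" using I(3) by simp
    finally show ?thesis .
  qed
  have "(\<Sum>i\<in>triangles. card {e \<in> bd i. tri e}) = (\<Sum>i\<in>triangles. 3)"
  proof (rule sum.cong)
    fix i assume i: "i \<in> triangles"
    then have "{e \<in> bd i. tri e} = bd i" by (auto simp: tri_def)
    then show "card {e \<in> bd i. tri e} = 3" using card_bd trianglesD[OF i] by simp
  qed simp
  then have c1: "card ?T = 3 * card triangles" using count[OF _ TN one(1)] by simp
  have c2: "(\<Sum>i\<in>?N. ntri i) = card ?T" unfolding ntri_def by (rule count) (use one in auto)
  have "(\<Sum>i<n. real (length (D i)) - 4) =
      (\<Sum>i\<in>?N. real (length (D i)) - 4) + (\<Sum>i\<in>triangles. real (length (D i)) - 4)"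
    by (rule sum.subset_diff[OF TN]) simp
  also have "(\<Sum>i\<in>triangles. real (length (D i)) - 4) = (\<Sum>i\<in>triangles. - 1)"
    by (rule sum.cong) (auto simp: triangles_def)
  also have "\<dots> = - (\<Sum>i\<in>?N. real (ntri i) / 3)"
  proof -
    have "(\<Sum>i\<in>?N. real (ntri i)) = real (3 * card triangles)"
      using c1 c2 by (simp flip: of_nat_sum)
    then show ?thesis by (simp flip: sum_divide_distrib)
  qed
  finally have tot: "(\<Sum>i<n. real (length (D i)) - 4) = (\<Sum>i\<in>?N. real (length (D i)) - 4 - real (ntri i) / 3)"
    by (simp add: sum_subtractf)
  have "- (\<Sum>i\<in>{i. bad i}. (real (ntri i) - 3) / 3) = (\<Sum>i\<in>?N. if bad i then - ((real (ntri i) - 3) / 3) else 0)"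
  proof -
    have "?N \<inter> {i. bad i} = {i. bad i}" using badD by auto
    then show ?thesis by (simp add: sum.If_cases sum_negf)
  qed
  also have "\<dots> \<le> (\<Sum>i\<in>?N. real (length (D i)) - 4 - real (ntri i) / 3)"
  proof (rule sum_mono)
    fix i assume i: "i \<in> ?N"
    then have "i < n" "i \<notin> triangles" by blast+
    then have iN: "i < n" "length (D i) \<noteq> 3" by (simp_all add: triangles_def)
    have le: "ntri i \<le> length (D i)" by (rule ntri_le[OF iN(1)])
    have ge: "length (D i) \<ge> 3" using face[OF iN(1)] by blast
    have "length (D i) = 4 \<or> length (D i) = 5 \<or> length (D i) \<ge> 6"
      using iN(2) ge by presburger
    then consider "length (D i) = 4" | "length (D i) = 5" | "length (D i) \<ge> 6" by blast
    then show "(if bad i then - ((real (ntri i) - 3) / 3) else 0) \<le> real (length (D i)) - 4 - real (ntri i) / 3"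
    proof cases
      case 1
      then have "{e \<in> bd i. tri e} = {}" using no_tri_on_4_face[OF iN(1) 1] by auto
      then have "ntri i = 0" unfolding ntri_def by simp
      then show ?thesis using 1 by (simp add: bad_def)
    next
      case 2
      then show ?thesis using iN(1) by (auto simp: bad_def field_simps)
    next
      \<comment> \<open>Even if all edges lie on triangles, two thirds of the length remain, and
        these are at least 4.\<close>
      case 3
      then show ?thesis using le by (auto simp: bad_def)
    qed
  qed
  finally show ?thesis using tot by simp
qed

lemma inconsistent: False
proof -
  let ?G = "{v \<in> W. big v}"
  have "(\<Sum>v\<in>?G. load v) - 4 \<le> (\<Sum>v\<in>W. real (deg v) - 4)"
  proof -
    have wG: "w \<in> ?G" using w by (simp add: big_def)
    have finG: "finite ?G" using finite_W by simp
    have "load w \<le> 2/3 * real (card (triangles_at w))" by (rule load_le) (simp add: big_def)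
    moreover have "2 * real (card (triangles_at w)) \<le> real (deg w)"
      using card_triangles_at[of w] by linarith
    ultimately have "load w - 4 \<le> real (deg w) - 4" by linarith
    moreover have "(\<Sum>v\<in>?G - {w}. load v) \<le> (\<Sum>v\<in>?G - {w}. real (deg v) - 4)"
      by (rule sum_mono, rule load_le_excess) auto
    ultimately have "(\<Sum>v\<in>?G. load v) - 4 \<le> (\<Sum>v\<in>?G. real (deg v) - 4)"
      using wG finG by (simp add: sum.remove[of ?G w])
    also have "\<dots> \<le> (\<Sum>v\<in>W. real (deg v) - 4)"
    \<comment> \<open>Vertices that are not big have degree exactly 4 and charge 0.\<close>
    proof (rule sum_mono2[OF finite_W])
      fix v assume "v \<in> W - ?G"
      then show "0 \<le> real (deg v) - 4" using not_big by auto
    qed auto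
    finally show ?thesis .
  qed
  then show False using total_charge face_charge bad_deficit by linarith
qed

end

subsection \<open>Coloring\<close>

text \<open>\<open>conf u i v j\<close> says that the matching on \<open>uv\<close> joins color
  \<open>i\<close> of \<open>u\<close> to color \<open>j\<close> of \<open>v\<close>. Colors of
  different vertices are compared only through \<open>conf\<close>, so nothing relies on a conflict
  being an equality of colors.\<close>

locale dp_drawn_graph = drawn_graph +
  fixes L :: "'a \<Rightarrow> nat set" and conf :: "'a \<Rightarrow> nat \<Rightarrow> 'a \<Rightarrow> nat \<Rightarrow> bool"
  assumes L: "v \<in> V \<Longrightarrow> finite (L v) \<and> 4 \<le> card (L v)"
    and conf_sym: "conf u i v j \<Longrightarrow> conf v j u i"
    and conf_unique: "{u, v} \<in> E \<Longrightarrow> conf u i v j \<Longrightarrow> conf u i v j' \<Longrightarrow> j = j'"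
    and no_triangle_on_4_cycle: "distinct [a, b, c, d] \<Longrightarrow>
      {{a, b}, {b, c}, {c, d}, {d, a}, {a, x}, {b, x}} \<subseteq> E \<Longrightarrow> False"
begin

definition proper :: "'a set \<Rightarrow> ('a \<Rightarrow> nat) \<Rightarrow> bool" where
  "proper U \<phi> \<longleftrightarrow> (\<forall>v\<in>U. \<phi> v \<in> L v) \<and>
     (\<forall>u\<in>U. \<forall>v\<in>U. {u, v} \<in> E \<longrightarrow> \<not> conf u (\<phi> u) v (\<phi> v))"

definition avail :: "'a set \<Rightarrow> ('a \<Rightarrow> nat) \<Rightarrow> 'a \<Rightarrow> nat set" where
  "avail U \<phi> v = {c \<in> L v. \<forall>u\<in>U. {u, v} \<in> E \<longrightarrow> \<not> conf u (\<phi> u) v c}"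

definition nbrs :: "'a set \<Rightarrow> 'a \<Rightarrow> 'a set" where
  "nbrs U v = {u \<in> U. {u, v} \<in> E}"

lemma no_loop: "{v, v} \<notin> E"
  using edge[of "{v, v}"] by auto

lemma finite_avail: "v \<in> V \<Longrightarrow> finite (avail U \<phi> v)"
  using L by (auto simp: avail_def)

text \<open>A colored neighbour forbids at most one color, since its color has at most one partner
  in the matching.\<close>

lemma card_avail:
  assumes v: "v \<in> V" and U: "finite U"
  shows "4 \<le> card (avail U \<phi> v) + card (nbrs U v)"
proof -
  let ?K = "\<lambda>u. {c. conf u (\<phi> u) v c}"
  have K: "finite (?K u) \<and> card (?K u) \<le> 1" if "u \<in> nbrs U v" for u
  proof -
    have "c = d" if "c \<in> ?K u" "d \<in> ?K u" for c d
      using that conf_unique \<open>u \<in> nbrs U v\<close> by (auto simp: nbrs_def)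
    then have "?K u = {} \<or> (\<exists>c. ?K u = {c})" by blast
    then show ?thesis by auto
  qed
  have fn: "finite (nbrs U v)" using U by (simp add: nbrs_def)
  have "L v \<subseteq> avail U \<phi> v \<union> (\<Union>u\<in>nbrs U v. ?K u)"
    by (auto simp: avail_def nbrs_def)
  then have "card (L v) \<le> card (avail U \<phi> v \<union> (\<Union>u\<in>nbrs U v. ?K u))"
    by (rule card_mono[rotated]) (use finite_avail[OF v] K fn in auto)
  also have "\<dots> \<le> card (avail U \<phi> v) + card (\<Union>u\<in>nbrs U v. ?K u)"
    by (rule card_Un_le)
  also have "card (\<Union>u\<in>nbrs U v. ?K u) \<le> (\<Sum>u\<in>nbrs U v. card (?K u))"
    by (rule card_UN_le[OF fn])
  also have "\<dots> \<le> (\<Sum>u\<in>nbrs U v. 1)" by (rule sum_mono) (use K in auto)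
  finally have "card (L v) \<le> card (avail U \<phi> v) + card (nbrs U v)" by simp
  then show ?thesis using L[OF v] by linarith
qed

lemma proper_extend:
  assumes "proper U \<phi>" "v \<notin> U" "c \<in> avail U \<phi> v"
  shows "proper (insert v U) (\<phi>(v := c))"
proof -
  have c: "c \<in> L v"
    "\<And>u. u \<in> U \<Longrightarrow> {u, v} \<in> E \<Longrightarrow> \<not> conf u (\<phi> u) v c"
    using assms(3) by (auto simp: avail_def)
  have c': "\<not> conf v c u (\<phi> u)" if "u \<in> U" "{v, u} \<in> E" for u
    using c(2)[OF that(1)] that(2) conf_sym by (auto simp: insert_commute)
  show ?thesis
    using assms(1,2) c c' no_loop[of v] unfolding proper_def by auto
qed

text \<open>Links the degrees of the discharging, which count edges, to those of the coloring, which
  count neighbours.\<close>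

lemma nbrs_induced:
  assumes "v \<in> W"
  shows "card {e \<in> induced_edges E W. v \<in> e} = card (nbrs W v)"
proof -
  have "{e \<in> induced_edges E W. v \<in> e} = (\<lambda>u. {u, v}) ` nbrs W v"
  proof
    show "{e \<in> induced_edges E W. v \<in> e} \<subseteq> (\<lambda>u. {u, v}) ` nbrs W v"
    proof
      fix e assume e: "e \<in> {e \<in> induced_edges E W. v \<in> e}"
      then have "card e = 2" using edge by (auto simp: induced_edges_def)
      then obtain x y where xy: "e = {x, y}" by (auto simp: card_2_iff)
      then have "v = x \<or> v = y" using e by auto
      then obtain u where u: "e = {u, v}" using xy by (metis insert_commute)
      moreover have "e \<in> E" "e \<subseteq> W" using e by (simp_all add: induced_edges_def)
      ultimately have "u \<in> nbrs W v" by (simp add: nbrs_def)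
      then show "e \<in> (\<lambda>u. {u, v}) ` nbrs W v" using u by blast
    qed
    show "(\<lambda>u. {u, v}) ` nbrs W v \<subseteq> {e \<in> induced_edges E W. v \<in> e}"
      using assms by (auto simp: nbrs_def induced_edges_def)
  qed
  moreover have "inj_on (\<lambda>u. {u, v}) (nbrs W v)" by (auto simp: inj_on_def doubleton_eq_iff)
  ultimately show ?thesis by (simp add: card_image)
qed

lemma extend_vertex:
  assumes W: "W \<subseteq> V" and \<phi>: "proper U \<phi>" and U: "U \<subseteq> W" and v: "v \<in> W - U" and few: "card (nbrs U v) \<le> 3"
  obtains c where "proper (insert v U) (\<phi>(v := c))"
proof -
  have "finite U" using U W finite_V by (meson finite_subset)
  then have "card (avail U \<phi> v) > 0" using card_avail[of v U \<phi>] v W few by auto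
  then obtain c where "c \<in> avail U \<phi> v" by fastforce
  then show thesis using proper_extend[OF \<phi>] v that by auto
qed

lemma card_nbrs_diff:
  assumes "finite W" "U \<subseteq> W" "S \<subseteq> nbrs W v" "S \<inter> U = {}"
  shows "card (nbrs U v) + card S \<le> card (nbrs W v)"
proof -
  have fin: "finite (nbrs W v)" using assms(1) by (simp add: nbrs_def)
  have "nbrs U v \<union> S \<subseteq> nbrs W v" using assms by (auto simp: nbrs_def)
  then have "card (nbrs U v \<union> S) \<le> card (nbrs W v)" by (rule card_mono[OF fin])
  moreover have "card (nbrs U v \<union> S) = card (nbrs U v) + card S"
  proof (rule card_Un_disjoint)
    show "finite (nbrs U v)" "finite S"
      using finite_subset[OF assms(2,1)] finite_subset[OF assms(3) fin] by (simp_all add: nbrs_def)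
    show "nbrs U v \<inter> S = {}" using assms(4) by (auto simp: nbrs_def)
  qed
  ultimately show ?thesis by simp
qed

text \<open>
  The lists left over have at least 3 colors at \<open>a\<close> and \<open>b\<close> and 2 at the other vertices. So \<open>a\<close> can get
  a color that spares two colors of \<open>x\<close>, after which \<open>f\<close>, \<open>d\<close>, \<open>c\<close>, \<open>b\<close>, \<open>x\<close> are colored greedily.
\<close>

lemma house_reducible:
  assumes W: "W \<subseteq> V" and dist: "distinct [a, b, c, d, f, x]" and S: "{a, b, c, d, f, x} \<subseteq> W"
    and house: "{{a, b}, {b, c}, {c, d}, {d, f}, {f, a}, {a, x}, {b, x}} \<subseteq> E"
    and deg: "\<And>v. v \<in> {a, b, c, d, f, x} \<Longrightarrow> card (nbrs W v) = 4"
    and \<phi>: "proper (W - {a, b, c, d, f, x}) \<phi>"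
  obtains \<psi>
    where "proper W \<psi>"
      "\<And>v. v \<in> W - {a, b, c, d, f, x} \<Longrightarrow> \<psi> v = \<phi> v"
proof -
  let ?U = "W - {a, b, c, d, f, x}"
  have finW: "finite W" using W finite_V finite_subset by blast
  have E1: "{a, b} \<in> E" "{b, c} \<in> E" "{c, d} \<in> E" "{d, f} \<in> E" "{f, a} \<in> E"
    "{a, x} \<in> E" "{b, x} \<in> E"
    using house by simp_all
  have E2: "{b, a} \<in> E" "{c, b} \<in> E" "{d, c} \<in> E" "{f, d} \<in> E" "{a, f} \<in> E"
    "{x, a} \<in> E" "{x, b} \<in> E"
    using E1 by (simp_all add: insert_commute)
  \<comment> \<open>Within the house, \<open>x\<close> is adjacent to \<open>a\<close> and
    \<open>b\<close> only, so the colors of \<open>c\<close>, \<open>d\<close>, \<open>f\<close> do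
    not restrict it. An edge from \<open>x\<close> to one of these would create a 4-cycle through
    \<open>x\<close> sharing an edge with a triangle.\<close>
  have xc: "{c, x} \<notin> E"
  proof
    assume "{c, x} \<in> E"
    then show False using no_triangle_on_4_cycle[of a b c x x] E1 E2 dist by auto
  qed
  have xf: "{f, x} \<notin> E"
  proof
    assume "{f, x} \<in> E"
    then show False using no_triangle_on_4_cycle[of b a f x x] E1 E2 dist by auto
  qed
  have xd: "{d, x} \<notin> E"
  proof
    assume "{d, x} \<in> E"
    then show False using no_triangle_on_4_cycle[of x b c d a] E1 E2 dist by auto
  qed
  have cnt: "card (nbrs U v) + card T \<le> 4"
    if "v \<in> {a, b, c, d, f, x}" "U \<subseteq> W" "T \<subseteq> nbrs W v" "T \<inter> U = {}"
      for U v T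
    using card_nbrs_diff[OF finW that(2-4)] deg[OF that(1)] by simp
  have "card (nbrs ?U a) + card {b, f, x} \<le> 4"
    by (rule cnt) (use S E1 E2 in \<open>auto simp: nbrs_def\<close>)
  then have "card (nbrs ?U a) \<le> 1" using dist by simp
  then have Aa: "card (avail ?U \<phi> a) \<ge> 3" using card_avail[of a ?U \<phi>] S W finW by auto
  have "card (nbrs ?U x) + card {a, b} \<le> 4"
    by (rule cnt) (use S E1 E2 in \<open>auto simp: nbrs_def\<close>)
  then have "card (nbrs ?U x) \<le> 2" using dist by simp
  then have "card (avail ?U \<phi> x) \<ge> 2" using card_avail[of x ?U \<phi>] S W finW by auto
  then obtain B where B: "B \<subseteq> avail ?U \<phi> x" "card B = 2"
    by (meson obtain_subset_with_card_n)
  then obtain \<beta>1 \<beta>2 where \<beta>: "B = {\<beta>1, \<beta>2}" "\<beta>1 \<noteq> \<beta>2"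
    by (auto simp: card_2_iff)
  let ?K = "\<lambda>\<beta>. {\<alpha>. conf x \<beta> a \<alpha>}"
  have K: "finite (?K \<beta>) \<and> card (?K \<beta>) \<le> 1" for \<beta>
  proof -
    have "?K \<beta> = {} \<or> (\<exists>\<alpha>. ?K \<beta> = {\<alpha>})"
      using conf_unique[OF E2(6)] by blast
    then show ?thesis by auto
  qed
  have "\<not> avail ?U \<phi> a \<subseteq> ?K \<beta>1 \<union> ?K \<beta>2"
  proof
    assume "avail ?U \<phi> a \<subseteq> ?K \<beta>1 \<union> ?K \<beta>2"
    then have "card (avail ?U \<phi> a) \<le> card (?K \<beta>1 \<union> ?K \<beta>2)"
      by (rule card_mono[rotated]) (use K in auto)
    also have "\<dots> \<le> card (?K \<beta>1) + card (?K \<beta>2)" by (rule card_Un_le)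
    also have "\<dots> \<le> 2" using K[of \<beta>1] K[of \<beta>2] by linarith
    finally show False using Aa by simp
  qed
  then obtain \<alpha> where \<alpha>: "\<alpha> \<in> avail ?U \<phi> a" "\<not> conf x \<beta>1 a \<alpha>" "\<not> conf x \<beta>2 a \<alpha>"
    by blast
  let ?U1 = "insert a ?U"
  have p1: "proper ?U1 (\<phi>(a := \<alpha>))"
    by (rule proper_extend[OF \<phi> _ \<alpha>(1)]) simp
  have sub: "?U1 \<subseteq> W" "insert f ?U1 \<subseteq> W"
    "insert d (insert f ?U1) \<subseteq> W" "insert c (insert d (insert f ?U1)) \<subseteq> W"
    using S by auto
  \<comment> \<open>In the order \<open>f\<close>, \<open>d\<close>, \<open>c\<close>,
    \<open>b\<close> each vertex still has an uncolored neighbour, namely the next one or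
    \<open>x\<close>; so at most three neighbours are colored.\<close>
  have "card (nbrs ?U1 f) + card {d} \<le> 4"
    by (rule cnt) (use S E1 E2 dist in \<open>auto simp: nbrs_def\<close>)
  then obtain cf where p2: "proper (insert f ?U1) (\<phi>(a := \<alpha>, f := cf))"
    using extend_vertex[OF W p1 sub(1), of f] S dist by auto
  have "card (nbrs (insert f ?U1) d) + card {c} \<le> 4"
    by (rule cnt) (use S E1 E2 dist in \<open>auto simp: nbrs_def\<close>)
  then obtain cd
    where p3: "proper (insert d (insert f ?U1)) (\<phi>(a := \<alpha>, f := cf, d := cd))"
    using extend_vertex[OF W p2 sub(2), of d] S dist by auto
  have "card (nbrs (insert d (insert f ?U1)) c) + card {b} \<le> 4"
    by (rule cnt) (use S E1 E2 dist in \<open>auto simp: nbrs_def\<close>)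
  then obtain cc
    where p4: "proper (insert c (insert d (insert f ?U1))) (\<phi>(a := \<alpha>, f := cf, d := cd, c := cc))"
    using extend_vertex[OF W p3 sub(3), of c] S dist by auto
  have "card (nbrs (insert c (insert d (insert f ?U1))) b) + card {x} \<le> 4"
    by (rule cnt) (use S E1 E2 dist in \<open>auto simp: nbrs_def\<close>)
  then obtain cb
    where p5: "proper (insert b (insert c (insert d (insert f ?U1)))) (\<phi>(a := \<alpha>, f := cf, d := cd, c := cc, b := cb))"
    using extend_vertex[OF W p4 sub(4), of b] S dist by auto
  let ?\<phi>5 = "\<phi>(a := \<alpha>, f := cf, d := cd, c := cc, b := cb)"
  \<comment> \<open>The color of \<open>b\<close> excludes at most one of the two colors reserved
    for \<open>x\<close>, and \<open>\<alpha>\<close> was chosen to exclude neither.\<close>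
  obtain \<beta> where \<beta>': "\<beta> \<in> B" "\<not> conf b cb x \<beta>"
    using \<beta> conf_unique[OF E1(7), of cb \<beta>1 \<beta>2] by blast
  have "\<not> conf x \<beta> a \<alpha>" using \<alpha>(2,3) \<beta>(1) \<beta>'(1) by auto
  then have \<beta>a: "\<not> conf a \<alpha> x \<beta>"
    using conf_sym[of a \<alpha> x \<beta>] by blast
  have \<beta>U: "\<beta> \<in> L x"
    "\<And>u. u \<in> ?U \<Longrightarrow> {u, x} \<in> E \<Longrightarrow> \<not> conf u (\<phi> u) x \<beta>"
    using \<beta>'(1) B(1) by (auto simp: avail_def)
  have "\<not> conf u (?\<phi>5 u) x \<beta>"
    if u: "u \<in> insert b (insert c (insert d (insert f ?U1)))" "{u, x} \<in> E" for u
  proof -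
    consider "u = a" | "u = b" | "u \<in> ?U" using u xc xd xf by blast
    then show ?thesis
    proof cases
      case 3
      then have "?\<phi>5 u = \<phi> u" by auto
      then show ?thesis using \<beta>U(2)[OF 3 u(2)] by simp
    qed (use \<beta>a \<beta>'(2) dist in auto)
  qed
  then have "\<beta> \<in> avail (insert b (insert c (insert d (insert f ?U1)))) ?\<phi>5 x"
    using \<beta>U(1) by (simp only: avail_def mem_Collect_eq) blast
  moreover have "x \<notin> insert b (insert c (insert d (insert f ?U1)))" using dist by auto
  ultimately have p6: "proper (insert x (insert b (insert c (insert d (insert f ?U1))))) (?\<phi>5(x := \<beta>))"
    using proper_extend[OF p5] by blast
  have Weq: "insert x (insert b (insert c (insert d (insert f ?U1)))) = W" using S by auto
  have "proper W (?\<phi>5(x := \<beta>))" using p6 unfolding Weq .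
  then show thesis by (rule that) auto
qed

text \<open>
  Prescribing the color of the root \<open>w\<close> is what allows to glue colorings at a cut vertex.
\<close>

lemma proper_coloring_rooted:
  assumes "W \<subseteq> V" "w \<in> W" "c0 \<in> L w"
  shows "\<exists>\<phi>. proper W \<phi> \<and> \<phi> w = c0"
  using assms
proof (induction "card W" arbitrary: W w c0 rule: less_induct)
  case less
  note W = less.prems(1) and w = less.prems(2) and c0 = less.prems(3)
  have finW: "finite W" using W finite_V finite_subset by blast
  have IH: "\<exists>\<phi>. proper W' \<phi> \<and> \<phi> w' = c'"
    if W': "W' \<subseteq> W" "W' \<noteq> W" "w' \<in> W'" "c' \<in> L w'" for W' w' c'
  proof -
    have "card W' < card W" using W' finW by (intro psubset_card_mono) auto
    then show ?thesis using less.hyps[of W' w' c'] W' W by auto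
  qed
  have split: ?case
    if W12: "W1 \<union> W2 = W" "W1 \<inter> W2 \<subseteq> {x}" "W1 \<noteq> W" "W2 \<noteq> W"
      "w \<in> W1"
    and edges: "\<And>e. e \<in> induced_edges E W \<Longrightarrow> e \<subseteq> W1 \<or> e \<subseteq> W2"
      for W1 W2 x
  proof -
    obtain \<phi>1 where \<phi>1: "proper W1 \<phi>1" "\<phi>1 w = c0"
      using IH[of W1 w c0] W12 c0 by auto
    \<comment> \<open>The second part gets its own root: the common vertex with the color it already
      has, or any vertex with any color if the parts are disjoint.\<close>
    obtain y cy
      where y: "y \<in> W2" "cy \<in> L y" "W1 \<inter> W2 \<subseteq> {y}"
        "y \<in> W1 \<Longrightarrow> cy = \<phi>1 y"
    proof (cases "W1 \<inter> W2 = {}")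
      case True
      obtain y where y: "y \<in> W2" using W12 by auto
      then have "card (L y) > 0" using L[of y] W W12 by auto
      then obtain cy where "cy \<in> L y" by fastforce
      then show thesis using that[of y cy] y True by auto
    next
      case False
      then have "W1 \<inter> W2 = {x}" using W12(2) by auto
      then show thesis using that[of x "\<phi>1 x"] \<phi>1 by (auto simp: proper_def)
    qed
    obtain \<phi>2 where \<phi>2: "proper W2 \<phi>2" "\<phi>2 y = cy"
      using IH[of W2 y cy] y W12 by auto
    define \<phi> where "\<phi> v = (if v \<in> W1 then \<phi>1 v else \<phi>2 v)" for v
    have on1: "\<phi> v = \<phi>1 v" if "v \<in> W1" for v using that by (simp add: \<phi>_def)
    have on2: "\<phi> v = \<phi>2 v" if "v \<in> W2" for v
      using that y \<phi>2 by (cases "v \<in> W1") (auto simp: \<phi>_def)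
    have "proper W \<phi>"
      unfolding proper_def
    proof (intro conjI ballI impI)
      fix v assume "v \<in> W"
      then show "\<phi> v \<in> L v"
        using W12(1) on1[of v] on2[of v] \<phi>1(1) \<phi>2(1) by (auto simp: proper_def)
    next
      fix u v assume uv: "u \<in> W" "v \<in> W" "{u, v} \<in> E"
      then have "{u, v} \<subseteq> W1 \<or> {u, v} \<subseteq> W2"
        using edges[of "{u, v}"] by (auto simp: induced_edges_def)
      then show "\<not> conf u (\<phi> u) v (\<phi> v)"
        using on1[of u] on1[of v] on2[of u] on2[of v] \<phi>1(1) \<phi>2(1) uv(3)
        by (auto simp: proper_def)
    qed
    then show ?thesis using on1[OF W12(5)] \<phi>1(2) by auto
  qed
  \<comment> \<open>Only vertices other than the root may be removed and colored last, which is why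
    the degree of the root stays unbounded from below.\<close>
  consider "W = {w}" | v where "v \<in> W" "v \<noteq> w" "\<not> card (nbrs W v) \<ge> 4"
    | "\<not> nonseparable E W" | "W \<noteq> {w}" "nonseparable E W"
      "\<And>v. v \<in> W \<Longrightarrow> v \<noteq> w \<Longrightarrow> card (nbrs W v) \<ge> 4"
    by blast
  then show ?case
  proof cases
    case 1
    then show ?thesis using c0 no_loop by (intro exI[of _ "\<lambda>_. c0"]) (auto simp: proper_def)
  next
    case (2 v)
    obtain \<phi> where \<phi>: "proper (W - {v}) \<phi>" "\<phi> w = c0"
      using IH[of "W - {v}" w c0] 2 w c0 by auto
    have "card (nbrs (W - {v}) v) \<le> card (nbrs W v)"
      by (rule card_mono) (use finW in \<open>auto simp: nbrs_def\<close>)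
    then obtain c where "proper (insert v (W - {v})) (\<phi>(v := c))"
      using extend_vertex[OF W \<phi>(1), of v] 2 by auto
    moreover have "insert v (W - {v}) = W" using 2 by auto
    ultimately show ?thesis using \<phi>(2) 2(2) by (intro exI[of _ "\<phi>(v := c)"]) auto
  next
    case 3
    then obtain W1 W2 x
      where s': "W1 \<union> W2 = W \<and> W1 \<inter> W2 \<subseteq> {x} \<and> W1 \<noteq> W \<and> W2 \<noteq> W"
      "\<not> (\<exists>e\<in>induced_edges E W. \<not> e \<subseteq> W1 \<and> \<not> e \<subseteq> W2)"
      unfolding nonseparable_def not_all not_imp by (elim exE conjE) (rule that, intro conjI)
    note s = s'(1)[THEN conjunct1] s'(1)[THEN conjunct2, THEN conjunct1]
      s'(1)[THEN conjunct2, THEN conjunct2, THEN conjunct1]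
        s'(1)[THEN conjunct2, THEN conjunct2, THEN conjunct2]
    have edges: "e \<subseteq> W1 \<or> e \<subseteq> W2" "e \<subseteq> W2 \<or> e \<subseteq> W1"
      if "e \<in> induced_edges E W" for e
      using s'(2) that by auto
    have "w \<in> W1 \<or> w \<in> W2" using s(1) w by auto
    then show ?thesis
    proof
      assume "w \<in> W1"
      show ?thesis by (rule split[OF s \<open>w \<in> W1\<close> edges(1)])
    next
      assume "w \<in> W2"
      have s2: "W2 \<union> W1 = W" "W2 \<inter> W1 \<subseteq> {x}" using s by auto
      show ?thesis by (rule split[OF s2 s(4,3) \<open>w \<in> W2\<close> edges(2)])
    qed
  next
    case 4
    obtain v where v: "v \<in> W" "v \<noteq> w" using 4(1) w by auto
    have "card (nbrs W v) \<le> card W" by (rule card_mono[OF finW]) (auto simp: nbrs_def)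
    then have "card W \<ge> 3" using 4(3)[OF v] by simp
    then obtain n D
      where nD: "cycle_cover (induced_edges E W) n D" "\<Union>(induced_edges E W) = W"
      using nonseparable_cycle_cover[OF 4(2) W] by blast
    let ?F = "induced_edges E W"
    have FE: "?F \<subseteq> E" by (auto simp: induced_edges_def)
    define house where "house a b c d f x \<longleftrightarrow> distinct [a, b, c, d, f, x] \<and>
        {{a, b}, {b, c}, {c, d}, {d, f}, {f, a}, {a, x}, {b, x}} \<subseteq> ?F \<and>
        (\<forall>v\<in>{a, b, c, d, f, x}. v \<noteq> w \<and> card {e \<in> ?F. v \<in> e} = 4)" for a b c d f x
    show ?thesis
    proof (cases "\<exists>a b c d f x. house a b c d f x")
      case True
      then obtain a b c d f x where "house a b c d f x" by blast
      note h = this[unfolded house_def, THEN conjunct1]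
        this[unfolded house_def, THEN conjunct2, THEN conjunct1]
        this[unfolded house_def, THEN conjunct2, THEN conjunct2]
      let ?S = "{a, b, c, d, f, x}"
      have S: "?S \<subseteq> W" using h(2) by (auto simp: induced_edges_def)
      have deg: "card (nbrs W v) = 4" if "v \<in> ?S" for v
        using nbrs_induced[of v W] S h(3) that by auto
      have wS: "w \<in> W - ?S" using h(3) w by auto
      have "W - ?S \<noteq> W" using S by auto
      then obtain \<phi> where \<phi>: "proper (W - ?S) \<phi>" "\<phi> w = c0"
        using IH[OF _ _ wS c0] by blast
      obtain \<psi>
        where "proper W \<psi>" "\<And>v. v \<in> W - ?S \<Longrightarrow> \<psi> v = \<phi> v"
        by (rule house_reducible[OF W h(1) S _ deg \<phi>(1)]) (use h(2) FE in auto)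
      then show ?thesis using wS \<phi>(2) by auto
    next
      case False
      have "cycle_covered_graph W ?F n D w"
      proof
        show "card e = 2" if "e \<in> ?F" for e using edge that FE by auto
        show "4 \<le> card {e \<in> ?F. v \<in> e}" if "v \<in> W" "v \<noteq> w" for v
          using 4(3)[OF that] nbrs_induced[OF that(1)] by simp
        show False
          if "distinct [a, b, c, d]" "{{a, b}, {b, c}, {c, d}, {d, a}, {a, x}, {b, x}} \<subseteq> ?F"
            for a b c d x
          using no_triangle_on_4_cycle[OF that(1)] that(2) FE by blast
        show "\<exists>v\<in>{a, b, c, d, f, x}. v = w \<or> card {e \<in> ?F. v \<in> e} \<noteq> 4"
          if "distinct [a, b, c, d, f, x]"
            "{{a, b}, {b, c}, {c, d}, {d, f}, {f, a}, {a, x}, {b, x}} \<subseteq> ?F"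
          for a b c d f x
        proof (rule ccontr)
          assume "\<not> ?thesis"
          then have "house a b c d f x" unfolding house_def using that by blast
          then show False using False by blast
        qed
      qed (fact nD finW w)+
      then have False by (rule cycle_covered_graph.inconsistent)
      then show ?thesis ..
    qed
  qed
qed

end

section \<open>From planar graphs and their covers to the abstract setting\<close>

lemma uedges_iff:
  assumes "pair_graph G"
  shows "{u, v} \<in> uedges (parcs G) \<longleftrightarrow> (u, v) \<in> parcs G"
proof -
  interpret pair_graph G by fact
  have "(v, u) \<in> parcs G" if "(u, v) \<in> parcs G" for u v
    using pair_sym_arcs that by (auto simp: symmetric_def sym_def)
  then show ?thesis by (auto simp: uedges_def doubleton_eq_iff)
qed

lemma k_cycle_4:
  assumes "pair_graph G" "distinct [a, b, c, d]" "(a, b) \<in> parcs G" "(b, c) \<in> parcs G"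
    "(c, d) \<in> parcs G" "(d, a) \<in> parcs G"
  shows "k_cycle G 4 [(a, b), (b, c), (c, d), (d, a)]"
proof -
  interpret pair_graph G by fact
  have "a \<in> pverts G" using in_arcsD1[of a b] assms by auto
  then show ?thesis using assms
    by (auto simp: k_cycle_def cycle_def awalk_def)
qed

lemma k_cycle_3:
  assumes "pair_graph G" "distinct [a, b, c]" "(a, b) \<in> parcs G" "(b, c) \<in> parcs G"
    "(c, a) \<in> parcs G"
  shows "k_cycle G 3 [(a, b), (b, c), (c, a)]"
proof -
  interpret pair_graph G by fact
  have "a \<in> pverts G" using in_arcsD1[of a b] assms by auto
  then show ?thesis using assms
    by (auto simp: k_cycle_def cycle_def awalk_def)
qed

theorem theorem2:
  fixes G :: "'a pair_pre_digraph"
  assumes "pair_graph G"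
    and "planar G"
    and "\<not> (\<exists>c d. k_cycle G 4 c \<and> k_cycle G 3 d \<and> adjacent_cycles c d)"
  shows "chi_DP G \<le> 4"
  unfolding chi_DP_le_iff[OF assms(1)] always_dp_colorable_def
proof (intro allI impI, elim conjE)
  fix L :: "'a list_assignment" and M :: "'a matching_assignment"
  assume L: "\<forall>v \<in> pverts G. finite (L v) \<and> 4 \<le> card (L v)" and M: "matching_assignment G L M"
  interpret pair_graph G by fact
  let ?E = "uedges (parcs G)"
  note E_iff = uedges_iff[OF assms(1)]
  obtain p \<gamma> where draw: "plane_drawing G p \<gamma>"
    using assms(2) by (auto simp: planar_def)
  have edge: "e \<subseteq> pverts G \<and> card e = 2" if "e \<in> ?E" for e
  proof -
    obtain u v where uv: "e = {u, v}" "(u, v) \<in> parcs G"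
      using \<open>e \<in> ?E\<close> by (auto simp: uedges_def)
    then have "u \<noteq> v" using pair_no_loops[of "(u, v)"] by auto
    then show ?thesis using uv in_arcsD1 in_arcsD2 by auto
  qed
  define conf where "conf u i v j \<longleftrightarrow> {(u, i), (v, j)} \<in> M {u, v}" for u i v j
  interpret dp_drawn_graph "pverts G" ?E p \<gamma> L conf
  proof
    show "finite (pverts G)" by (rule pair_finite_verts)
    show "e \<subseteq> pverts G \<and> card e = 2" if "e \<in> ?E" for e using edge[OF that] .
    show "inj_on p (pverts G)" using draw by (simp add: plane_drawing_def)
    show "Path_Connected.arc (\<gamma> e)"
      "{pathstart (\<gamma> e), pathfinish (\<gamma> e)} = p ` e"
      "path_image (\<gamma> e) \<inter> p ` pverts G = p ` e" if "e \<in> ?E" for e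
      using draw that by (simp_all add: plane_drawing_def)
    show "path_image (\<gamma> e) \<inter> path_image (\<gamma> e') \<subseteq> p ` (e \<inter> e')"
      if "e \<in> ?E" "e' \<in> ?E" "e \<noteq> e'" for e e'
      using draw that by (simp add: plane_drawing_def)
    show "finite (L v) \<and> 4 \<le> card (L v)" if "v \<in> pverts G" for v using L that by blast
    show "conf v j u i" if "conf u i v j" for u i v j
      using that by (simp add: conf_def insert_commute)
    show "j = j'" if "{u, v} \<in> ?E" "conf u i v j" "conf u i v j'" for u v i j j'
    proof (rule ccontr)
      assume "j \<noteq> j'"
      have uv: "(u, v) \<in> parcs G" using that(1) E_iff by simp
      then have "u \<noteq> v" using pair_no_loops[of "(u, v)"] by auto
      have "pairwise disjnt (M {u, v})"
        using M uv by (auto simp: matching_assignment_def matching_between_def)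
      moreover have "{(u, i), (v, j)} \<noteq> {(u, i), (v, j')}"
        using \<open>j \<noteq> j'\<close> \<open>u \<noteq> v\<close>
        by (simp add: doubleton_eq_iff)
      ultimately have "disjnt {(u, i), (v, j)} {(u, i), (v, j')}"
        using that(2,3) unfolding conf_def by (meson pairwiseD)
      then show False by (simp add: disjnt_def)
    qed
    show False if d: "distinct [a, b, c, d]" and
      "{{a, b}, {b, c}, {c, d}, {d, a}, {a, x}, {b, x}} \<subseteq> ?E" for a b c d x
    proof -
      have arcs: "(a, b) \<in> parcs G" "(b, c) \<in> parcs G" "(c, d) \<in> parcs G"
        "(d, a) \<in> parcs G"
        "{a, x} \<in> ?E" "(b, x) \<in> parcs G" using that(2) by (simp_all add: E_iff)
      have xa: "(x, a) \<in> parcs G" using arcs(5) E_iff[of x a] by (simp add: insert_commute)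
      \<comment> \<open>Although \<open>x\<close> may lie on the 4-cycle, it differs from
        \<open>a\<close> and \<open>b\<close> as there are no loops, so \<open>a\<close>,
        \<open>b\<close>, \<open>x\<close> always form a triangle on the edge
        \<open>ab\<close>.\<close>
      have "x \<noteq> a" "x \<noteq> b"
        using pair_no_loops[of "(x, a)"] pair_no_loops[of "(b, x)"] xa arcs(6) by auto
      then have "distinct [a, b, x]" using d by auto
      moreover have "adjacent_cycles [(a, b), (b, c), (c, d), (d, a)] [(a, b), (b, x), (x, a)]"
        by (auto simp: adjacent_cycles_def uedges_def)
      ultimately show False
        using assms(3) k_cycle_4[OF assms(1) d arcs(1-4)] k_cycle_3[OF assms(1) _ arcs(1,6) xa]
        by blast
    qed
  qed
  obtain \<phi> where \<phi>: "proper (pverts G) \<phi>"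
  proof (cases "pverts G = {}")
    case True
    then show ?thesis using that by (simp add: proper_def)
  next
    case False
    then obtain w where w: "w \<in> pverts G" by auto
    then have "card (L w) > 0" using L by fastforce
    then obtain c0 where "c0 \<in> L w" by fastforce
    then show ?thesis using proper_coloring_rooted[OF order_refl w] that by blast
  qed
  let ?I = "(\<lambda>v. (v, \<phi> v)) ` pverts G"
  have "independent_set (cover_graph G L M) ?I"
    using \<phi> by (fastforce simp: independent_set_def cover_graph_def proper_def conf_def E_iff)
  moreover have "card ?I = card (pverts G)"
    by (rule card_image) (simp add: inj_on_def)
  ultimately show "\<exists>I. dp_coloring G L M I"
    unfolding dp_coloring_def by blast
qed

end
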